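(* Let $\lambda\in(0,\Lambda)$, where $$\Lambda:= \frac{p-1+q}{r+q} \left(\frac{r-p+1}{r+q}\right)^{\frac{r-p+1}{p-1+q}} \frac{1}{\|b\|} \left(\frac{S^{r+q}}{\|a\|^{r-p+1}}\right)^{\frac{1}{p-1+q}}.$$ Then the problem $$(P_\lambda)\quad -2\int_{\mathbb R^n}\frac{|w(y)-w(x)|^{p-2}(w(y)-w(x))}{|x-y|^{n+ps}}\,dy = a(x)w^{-q}+\lambda b(x)w^r \ \text{in } \Omega,\qquad w>0 \text{ in } \Omega,\qquad w=0 \text{ in } \mathbb R^n\setminus\Omega,$$ has at least two (weak) solutions $w\in\mathcal N_\lambda^{+}$ and $W\in\mathcal N_\lambda^{-}$, with $\|W\|>\|w\|$.
   Context: Standing assumptions: $s\in(0,1)$, $n>ps$, $\Omega\subset\mathbb R^n$ is a bounded domain with smooth boundary and $0\in\Omega$, $p_s^*=\frac{np}{n-ps}$, $0<q<1$, $q<p-1<r<p_s^*-1$. The function $a:\Omega\to\mathbb R$ satisfies $a>0$ and $a\in L^{\frac{p_s^*}{p_s^*-1+q}}(\Omega)$; $b:\Omega\to\mathbb R$ is sign-changing with $b^+\not\equiv0$ and $b\in L^{\frac{p_s^*}{p_s^*-1-r}}(\Omega)$. $\|a\|,\|b\|$ denote the norms of $a,b$ in these respective spaces. Let $Q=\mathbb R^{2n}\setminus((\mathbb R^n\setminus\Omega)\times(\mathbb R^n\setminus\Omega))$. $X_0$ is the space of measurable $w:\mathbb R^n\to\mathbb R$ with $w|_\Omega\in L^p(\Omega)$,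 $\frac{w(x)-w(y)}{|x-y|^{(n+ps)/p}}\in L^p(Q)$ and $w=0$ a.e. in $\mathbb R^n\setminus\Omega$, with the norm $\|w\|=\left(\int_Q\frac{|w(x)-w(y)|^p}{|x-y|^{n+ps}}\,dx\,dy\right)^{1/p}$. Put $$S=\inf_{w\in X_0\setminus\{0\}}\frac{\int_{\mathbb R^{2n}}|w(x)-w(y)|^p|x-y|^{-(n+ps)}\,dx\,dy}{\left(\int_{\mathbb R^n}|w|^{p_s^*}dx\right)^{p/p_s^*}}.$$ With $w_+=\max\{w,0\}$ and $\lambda>0$, let $$\mathcal N_\lambda=\left\{w\in X_0:\ \|w\|^p=\int_\Omega a\,w_+^{1-q}dx+\lambda\int_\Omega b\,w_+^{r+1}dx\right\},$$ $\mathcal N_\lambda^{+}$ (resp. $\mathcal N_\lambda^{-}$) $=\{w\in\mathcal N_\lambda: (p-1+q)\|w\|^p>\lambda(r+q)\int_\Omega b\,w_+^{r+1}dx\}$ (resp. with $<$). A (weak) solution of $(P_\lambda)$ is $w\in X_0$ with $w>0$ in $\Omega$ such that for every $v\in X_0$ $$\int_Q\frac{|w(x)-w(y)|^{p-2}(w(x)-w(y))(v(x)-v(y))}{|x-y|^{n+ps}}dx\,dy=\int_\Omega a\,w^{-q}v\,dx+\lambda\int_\Omega b\,w^rv\,dx.$$ *)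

theory Defs
  imports "HOL-Analysis.Analysis"
begin

section \<open>Domains with smooth boundary\<close>

primrec C_k :: "nat \<Rightarrow> ('a::euclidean_space \<Rightarrow> real) \<Rightarrow> bool" where
  "C_k 0 f \<longleftrightarrow> continuous_on UNIV f"
| "C_k (Suc k) f \<longleftrightarrow> f differentiable_on UNIV \<and>
     (\<forall>v\<in>Basis. C_k k (\<lambda>x. frechet_derivative f (at x) v))"

definition smooth :: "('a::euclidean_space \<Rightarrow> real) \<Rightarrow> bool" where
  "smooth f \<longleftrightarrow> (\<forall>k. C_k k f)"

text \<open>Near each boundary point the set is the part of a ball lying above the graph of a smooth
  function. The vector \<open>\<nu>\<close> is the vertical direction; a function on the hyperplane orthogonal
  to \<open>\<nu>\<close> is encoded as a function on the whole space that is constant along \<open>\<nu>\<close>.\<close>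

definition smooth_boundary :: "'a::euclidean_space set \<Rightarrow> bool" where
  "smooth_boundary \<Omega> \<longleftrightarrow>
     (\<forall>x0\<in>frontier \<Omega>. \<exists>\<delta>>0. \<exists>\<nu> \<gamma>. norm \<nu> = 1 \<and> smooth \<gamma> \<and>
        (\<forall>x t. \<gamma> (x + t *\<^sub>R \<nu>) = \<gamma> x) \<and>
        \<Omega> \<inter> ball x0 \<delta> = {x \<in> ball x0 \<delta>. \<gamma> x < x \<bullet> \<nu>})"

section \<open>Lebesgue spaces and the space \<open>X0\<close>\<close>

definition Lp :: "real \<Rightarrow> 'a::euclidean_space set \<Rightarrow> ('a \<Rightarrow> real) set" where
  "Lp m A = {f \<in> borel_measurable (lebesgue_on A).
     integrable (lebesgue_on A) (\<lambda>x. \<bar>f x\<bar> powr m)}"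

definition Lp_norm :: "real \<Rightarrow> 'a::euclidean_space set \<Rightarrow> ('a \<Rightarrow> real) \<Rightarrow> real" where
  "Lp_norm m A f = (LINT x|lebesgue_on A. \<bar>f x\<bar> powr m) powr (1 / m)"

definition p_star :: "real \<Rightarrow> real \<Rightarrow> real \<Rightarrow> real" where
  "p_star n p s = n * p / (n - p * s)"

definition Q :: "'a set \<Rightarrow> ('a \<times> 'a) set" where
  "Q \<Omega> = UNIV - (UNIV - \<Omega>) \<times> (UNIV - \<Omega>)"

text \<open>Elements are functions, not classes modulo null sets. On the diagonal, which is a null set
  of the product space, the quotient is \<open>0\<close>.\<close>

definition X0 :: "real \<Rightarrow> real \<Rightarrow> (real^'n) set \<Rightarrow> (real^'n \<Rightarrow> real) set" where
  "X0 p s \<Omega> = {w \<in> borel_measurable lebesgue.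
     w \<in> Lp p \<Omega> \<and>
     (\<lambda>(x, y). (w x - w y) / norm (x - y) powr ((real CARD('n) + p * s) / p)) \<in> Lp p (Q \<Omega>) \<and>
     (AE x in lebesgue. x \<notin> \<Omega> \<longrightarrow> w x = 0)}"

definition X0_norm :: "real \<Rightarrow> real \<Rightarrow> (real^'n) set \<Rightarrow> (real^'n \<Rightarrow> real) \<Rightarrow> real" where
  "X0_norm p s \<Omega> w =
     (LINT (x, y)|lebesgue_on (Q \<Omega>).
        \<bar>w x - w y\<bar> powr p / norm (x - y) powr (real CARD('n) + p * s)) powr (1 / p)"

text \<open>The integrals below are finite on \<open>X0\<close> and the denominator is positive, by the fractional
  Sobolev inequality; the zero element is the class of almost everywhere vanishing functions.\<close>

definition sobolev_S :: "real \<Rightarrow> real \<Rightarrow> (real^'n) set \<Rightarrow> real" where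
  "sobolev_S p s \<Omega> =
     (INF w \<in> {w \<in> X0 p s \<Omega>. \<not> (AE x in lebesgue. w x = 0)}.
        (LINT (x, y)|lebesgue.
           \<bar>w x - w y\<bar> powr p * norm (x - y) powr (- (real CARD('n) + p * s))) /
        (LINT x|lebesgue. \<bar>w x\<bar> powr p_star (real CARD('n)) p s)
           powr (p / p_star (real CARD('n)) p s))"

section \<open>Nehari sets, weak solutions and the threshold for \<open>\<lambda>\<close>\<close>

definition nehari ::
  "real \<Rightarrow> real \<Rightarrow> real \<Rightarrow> real \<Rightarrow> (real^'n) set \<Rightarrow> (real^'n \<Rightarrow> real) \<Rightarrow> (real^'n \<Rightarrow> real) \<Rightarrow> real
    \<Rightarrow> (real^'n \<Rightarrow> real) set" where
  "nehari p s q r \<Omega> a b l = {w \<in> X0 p s \<Omega>.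
     X0_norm p s \<Omega> w powr p =
       (LINT x|lebesgue_on \<Omega>. a x * max (w x) 0 powr (1 - q)) +
       l * (LINT x|lebesgue_on \<Omega>. b x * max (w x) 0 powr (r + 1))}"

definition nehari_plus ::
  "real \<Rightarrow> real \<Rightarrow> real \<Rightarrow> real \<Rightarrow> (real^'n) set \<Rightarrow> (real^'n \<Rightarrow> real) \<Rightarrow> (real^'n \<Rightarrow> real) \<Rightarrow> real
    \<Rightarrow> (real^'n \<Rightarrow> real) set" where
  "nehari_plus p s q r \<Omega> a b l = {w \<in> nehari p s q r \<Omega> a b l.
     (p - 1 + q) * X0_norm p s \<Omega> w powr p >
       l * (r + q) * (LINT x|lebesgue_on \<Omega>. b x * max (w x) 0 powr (r + 1))}"

definition nehari_minus ::
  "real \<Rightarrow> real \<Rightarrow> real \<Rightarrow> real \<Rightarrow> (real^'n) set \<Rightarrow> (real^'n \<Rightarrow> real) \<Rightarrow> (real^'n \<Rightarrow> real) \<Rightarrow> real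
    \<Rightarrow> (real^'n \<Rightarrow> real) set" where
  "nehari_minus p s q r \<Omega> a b l = {w \<in> nehari p s q r \<Omega> a b l.
     (p - 1 + q) * X0_norm p s \<Omega> w powr p <
       l * (r + q) * (LINT x|lebesgue_on \<Omega>. b x * max (w x) 0 powr (r + 1))}"

definition weak_integrand ::
  "real \<Rightarrow> real \<Rightarrow> (real^'n \<Rightarrow> real) \<Rightarrow> (real^'n \<Rightarrow> real) \<Rightarrow> (real^'n) \<times> (real^'n) \<Rightarrow> real" where
  "weak_integrand p s w v = (\<lambda>(x, y).
     \<bar>w x - w y\<bar> powr (p - 2) * (w x - w y) * (v x - v y) /
       norm (x - y) powr (real CARD('n) + p * s))"

text \<open>The Bochner integral of a non-integrable function is \<open>0\<close>, so the existence of the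
  integrals in the weak formulation, in particular of the singular one, is required explicitly.\<close>

definition weak_solution ::
  "real \<Rightarrow> real \<Rightarrow> real \<Rightarrow> real \<Rightarrow> (real^'n) set \<Rightarrow> (real^'n \<Rightarrow> real) \<Rightarrow> (real^'n \<Rightarrow> real) \<Rightarrow> real
    \<Rightarrow> (real^'n \<Rightarrow> real) \<Rightarrow> bool" where
  "weak_solution p s q r \<Omega> a b l w \<longleftrightarrow>
     w \<in> X0 p s \<Omega> \<and> (\<forall>x\<in>\<Omega>. w x > 0) \<and>
     (\<forall>v\<in>X0 p s \<Omega>.
        integrable (lebesgue_on (Q \<Omega>)) (weak_integrand p s w v) \<and>
        integrable (lebesgue_on \<Omega>) (\<lambda>x. a x * w x powr (- q) * v x) \<and>
        integrable (lebesgue_on \<Omega>) (\<lambda>x. b x * w x powr r * v x) \<and>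
        (LINT z|lebesgue_on (Q \<Omega>). weak_integrand p s w v z) =
          (LINT x|lebesgue_on \<Omega>. a x * w x powr (- q) * v x) +
          l * (LINT x|lebesgue_on \<Omega>. b x * w x powr r * v x))"

definition Lambda ::
  "real \<Rightarrow> real \<Rightarrow> real \<Rightarrow> real \<Rightarrow> (real^'n) set \<Rightarrow> (real^'n \<Rightarrow> real) \<Rightarrow> (real^'n \<Rightarrow> real)
    \<Rightarrow> real" where
  "Lambda p s q r \<Omega> a b =
     (let ps = p_star (real CARD('n)) p s;
          norm_a = Lp_norm (ps / (ps - 1 + q)) \<Omega> a;
          norm_b = Lp_norm (ps / (ps - 1 - r)) \<Omega> b
      in (p - 1 + q) / (r + q)
         * ((r - p + 1) / (r + q)) powr ((r - p + 1) / (p - 1 + q))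
         * (1 / norm_b)
         * (sobolev_S p s \<Omega> powr (r + q) / norm_a powr (r - p + 1)) powr (1 / (p - 1 + q)))"

end

theory Submission
  imports Defs "HOL-Complex_Analysis.Great_Picard"
begin

text \<open>With \<open>N = \<parallel>w\<parallel>\<^sup>p\<close>, \<open>A = \<integral> a w\<^sub>+\<^sup>1\<^sup>-\<^sup>q\<close> and \<open>B = \<integral> b w\<^sub>+\<^sup>r\<^sup>+\<^sup>1\<close>, the solutions are critical points of
  \<open>J = N / p - A / (1 - q) - \<lambda> B / (r + 1)\<close>. The bound \<open>\<lambda> < \<Lambda>\<close> says exactly that there is a radius \<open>R\<close>
  with \<open>N > A + \<lambda> B\<close> on the sphere \<open>\<parallel>w\<parallel> = R\<close>, and this sphere separates the two parts of the
  Nehari set. The first solution minimises \<open>J\<close> over the ball of radius \<open>R\<close>; the second minimises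
  \<open>J\<close> over the elements of the Nehari set outside the ball, where each point maximises \<open>J\<close> along its
  own ray. Minimising sequences have almost everywhere convergent subsequences, \<open>A\<close> and \<open>B\<close> pass to
  the limit and \<open>N\<close> is lower semicontinuous by Fatou's lemma.

  Because \<open>a > 0\<close> and \<open>0 < 1 - q < 1\<close>, the one-sided derivative of \<open>A\<close> at a function vanishing on a
  set of positive measure is infinite; hence a minimiser is positive almost everywhere, without
  a maximum principle. The same one-sided inequality gives integrability of \<open>a w\<^sup>-\<^sup>q \<phi>\<close>, after which
  \<open>J\<close> is differentiable in every direction.\<close>

section \<open>Integration lemmas\<close>

text \<open>Origin of the radius: by Hoelder and Sobolev, on the sphere of radius \<open>X\<close>
  the quantity \<open>N - A - l * B\<close> divided by \<open>X powr (1 - q)\<close> is at least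
  \<open>X powr (p - 1 + q) - l * cb * X powr (r + q) - ca\<close>. The first two terms together are
  largest at \<open>R\<close>, where
  \<open>l * cb * R powr (r - p + 1) = (p - 1 + q) / (r + q)\<close>, and \<open>Lambda\<close> is
  the value of \<open>l\<close> at which this maximum equals \<open>ca\<close>. The obstacle is that
  \<open>J\<close> is not differentiable before positivity is known, so neither a multiplier rule
  nor the implicit function theorem applies on the Nehari set. Both minimisers are treated through
  one weak notion, \<open>stationary\<close>: in every direction \<open>J\<close> does not decrease
  along some sequence of small steps, after a common rescaling of the old and the new point. The
  common factor tends to one and disappears in the limit. The second obstacle is loss of norm in the
  limit of a minimising sequence. The limit then leaves the Nehari set, but the triple made of the
  limit norm and the limits of \<open>A\<close> and \<open>B\<close> still satisfies its equation,
  and the fibre analysis needs nothing but such triples of numbers.\<close>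

lemma powr_add_le:
  fixes x y m :: real
  assumes "m > 0"
  shows "\<bar>x + y\<bar> powr m \<le> 2 powr m * (\<bar>x\<bar> powr m + \<bar>y\<bar> powr m)"
proof -
  have "\<bar>x + y\<bar> powr m \<le> (2 * max \<bar>x\<bar> \<bar>y\<bar>) powr m"
    using assms by (intro powr_mono2) auto
  also have "\<dots> = 2 powr m * (max \<bar>x\<bar> \<bar>y\<bar>) powr m"
    by (simp add: powr_mult)
  also have "\<dots> \<le> 2 powr m * (\<bar>x\<bar> powr m + \<bar>y\<bar> powr m)"
    by (intro mult_left_mono) (auto simp: max_def)
  finally show ?thesis .
qed

lemma integrable_powr_add:
  fixes F G :: "'a \<Rightarrow> real"
  assumes m: "m > 0"
    and [measurable]: "F \<in> borel_measurable M" "G \<in> borel_measurable M"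
    and "integrable M (\<lambda>x. \<bar>F x\<bar> powr m)" "integrable M (\<lambda>x. \<bar>G x\<bar> powr m)"
  shows "integrable M (\<lambda>x. \<bar>F x + G x\<bar> powr m)"
proof (rule Bochner_Integration.integrable_bound)
  show "integrable M (\<lambda>x. 2 powr m * (\<bar>F x\<bar> powr m + \<bar>G x\<bar> powr m))"
    using assms by auto
  show "AE x in M. norm (\<bar>F x + G x\<bar> powr m) \<le> norm (2 powr m * (\<bar>F x\<bar> powr m + \<bar>G x\<bar> powr m))"
    using powr_add_le[OF m] by auto
qed measurable

text \<open>Young's inequality gives integrability pointwise, and the bound after normalising both
  factors. The constant one matters: it enters \<open>ca\<close> and \<open>cb\<close>, hence the
  exact comparison with \<open>Lambda\<close>.\<close>

lemma Hoelder:
  fixes f g :: "'a \<Rightarrow> real"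
  assumes mm: "m > 1" "m' > 1" "1 / m + 1 / m' = 1"
    and [measurable]: "f \<in> borel_measurable M" "g \<in> borel_measurable M"
    and f: "integrable M (\<lambda>x. \<bar>f x\<bar> powr m)" and g: "integrable M (\<lambda>x. \<bar>g x\<bar> powr m')"
  shows "integrable M (\<lambda>x. f x * g x)"
    and "\<bar>LINT x|M. f x * g x\<bar> \<le>
      (LINT x|M. \<bar>f x\<bar> powr m) powr (1 / m) * (LINT x|M. \<bar>g x\<bar> powr m') powr (1 / m')"
proof -
  have bd: "\<bar>f x * g x\<bar> \<le> \<bar>f x\<bar> powr m / m + \<bar>g x\<bar> powr m' / m'" for x
    using Youngs_inequality[OF mm, of "\<bar>f x\<bar>" "\<bar>g x\<bar>"] by (simp add: abs_mult)
  show int: "integrable M (\<lambda>x. f x * g x)"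
  proof (rule Bochner_Integration.integrable_bound)
    show "integrable M (\<lambda>x. \<bar>f x\<bar> powr m / m + \<bar>g x\<bar> powr m' / m')"
      using f g by auto
    show "AE x in M. norm (f x * g x) \<le> norm (\<bar>f x\<bar> powr m / m + \<bar>g x\<bar> powr m' / m')"
      using bd by (intro AE_I2) (smt (verit, best) real_norm_def)
  qed measurable
  define I where "I = (LINT x|M. \<bar>f x\<bar> powr m)"
  define K where "K = (LINT x|M. \<bar>g x\<bar> powr m')"
  have I0: "I \<ge> 0" and K0: "K \<ge> 0" by (auto simp: I_def K_def)
  show "\<bar>LINT x|M. f x * g x\<bar> \<le>
      (LINT x|M. \<bar>f x\<bar> powr m) powr (1 / m) * (LINT x|M. \<bar>g x\<bar> powr m') powr (1 / m')"
  proof (cases "I = 0 \<or> K = 0")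
    case True
    have "AE x in M. f x * g x = 0"
    proof (cases "I = 0")
      case True
      then have "AE x in M. \<bar>f x\<bar> powr m = 0"
        using integral_nonneg_eq_0_iff_AE[OF f] by (auto simp: I_def)
      then show ?thesis by eventually_elim auto
    next
      case False
      then have "K = 0" using \<open>I = 0 \<or> K = 0\<close> by auto
      then have "AE x in M. \<bar>g x\<bar> powr m' = 0"
        using integral_nonneg_eq_0_iff_AE[OF g] by (auto simp: K_def)
      then show ?thesis by eventually_elim auto
    qed
    then have "(LINT x|M. f x * g x) = (LINT x|M. 0)"
      by (intro integral_cong_AE) auto
    then show ?thesis by simp
  next
    case False
    with I0 K0 have I: "I > 0" and K: "K > 0" by auto
    \<comment> \<open>Young is applied to \<open>f / u\<close> and \<open>g / v\<close>, whose
      powers integrate to one; this turns the sum into the product of the norms.\<close>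
    define u where "u = I powr (1 / m)"
    define v where "v = K powr (1 / m')"
    have u: "u > 0" "u powr m = I" and v: "v > 0" "v powr m' = K"
      using I K mm by (auto simp: u_def v_def powr_powr)
    have "\<bar>LINT x|M. f x * g x\<bar> \<le> (LINT x|M. \<bar>f x * g x\<bar>)"
      by (rule integral_abs_bound)
    also have "\<dots> \<le> (LINT x|M. u * v * (\<bar>f x\<bar> powr m / (I * m) + \<bar>g x\<bar> powr m' / (K * m')))"
    proof (rule integral_mono)
      show "integrable M (\<lambda>x. \<bar>f x * g x\<bar>)" using int by auto
      show "integrable M (\<lambda>x. u * v * (\<bar>f x\<bar> powr m / (I * m) + \<bar>g x\<bar> powr m' / (K * m')))"
        using f g by auto
      fix x
      have "\<bar>f x\<bar> / u * (\<bar>g x\<bar> / v) \<le> (\<bar>f x\<bar> / u) powr m / m + (\<bar>g x\<bar> / v) powr m' / m'"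
        using u v by (intro Youngs_inequality mm) auto
      also have "\<dots> = \<bar>f x\<bar> powr m / (I * m) + \<bar>g x\<bar> powr m' / (K * m')"
        using u v by (simp add: powr_divide)
      finally show "\<bar>f x * g x\<bar> \<le> u * v * (\<bar>f x\<bar> powr m / (I * m) + \<bar>g x\<bar> powr m' / (K * m'))"
        using u(1) v(1) by (simp add: field_simps abs_mult)
    qed
    also have "\<dots> = u * v * (I / (I * m) + K / (K * m'))"
      using f g by (simp add: I_def K_def)
    also have "\<dots> = u * v"
      using I K mm by simp
    finally show ?thesis by (simp add: u_def v_def I_def K_def)
  qed
qed

text \<open>Finiteness of the nonnegative integral of the limit supplies its integrability; this is
  how limit functions are later shown to have finite energy.\<close>

lemma Fatou_integral_le:
  fixes F :: "nat \<Rightarrow> 'a \<Rightarrow> real"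
  assumes [measurable]: "\<And>n. F n \<in> borel_measurable M" "G \<in> borel_measurable M"
    and int: "\<And>n. integrable M (F n)" and nn: "\<And>n x. F n x \<ge> 0"
    and lim: "AE x in M. (\<lambda>n. F n x) \<longlonglongrightarrow> G x"
    and le: "(\<lambda>n. integral\<^sup>L M (F n)) \<longlonglongrightarrow> c"
  shows "integrable M G" "integral\<^sup>L M G \<le> c"
proof -
  have G0: "AE x in M. G x \<ge> 0"
    using lim by eventually_elim (use nn in \<open>auto intro: LIMSEQ_le_const\<close>)
  have c0: "c \<ge> 0"
    using le by (rule LIMSEQ_le_const) (use nn in \<open>auto intro!: Bochner_Integration.integral_nonneg\<close>)
  have "(\<integral>\<^sup>+x. ennreal (G x) \<partial>M) = (\<integral>\<^sup>+x. liminf (\<lambda>n. ennreal (F n x)) \<partial>M)"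
  proof (rule nn_integral_cong_AE)
    show "AE x in M. ennreal (G x) = liminf (\<lambda>n. ennreal (F n x))"
      using lim
      by eventually_elim (intro lim_imp_Liminf[symmetric] tendsto_ennrealI, auto)
  qed
  also have "\<dots> \<le> liminf (\<lambda>n. \<integral>\<^sup>+x. ennreal (F n x) \<partial>M)"
    by (rule nn_integral_liminf) measurable
  also have "\<dots> = liminf (\<lambda>n. ennreal (integral\<^sup>L M (F n)))"
    using int nn by (simp add: nn_integral_eq_integral)
  also have "\<dots> = ennreal c"
    using le by (intro lim_imp_Liminf tendsto_ennrealI) auto
  finally have *: "(\<integral>\<^sup>+x. ennreal (G x) \<partial>M) \<le> ennreal c" .
  show iG: "integrable M G"
    using * G0 by (intro integrableI_nonneg) (auto simp: top_unique less_top[symmetric])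
  show "integral\<^sup>L M G \<le> c"
    using * c0 nn_integral_eq_integral[OF iG G0] by simp
qed

text \<open>A bounded sequence of integrals has a convergent subsequence whose limit is still at
  most \<open>C\<close>, which reduces the claim to the convergent case.\<close>

lemma Fatou_integral_bounded:
  fixes F :: "nat \<Rightarrow> 'a \<Rightarrow> real"
  assumes [measurable]: "\<And>n. F n \<in> borel_measurable M" "G \<in> borel_measurable M"
    and int: "\<And>n. integrable M (F n)" and nn: "\<And>n x. F n x \<ge> 0"
    and lim: "AE x in M. (\<lambda>n. F n x) \<longlonglongrightarrow> G x"
    and le: "\<And>n. integral\<^sup>L M (F n) \<le> C"
  shows "integrable M G" "integral\<^sup>L M G \<le> C"
proof -
  have "\<bar>integral\<^sup>L M (F n)\<bar> \<le> C" for n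
    using le[of n] nn by (simp add: abs_of_nonneg integral_nonneg)
  then have "bounded (range (\<lambda>n. integral\<^sup>L M (F n)))"
    by (auto simp: bounded_iff)
  then obtain c \<sigma> where s: "strict_mono \<sigma>" and c: "((\<lambda>n. integral\<^sup>L M (F n)) \<circ> \<sigma>) \<longlonglongrightarrow> c"
    using bounded_imp_convergent_subsequence by blast
  have "integrable M G \<and> integral\<^sup>L M G \<le> c"
  proof (intro conjI Fatou_integral_le[of "\<lambda>n. F (\<sigma> n)" M G c])
    show "AE x in M. (\<lambda>n. F (\<sigma> n) x) \<longlonglongrightarrow> G x"
      using lim by eventually_elim (use LIMSEQ_subseq_LIMSEQ[OF _ s] in \<open>auto simp: o_def\<close>)
    then show "AE x in M. (\<lambda>n. F (\<sigma> n) x) \<longlonglongrightarrow> G x" .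
    show "(\<lambda>n. integral\<^sup>L M (F (\<sigma> n))) \<longlonglongrightarrow> c" using c by (simp add: o_def)
    then show "(\<lambda>n. integral\<^sup>L M (F (\<sigma> n))) \<longlonglongrightarrow> c" .
  qed (use int nn in auto)
  moreover have "c \<le> C"
    using c le by (auto intro!: LIMSEQ_le_const2 simp: o_def)
  ultimately show "integrable M G" "integral\<^sup>L M G \<le> C" by auto
qed

text \<open>Young's inequality splits \<open>g (f\<^sub>n - f)\<close> into a dominated part and a part that is small
  uniformly in \<open>n\<close>.\<close>

lemma integral_mult_tendsto_of_bounded:
  fixes f :: "nat \<Rightarrow> 'a \<Rightarrow> real"
  assumes mm: "m > 1" "m' > 1" "1 / m + 1 / m' = 1"
    and [measurable]: "\<And>n. f n \<in> borel_measurable M" "h \<in> borel_measurable M"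
      "g \<in> borel_measurable M"
    and f: "\<And>n. integrable M (\<lambda>x. \<bar>f n x\<bar> powr m)"
    and C: "\<And>n. (LINT x|M. \<bar>f n x\<bar> powr m) \<le> C"
    and g: "integrable M (\<lambda>x. \<bar>g x\<bar> powr m')"
    and lim: "AE x in M. (\<lambda>n. f n x) \<longlonglongrightarrow> h x"
  shows "(\<lambda>n. LINT x|M. g x * f n x) \<longlonglongrightarrow> (LINT x|M. g x * h x)"
proof -
  have mm': "1 / m' + 1 / m = 1" using mm by simp
  have limp: "AE x in M. (\<lambda>n. \<bar>f n x\<bar> powr m) \<longlonglongrightarrow> \<bar>h x\<bar> powr m"
    using lim
  proof eventually_elim
    case (elim x)
    show ?case using tendsto_powr2[OF tendsto_rabs[OF elim] tendsto_const[of m]] mm by auto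
  qed
  have h: "integrable M (\<lambda>x. \<bar>h x\<bar> powr m)" and hC: "(LINT x|M. \<bar>h x\<bar> powr m) \<le> C"
    using Fatou_integral_bounded[of "\<lambda>n x. \<bar>f n x\<bar> powr m" M "\<lambda>x. \<bar>h x\<bar> powr m" C] f C limp by auto
  define d where "d n x = \<bar>f n x - h x\<bar>" for n x
  have d[measurable]: "d n \<in> borel_measurable M" for n by (simp add: d_def[abs_def])
  have dle: "d n x powr m \<le> 2 powr m * (\<bar>f n x\<bar> powr m + \<bar>h x\<bar> powr m)" for n x
    using powr_add_le[of m "f n x" "- h x"] mm by (simp add: d_def)
  have di: "integrable M (\<lambda>x. d n x powr m)" for n
    using integrable_powr_add[of m "f n" M "\<lambda>x. - h x"] f[of n] h mm by (simp add: d_def)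
  \<comment> \<open>The added one makes \<open>C2\<close> positive, so that it can be a denominator
    below.\<close>
  define C2 where "C2 = 2 powr m * (2 * C) + 1"
  have dC: "(LINT x|M. d n x powr m) \<le> C2" for n
  proof -
    have "(LINT x|M. d n x powr m) \<le> (LINT x|M. 2 powr m * (\<bar>f n x\<bar> powr m + \<bar>h x\<bar> powr m))"
      using f h di dle by (intro integral_mono) auto
    also have "\<dots> = 2 powr m * ((LINT x|M. \<bar>f n x\<bar> powr m) + (LINT x|M. \<bar>h x\<bar> powr m))"
      using f h by simp
    also have "\<dots> \<le> 2 powr m * (C + C)"
      using C[of n] hC by (intro mult_left_mono add_mono) auto
    finally show ?thesis by (simp add: C2_def)
  qed
  have "C \<ge> 0" using C[of 0] by (rule order_trans[rotated]) simp
  then have C2: "C2 > 0" by (simp add: C2_def add_nonneg_pos)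
  have gf: "integrable M (\<lambda>x. g x * f n x)" for n
    by (rule Hoelder(1)[OF mm(2,1) mm' _ _ g f]) auto
  have gh: "integrable M (\<lambda>x. g x * h x)"
    by (rule Hoelder(1)[OF mm(2,1) mm' _ _ g h]) auto
  have gd: "integrable M (\<lambda>x. \<bar>g x\<bar> * d n x)" for n
  proof -
    have "\<bar>g x\<bar> * d n x = norm (g x * f n x - g x * h x)" for x
      by (simp add: d_def right_diff_distrib flip: abs_mult)
    then show ?thesis using gf[of n] gh by simp
  qed
  have main: "(\<lambda>n. LINT x|M. \<bar>g x\<bar> * d n x) \<longlonglongrightarrow> 0"
  proof (rule LIMSEQ_I)
    fix e :: real assume e: "e > 0"
    \<comment> \<open>Scaled so that the Young term with \<open>\<delta> powr m\<close> contributes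
      at most \<open>e / 2\<close> for every \<open>n\<close>. The other Young term \<open>k\<close>
      may be large, but it does not depend on \<open>n\<close>.\<close>
    define \<delta> where "\<delta> = (e / (2 * C2)) powr (1 / m)"
    have \<delta>: "\<delta> > 0" "\<delta> powr m = e / (2 * C2)"
      using e C2 mm by (auto simp: \<delta>_def powr_powr)
    define k where "k x = \<bar>g x / \<delta>\<bar> powr m'" for x
    have [measurable]: "k \<in> borel_measurable M" by (simp add: k_def[abs_def])
    have ki: "integrable M k"
      using g by (simp add: k_def[abs_def] abs_divide powr_divide)
    have young: "\<bar>g x\<bar> * d n x \<le> \<delta> powr m * d n x powr m + k x" for n x
    proof -
      have "\<bar>g x\<bar> * d n x = (\<delta> * d n x) * \<bar>g x / \<delta>\<bar>" using \<delta> by (simp add: abs_divide)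
      also have "\<dots> \<le> (\<delta> * d n x) powr m / m + \<bar>g x / \<delta>\<bar> powr m' / m'"
        using \<delta> by (intro Youngs_inequality mm) (auto simp: d_def)
      also have "\<dots> \<le> (\<delta> * d n x) powr m + \<bar>g x / \<delta>\<bar> powr m'"
        using mm by (intro add_mono) (simp_all add: divide_le_eq mult_left_le mult_le_cancel_left1)
      finally show ?thesis by (simp add: k_def powr_mult)
    qed
    \<comment> \<open>The minimum is dominated by \<open>k\<close>, and what it cuts off from
      \<open>\<bar>g x\<bar> * d n x\<close> is covered by the uniformly small Young term.\<close>
    have lim0: "(\<lambda>n. LINT x|M. min (\<bar>g x\<bar> * d n x) (k x)) \<longlonglongrightarrow> (LINT x|M. 0)"
    proof (rule integral_dominated_convergence[where w=k])
      show "AE x in M. (\<lambda>n. min (\<bar>g x\<bar> * d n x) (k x)) \<longlonglongrightarrow> 0"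
        using lim
      proof eventually_elim
        case (elim x)
        have "(\<lambda>n. d n x) \<longlonglongrightarrow> \<bar>h x - h x\<bar>" unfolding d_def by (intro tendsto_intros elim)
        then have "(\<lambda>n. min (\<bar>g x\<bar> * d n x) (k x)) \<longlonglongrightarrow> min (\<bar>g x\<bar> * \<bar>h x - h x\<bar>) (k x)"
          by (intro tendsto_min tendsto_mult tendsto_const)
        then show ?case by (simp add: k_def)
      qed
      show "AE x in M. norm (min (\<bar>g x\<bar> * d n x) (k x)) \<le> k x" for n
        by (auto simp: k_def d_def min_def)
    qed (use ki in auto)
    then obtain N where N: "\<And>n. n \<ge> N \<Longrightarrow> \<bar>LINT x|M. min (\<bar>g x\<bar> * d n x) (k x)\<bar> < e / 2"
      using LIMSEQ_D[OF lim0, of "e/2"] e by auto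
    show "\<exists>N. \<forall>n\<ge>N. norm ((LINT x|M. \<bar>g x\<bar> * d n x) - 0) < e"
    proof (intro exI allI impI)
      fix n assume n: "n \<ge> N"
      have mi: "integrable M (\<lambda>x. min (\<bar>g x\<bar> * d n x) (k x))"
        by (rule Bochner_Integration.integrable_bound[OF ki]) (auto simp: k_def d_def min_def)
      have "(LINT x|M. \<bar>g x\<bar> * d n x) \<le>
          (LINT x|M. min (\<bar>g x\<bar> * d n x) (k x) + \<delta> powr m * d n x powr m)"
      proof (intro integral_mono gd)
        show "\<bar>g x\<bar> * d n x \<le> min (\<bar>g x\<bar> * d n x) (k x) + \<delta> powr m * d n x powr m" for x
          using young[of x n] by (auto simp: min_def)
      qed (use mi di in auto)
      also have "\<dots> = (LINT x|M. min (\<bar>g x\<bar> * d n x) (k x)) + \<delta> powr m * (LINT x|M. d n x powr m)"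
        using mi di by simp
      also have "\<dots> < e / 2 + e / 2"
      proof (intro add_less_le_mono)
        show "(LINT x|M. min (\<bar>g x\<bar> * d n x) (k x)) < e / 2" using N[OF n] by linarith
        have "\<delta> powr m * (LINT x|M. d n x powr m) \<le> \<delta> powr m * C2"
          by (intro mult_left_mono dC) auto
        also have "\<dots> = e / 2" using \<delta> C2 by simp
        finally show "\<delta> powr m * (LINT x|M. d n x powr m) \<le> e / 2" .
      qed
      finally show "norm ((LINT x|M. \<bar>g x\<bar> * d n x) - 0) < e"
        by (simp add: d_def abs_of_nonneg)
    qed
  qed
  show ?thesis
  proof (rule LIM_zero_cancel, rule tendsto_rabs_zero_cancel, rule tendsto_sandwich[OF _ _ tendsto_const main])
    show "\<forall>\<^sub>F n in sequentially. \<bar>(LINT x|M. g x * f n x) - (LINT x|M. g x * h x)\<bar> \<le> (LINT x|M. \<bar>g x\<bar> * d n x)"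
    proof (intro always_eventually allI)
      fix n
      have "\<bar>(LINT x|M. g x * f n x) - (LINT x|M. g x * h x)\<bar> = \<bar>LINT x|M. g x * f n x - g x * h x\<bar>"
        using gf gh by simp
      also have "\<dots> \<le> (LINT x|M. \<bar>g x * f n x - g x * h x\<bar>)" by (rule integral_abs_bound)
      also have "\<dots> = (LINT x|M. \<bar>g x\<bar> * d n x)"
        by (simp add: d_def abs_mult flip: right_diff_distrib)
      finally show "\<bar>(LINT x|M. g x * f n x) - (LINT x|M. g x * h x)\<bar> \<le> (LINT x|M. \<bar>g x\<bar> * d n x)" .
    qed
  qed auto
qed

section \<open>Differentiation under the integral sign and almost everywhere convergent
  subsequences\<close>

text \<open>The growth bound on \<open>\<Phi>'\<close> and the mean value inequality dominate all
  difference quotients with steps at most one by a multiple of \<open>\<bar>k\<bar>\<close> times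
  \<open>\<bar>F\<bar> powr e + \<bar>G\<bar> powr e\<close>. The weight \<open>k\<close> may change
  sign; the two instances are the energy, with weight one, and the integral containing
  \<open>b\<close>.\<close>

lemma integral_Gateaux_derivative:
  fixes F G k :: "'a \<Rightarrow> real" and \<Phi> \<Phi>' :: "real \<Rightarrow> real"
  assumes e: "e > 1"
    and \<Phi>: "\<And>x. (\<Phi> has_real_derivative \<Phi>' x) (at x)" "\<And>x. \<bar>\<Phi>' x\<bar> \<le> c * \<bar>x\<bar> powr (e - 1)"
    and [measurable]: "\<Phi>' \<in> borel_measurable borel"
      "F \<in> borel_measurable M" "G \<in> borel_measurable M" "k \<in> borel_measurable M"
    and kF: "integrable M (\<lambda>x. k x * \<bar>F x\<bar> powr e)" and kG: "integrable M (\<lambda>x. k x * \<bar>G x\<bar> powr e)"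
    and int: "\<And>t. integrable M (\<lambda>x. k x * \<Phi> (F x + t * G x))"
    and \<epsilon>: "\<epsilon> \<longlonglongrightarrow> 0" "\<And>j. 0 < \<epsilon> j" "\<And>j. \<epsilon> j \<le> 1"
  shows "integrable M (\<lambda>x. k x * \<Phi>' (F x) * G x)"
    and "(\<lambda>j. ((LINT x|M. k x * \<Phi> (F x + \<epsilon> j * G x)) - (LINT x|M. k x * \<Phi> (F x))) / \<epsilon> j)
      \<longlonglongrightarrow> (LINT x|M. k x * \<Phi>' (F x) * G x)"
proof -
  have c: "c \<ge> 0" using \<Phi>(2)[of 1] by simp
  have int0: "integrable M (\<lambda>x. k x * \<Phi> (F x))" using int[of 0] by simp
  define D where "D j x = (k x * \<Phi> (F x + \<epsilon> j * G x) - k x * \<Phi> (F x)) / \<epsilon> j" for j x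
  have Di: "integrable M (D j)" for j
    unfolding D_def by (intro integrable_divide Bochner_Integration.integrable_diff int int0)
  define w where "w x = c * 2 powr e * (\<bar>k x * \<bar>F x\<bar> powr e\<bar> + \<bar>k x * \<bar>G x\<bar> powr e\<bar>)" for x
  have wi: "integrable M w" unfolding w_def using kF kG
    by (intro integrable_mult_right Bochner_Integration.integrable_add integrable_abs)
  have bd: "c * (\<bar>F x\<bar> + \<bar>G x\<bar>) powr (e - 1) * \<bar>G x\<bar> * \<bar>k x\<bar> \<le> w x" for x
  proof -
    have "(\<bar>F x\<bar> + \<bar>G x\<bar>) powr (e - 1) * \<bar>G x\<bar> \<le> (\<bar>F x\<bar> + \<bar>G x\<bar>) powr (e - 1) * (\<bar>F x\<bar> + \<bar>G x\<bar>)"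
      by (intro mult_left_mono) auto
    also have "\<dots> = (\<bar>F x\<bar> + \<bar>G x\<bar>) powr e"
      by (cases "\<bar>F x\<bar> + \<bar>G x\<bar> = 0") (auto simp: powr_mult_base mult.commute)
    also have "\<dots> \<le> 2 powr e * (\<bar>F x\<bar> powr e + \<bar>G x\<bar> powr e)"
      using powr_add_le[of e "\<bar>F x\<bar>" "\<bar>G x\<bar>"] e by simp
    finally have *: "(\<bar>F x\<bar> + \<bar>G x\<bar>) powr (e - 1) * \<bar>G x\<bar> \<le> 2 powr e * (\<bar>F x\<bar> powr e + \<bar>G x\<bar> powr e)" .
    have "c * \<bar>k x\<bar> * ((\<bar>F x\<bar> + \<bar>G x\<bar>) powr (e - 1) * \<bar>G x\<bar>)
        \<le> c * \<bar>k x\<bar> * (2 powr e * (\<bar>F x\<bar> powr e + \<bar>G x\<bar> powr e))"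
      using c by (intro mult_left_mono[OF *]) auto
    then show ?thesis by (simp add: w_def abs_mult algebra_simps)
  qed
  have Dlim: "(\<lambda>j. D j x) \<longlonglongrightarrow> k x * \<Phi>' (F x) * G x" for x
  \<comment> \<open>The increment \<open>\<epsilon> j * G x\<close> has to be nonzero to enter the
    difference quotient of \<open>\<Phi>\<close>; where \<open>G x = 0\<close> nothing
    moves.\<close>
  proof (cases "G x = 0")
    case True
    then show ?thesis by (simp add: D_def)
  next
    case False
    have "((\<lambda>h. (\<Phi> (F x + h) - \<Phi> (F x)) / h) \<longlongrightarrow> \<Phi>' (F x)) (at 0)"
      using \<Phi>(1) by (simp add: DERIV_def)
    moreover have "filterlim (\<lambda>j. \<epsilon> j * G x) (at 0) sequentially"
    proof -
      have "(\<lambda>j. \<epsilon> j * G x) \<longlonglongrightarrow> 0 * G x" by (intro tendsto_mult \<epsilon> tendsto_const)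
      then show ?thesis using False \<epsilon>(2) by (auto simp: filterlim_at less_le)
    qed
    ultimately have "((\<lambda>j. (\<Phi> (F x + \<epsilon> j * G x) - \<Phi> (F x)) / (\<epsilon> j * G x)) \<longlonglongrightarrow> \<Phi>' (F x))"
      by (rule filterlim_compose)
    then have "(\<lambda>j. k x * ((\<Phi> (F x + \<epsilon> j * G x) - \<Phi> (F x)) / (\<epsilon> j * G x)) * G x)
        \<longlonglongrightarrow> k x * \<Phi>' (F x) * G x"
      by (intro tendsto_intros)
    moreover have "k x * ((\<Phi> (F x + \<epsilon> j * G x) - \<Phi> (F x)) / (\<epsilon> j * G x)) * G x = D j x" for j
      using False \<epsilon>(2)[of j] by (simp add: D_def field_simps)
    ultimately show ?thesis by simp
  qed
  have Dbd: "norm (D j x) \<le> w x" for j x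
  proof -
    have "\<bar>\<Phi> (F x + \<epsilon> j * G x) - \<Phi> (F x)\<bar> \<le> c * (\<bar>F x\<bar> + \<bar>G x\<bar>) powr (e - 1) * \<bar>\<epsilon> j * G x\<bar>"
    proof -
      have *: "norm (\<Phi> y - \<Phi> z) \<le> c * (\<bar>F x\<bar> + \<bar>G x\<bar>) powr (e - 1) * norm (y - z)"
        if "y \<in> {- (\<bar>F x\<bar> + \<bar>G x\<bar>)..\<bar>F x\<bar> + \<bar>G x\<bar>}" "z \<in> {- (\<bar>F x\<bar> + \<bar>G x\<bar>)..\<bar>F x\<bar> + \<bar>G x\<bar>}" for y z
      proof (rule field_differentiable_bound[OF convex_real_interval(5) _ _ that])
        fix y assume y: "y \<in> {- (\<bar>F x\<bar> + \<bar>G x\<bar>)..\<bar>F x\<bar> + \<bar>G x\<bar>}"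
        show "(\<Phi> has_field_derivative \<Phi>' y) (at y within {- (\<bar>F x\<bar> + \<bar>G x\<bar>)..\<bar>F x\<bar> + \<bar>G x\<bar>})"
          using \<Phi>(1) by (rule has_field_derivative_at_within)
        have "\<bar>\<Phi>' y\<bar> \<le> c * \<bar>y\<bar> powr (e - 1)" by (rule \<Phi>)
        also have "\<dots> \<le> c * (\<bar>F x\<bar> + \<bar>G x\<bar>) powr (e - 1)"
          using y e c by (intro mult_left_mono powr_mono2) auto
        finally show "norm (\<Phi>' y) \<le> c * (\<bar>F x\<bar> + \<bar>G x\<bar>) powr (e - 1)" by simp
      qed
      have **: "\<bar>\<epsilon> j * G x\<bar> \<le> \<bar>G x\<bar>"
        using \<epsilon>(2,3)[of j] by (simp add: abs_mult mult_left_le_one_le)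
      have "norm (\<Phi> (F x + \<epsilon> j * G x) - \<Phi> (F x))
          \<le> c * (\<bar>F x\<bar> + \<bar>G x\<bar>) powr (e - 1) * norm (F x + \<epsilon> j * G x - F x)"
        using ** by (intro *) (simp_all, linarith+)
      then show ?thesis by simp
    qed
    then have "\<bar>k x\<bar> * \<bar>\<Phi> (F x + \<epsilon> j * G x) - \<Phi> (F x)\<bar>
        \<le> \<bar>k x\<bar> * (c * (\<bar>F x\<bar> + \<bar>G x\<bar>) powr (e - 1) * \<bar>\<epsilon> j * G x\<bar>)"
      by (intro mult_left_mono) auto
    also have "\<dots> = (c * (\<bar>F x\<bar> + \<bar>G x\<bar>) powr (e - 1) * \<bar>G x\<bar> * \<bar>k x\<bar>) * \<epsilon> j"
      using \<epsilon>(2)[of j] by (simp add: abs_mult)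
    finally have "\<bar>k x\<bar> * \<bar>\<Phi> (F x + \<epsilon> j * G x) - \<Phi> (F x)\<bar> / \<epsilon> j
        \<le> c * (\<bar>F x\<bar> + \<bar>G x\<bar>) powr (e - 1) * \<bar>G x\<bar> * \<bar>k x\<bar>"
      using \<epsilon>(2)[of j] by (simp only: pos_divide_le_eq)
    moreover have "norm (D j x) = \<bar>k x\<bar> * \<bar>\<Phi> (F x + \<epsilon> j * G x) - \<Phi> (F x)\<bar> / \<epsilon> j"
      using \<epsilon>(2)[of j] by (simp add: D_def abs_mult abs_divide flip: right_diff_distrib)
    ultimately have "norm (D j x) \<le> c * (\<bar>F x\<bar> + \<bar>G x\<bar>) powr (e - 1) * \<bar>G x\<bar> * \<bar>k x\<bar>"
      by simp
    also have "\<dots> \<le> w x" by (rule bd)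
    finally show ?thesis .
  qed
  have dc: "integrable M (\<lambda>x. k x * \<Phi>' (F x) * G x)"
      "(\<lambda>j. integral\<^sup>L M (D j)) \<longlonglongrightarrow> (LINT x|M. k x * \<Phi>' (F x) * G x)"
    by (rule integrable_dominated_convergence[where w=w and s=D] integral_dominated_convergence[where w=w and s=D];
        use wi Di Dlim Dbd in auto)+
  show "integrable M (\<lambda>x. k x * \<Phi>' (F x) * G x)" by (rule dc)
  have "integral\<^sup>L M (D j) = ((LINT x|M. k x * \<Phi> (F x + \<epsilon> j * G x)) - (LINT x|M. k x * \<Phi> (F x))) / \<epsilon> j" for j
    unfolding D_def using int int0 by simp
  then show "(\<lambda>j. ((LINT x|M. k x * \<Phi> (F x + \<epsilon> j * G x)) - (LINT x|M. k x * \<Phi> (F x))) / \<epsilon> j)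
      \<longlonglongrightarrow> (LINT x|M. k x * \<Phi>' (F x) * G x)"
    using dc(2) by simp
qed

text \<open>Along a fast subsequence consecutive terms differ by at most \<open>(1/2)^n\<close> in
  mean. The sum of the differences is then finite almost everywhere, and telescoping gives
  convergence.\<close>

lemma L1_Cauchy_AE_subseq:
  fixes u :: "nat \<Rightarrow> 'a \<Rightarrow> real"
  assumes int: "\<And>n. integrable M (u n)"
    and Cauchy: "\<And>e. e > 0 \<Longrightarrow> \<exists>N. \<forall>i\<ge>N. \<forall>j\<ge>N. (LINT x|M. \<bar>u i x - u j x\<bar>) < e"
  obtains \<sigma> where "strict_mono (\<sigma> :: nat \<Rightarrow> nat)" "AE x in M. convergent (\<lambda>n. u (\<sigma> n) x)"
proof -
  have "\<exists>N. \<forall>i\<ge>N. \<forall>j\<ge>N. (LINT x|M. \<bar>u i x - u j x\<bar>) < (1/2)^n" for n :: nat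
    by (rule Cauchy) simp
  then obtain N where N: "\<And>n i j. i \<ge> N n \<Longrightarrow> j \<ge> N n \<Longrightarrow> (LINT x|M. \<bar>u i x - u j x\<bar>) < (1/2)^n"
    by metis
  \<comment> \<open>The summand \<open>n\<close> forces strict growth, and the sum dominates each
    threshold \<open>N n\<close>.\<close>
  define \<sigma> where "\<sigma> n = n + (\<Sum>k\<le>n. N k)" for n
  have s: "strict_mono \<sigma>"
    by (rule strict_monoI_Suc) (simp add: \<sigma>_def)
  have ge: "\<sigma> n \<ge> N n" for n by (simp add: \<sigma>_def sum.atMost_Suc trans_le_add2 member_le_sum)
  have ge': "\<sigma> (Suc n) \<ge> N n" for n
    using ge[of n] s by (meson lessI less_imp_le order_trans strict_mono_less)
  define d where "d n x = \<bar>u (\<sigma> (Suc n)) x - u (\<sigma> n) x\<bar>" for n x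
  have di: "integrable M (d n)" for n unfolding d_def using int by auto
  have dle: "integral\<^sup>L M (d n) \<le> (1/2)^n" for n
    using N[OF ge' ge] by (simp add: d_def[abs_def] less_imp_le)
  have [measurable]: "d n \<in> borel_measurable M" for n using di by auto
  have "(\<integral>\<^sup>+x. (\<Sum>n. ennreal (d n x)) \<partial>M) = (\<Sum>n. \<integral>\<^sup>+x. ennreal (d n x) \<partial>M)"
    by (rule nn_integral_suminf) auto
  also have "\<dots> = (\<Sum>n. ennreal (integral\<^sup>L M (d n)))"
    using di by (subst nn_integral_eq_integral) (auto simp: d_def)
  also have "\<dots> \<le> (\<Sum>n. ennreal ((1/2)^n))"
    by (intro suminf_le ennreal_leI dle) auto
  also have "\<dots> = ennreal (\<Sum>n. (1/2)^n)"
    by (rule suminf_ennreal2) auto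
  finally have "(\<integral>\<^sup>+x. (\<Sum>n. ennreal (d n x)) \<partial>M) \<noteq> \<infinity>" by (auto simp: top_unique)
  then have "AE x in M. (\<Sum>n. ennreal (d n x)) \<noteq> \<infinity>"
    by (intro nn_integral_noteq_infinite) auto
  then have "AE x in M. convergent (\<lambda>n. u (\<sigma> n) x)"
  proof eventually_elim
    case (elim x)
    have "summable (\<lambda>n. \<bar>u (\<sigma> (Suc n)) x - u (\<sigma> n) x\<bar>)"
      using elim by (intro summable_suminf_not_top) (auto simp: d_def)
    then have "summable (\<lambda>n. u (\<sigma> (Suc n)) x - u (\<sigma> n) x)"
      by (rule summable_rabs_cancel)
    then have "convergent (\<lambda>n. \<Sum>k<n. u (\<sigma> (Suc k)) x - u (\<sigma> k) x)"
      by (simp add: summable_iff_convergent)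
    moreover have "(\<Sum>k<n. u (\<sigma> (Suc k)) x - u (\<sigma> k) x) = u (\<sigma> n) x - u (\<sigma> 0) x" for n
      by (rule sum_lessThan_telescope)
    ultimately have "convergent (\<lambda>n. u (\<sigma> n) x - u (\<sigma> 0) x)" by simp
    then obtain L where "(\<lambda>n. u (\<sigma> n) x - u (\<sigma> 0) x) \<longlonglongrightarrow> L" by (auto simp: convergent_def)
    then have "(\<lambda>n. u (\<sigma> n) x - u (\<sigma> 0) x + u (\<sigma> 0) x) \<longlonglongrightarrow> L + u (\<sigma> 0) x"
      by (intro tendsto_add tendsto_const)
    then have "(\<lambda>n. u (\<sigma> n) x) \<longlonglongrightarrow> L + u (\<sigma> 0) x" by (simp only: diff_add_cancel)
    then show ?case by (auto simp: convergent_def)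
  qed
  with s show ?thesis by (rule that)
qed

section \<open>Fibre maps\<close>

text \<open>\<open>ca\<close> and \<open>cb\<close> are the constants in the bounds of the singular
  and the superlinear integral by powers of the norm. \<open>R_eq\<close> is the first order
  condition for the maximum of \<open>X powr (p - 1 + q) - l * cb * X powr (r + q)\<close>; the
  maximal value is \<open>(r - p + 1) / (r + q) * R powr (p - 1 + q)\<close>, and \<open>gap\<close>
  says that it exceeds \<open>ca\<close>.\<close>

locale nehari_scalars =
  fixes p q r l ca cb R :: real
  assumes q: "0 < q" "q < 1" and qp: "q < p - 1" and pr: "p - 1 < r" and l: "0 < l"
    and cb: "0 < cb" and R: "0 < R"
    and R_eq: "R powr (r - p + 1) = (p - 1 + q) / (l * (r + q) * cb)"
    and gap: "ca < (r - p + 1) / (r + q) * R powr (p - 1 + q)"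
begin

lemma R_balance: "l * cb * R powr (r - p + 1) = (p - 1 + q) / (r + q)"
  using l cb q qp pr by (simp add: R_eq)

text \<open>The only information about a function that the fibre analysis uses. \<open>X\<close> is
  the norm itself, so the \<open>N\<close> of the overview is \<open>X powr p\<close>.\<close>

definition adm :: "real \<Rightarrow> real \<Rightarrow> real \<Rightarrow> bool" where
  "adm X A B \<longleftrightarrow> 0 \<le> X \<and> 0 \<le> A \<and> A \<le> ca * X powr (1 - q) \<and> \<bar>B\<bar> \<le> cb * X powr (r + 1)"

definition J :: "real \<Rightarrow> real \<Rightarrow> real \<Rightarrow> real" where
  "J X A B = X powr p / p - A / (1 - q) - l * B / (r + 1)"

text \<open>This is \<open>t powr q\<close> times the derivative of \<open>J\<close> along the ray.
  Removing the singular factor \<open>t powr (- q)\<close> leaves an expression that becomes concave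
  after a change of variable.\<close>

definition fibre :: "real \<Rightarrow> real \<Rightarrow> real \<Rightarrow> real \<Rightarrow> real" where
  "fibre X A B t = t powr (p - 1 + q) * X powr p - A - l * t powr (r + q) * B"

lemma adm_scale: "adm X A B \<Longrightarrow> t > 0 \<Longrightarrow> adm (t * X) (t powr (1 - q) * A) (t powr (r + 1) * B)"
  by (auto simp: adm_def powr_mult abs_mult intro!: mult_left_mono mult_nonneg_nonneg
      simp: mult.left_commute[of ca] mult.left_commute[of cb])

text \<open>Homogeneity of degree \<open>1 - q\<close> is factored out, so for positive
  \<open>t\<close> the zeros of \<open>fibre\<close> are the multiples that satisfy the Nehari
  equation.\<close>

lemma fibre_eq:
  assumes "t > 0" "X \<ge> 0"
  shows "t powr (1 - q) * fibre X A B t = (t * X) powr p - t powr (1 - q) * A - l * (t powr (r + 1) * B)"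
proof -
  have "t powr (1 - q) * t powr (p - 1 + q) = t powr p" "t powr (1 - q) * t powr (r + q) = t powr (r + 1)"
    by (simp_all add: add.commute flip: powr_add)
  then show ?thesis
    using assms by (simp add: fibre_def powr_mult algebra_simps)
qed

text \<open>On the sphere \<open>gap\<close> keeps \<open>A\<close> below the fraction
  \<open>(r - p + 1) / (r + q)\<close> of \<open>R powr p\<close>, and the choice of
  \<open>R\<close> keeps \<open>l * B\<close> below the fraction
  \<open>(p - 1 + q) / (r + q)\<close>. The two fractions add up to one.\<close>

lemma outside_sphere:
  assumes "adm R A B"
  shows "R powr p - A - l * B > 0"
proof -
  have "A \<le> ca * R powr (1 - q)" using assms by (simp add: adm_def)
  also have "\<dots> < (r - p + 1) / (r + q) * R powr (p - 1 + q) * R powr (1 - q)"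
    using gap R by (intro mult_strict_right_mono) auto
  also have "\<dots> = (r - p + 1) / (r + q) * R powr p"
    by (simp flip: powr_add)
  finally have A: "A < (r - p + 1) / (r + q) * R powr p" .
  have "l * B \<le> l * (cb * R powr (r + 1))"
    using assms l by (intro mult_left_mono) (auto simp: adm_def)
  also have "R powr (r + 1) = R powr (r - p + 1) * R powr p" by (simp flip: powr_add)
  also have "l * (cb * \<dots>) = (p - 1 + q) / (r + q) * R powr p"
    by (simp flip: R_balance)
  finally have "A + l * B < ((r - p + 1) / (r + q) + (p - 1 + q) / (r + q)) * R powr p"
    using A by (simp add: distrib_right)
  also have "(r - p + 1) / (r + q) + (p - 1 + q) / (r + q) = 1"
    using q qp pr by (simp flip: add_divide_distrib)
  finally show ?thesis by simp
qed

text \<open>The bound on \<open>B\<close> is of higher order than \<open>X powr p\<close>, and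
  \<open>R\<close> is exactly the radius where the two sides balance. The Nehari equation is not
  involved: every nonzero point of the open ball is on the plus side.\<close>

lemma inside_ball:
  assumes "adm X A B" "0 < X" "X < R"
  shows "l * (r + q) * B < (p - 1 + q) * X powr p"
proof -
  have "l * (r + q) * B \<le> l * (r + q) * (cb * X powr (r + 1))"
    using assms l q qp pr by (intro mult_left_mono) (auto simp: adm_def)
  also have "X powr (r + 1) = X powr (r - p + 1) * X powr p" by (simp flip: powr_add)
  also have "l * (r + q) * (cb * (X powr (r - p + 1) * X powr p))
      < l * (r + q) * (cb * (R powr (r - p + 1) * X powr p))"
    using assms l q qp pr cb by (intro mult_strict_left_mono mult_strict_right_mono powr_less_mono2) auto
  also have "\<dots> = (r + q) * (l * cb * R powr (r - p + 1)) * X powr p" by simp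
  also have "\<dots> = (p - 1 + q) * X powr p"
    using q qp pr unfolding R_balance by simp
  finally show ?thesis .
qed

text \<open>If the strict inequality failed, eliminating \<open>l * B\<close> by the Nehari equation
  would give \<open>(r - p + 1) * X powr p \<le> (r + q) * A\<close>, against \<open>gap\<close> for
  \<open>X \<ge> R\<close>. Positivity of \<open>B\<close> follows since
  \<open>l * (r + q) * B\<close> exceeds a positive quantity.\<close>

lemma nehari_outside:
  assumes adm: "adm X A B" and X: "X \<ge> R" and eq: "X powr p = A + l * B"
  shows "(p - 1 + q) * X powr p < l * (r + q) * B" "X > R" "B > 0"
proof -
  show "X > R"
    using outside_sphere[of A B] adm X eq by (cases "X = R") auto
  show *: "(p - 1 + q) * X powr p < l * (r + q) * B"
  proof (rule ccontr)
    assume "\<not> ?thesis"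
    then have "(p - 1 + q) * X powr p \<ge> (r + q) * (l * B)" by (simp add: mult.commute mult.left_commute)
    then have "(p - 1 + q) * X powr p \<ge> (r + q) * (X powr p - A)" using eq by simp
    then have "(r - p + 1) * X powr p \<le> (r + q) * A" by (simp add: algebra_simps)
    also have "\<dots> \<le> (r + q) * (ca * X powr (1 - q))"
      using adm q qp pr by (intro mult_left_mono) (auto simp: adm_def)
    also have "\<dots> < (r + q) * ((r - p + 1) / (r + q) * R powr (p - 1 + q) * X powr (1 - q))"
      using gap R X q qp pr by (intro mult_strict_left_mono mult_strict_right_mono) auto
    also have "\<dots> \<le> (r + q) * ((r - p + 1) / (r + q) * X powr (p - 1 + q) * X powr (1 - q))"
      using R X q qp pr by (intro mult_left_mono mult_right_mono powr_mono2) auto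
    also have "\<dots> = (r - p + 1) * (X powr (p - 1 + q) * X powr (1 - q))"
      using q qp pr by (simp add: field_simps)
    also have "\<dots> = (r - p + 1) * X powr p" by (simp flip: powr_add)
    finally show False by simp
  qed
  have "0 < (p - 1 + q) * X powr p" using X R q qp by auto
  with * have "0 < l * (r + q) * B" by linarith
  moreover have "l * (r + q) > 0" using l q qp pr by simp
  ultimately show "B > 0" by (rule zero_less_mult_pos)
qed

text \<open>In the variable \<open>\<tau> = t\<^sup>p\<^sup>-\<^sup>1\<^sup>+\<^sup>q\<close> the fibre map is concave when \<open>B > 0\<close>.\<close>

lemma fibre_concave:
  assumes B: "B \<ge> 0" and t: "0 < x" "0 < z" "0 \<le> u" "u \<le> 1"
    and y: "y = (u * x powr (p - 1 + q) + (1 - u) * z powr (p - 1 + q)) powr (1 / (p - 1 + q))"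
  shows "fibre X A B y \<ge> u * fibre X A B x + (1 - u) * fibre X A B z"
proof -
  \<comment> \<open>In the variable \<open>\<tau>\<close> the last term of \<open>fibre\<close> is a
    multiple of \<open>\<tau> powr k\<close> with \<open>k \<ge> 1\<close>, hence convex, and the
    other two terms are affine.\<close>
  define k where "k = (r + q) / (p - 1 + q)"
  have k: "k \<ge> 1" using q qp pr by (simp add: k_def)
  have tk: "s powr (r + q) = (s powr (p - 1 + q)) powr k" for s
    using q qp by (simp add: powr_powr k_def)
  have y1: "y powr (p - 1 + q) = u * x powr (p - 1 + q) + (1 - u) * z powr (p - 1 + q)"
    unfolding y using q qp t by (subst powr_powr) (auto intro!: add_nonneg_nonneg)
  have "(u * x powr (p - 1 + q) + (1 - u) * z powr (p - 1 + q)) powr k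
      \<le> u * (x powr (p - 1 + q)) powr k + (1 - u) * (z powr (p - 1 + q)) powr k"
    using convex_onD[OF powr_convex[OF k], of "1 - u" "x powr (p - 1 + q)" "z powr (p - 1 + q)"] t
    by simp
  then have "y powr (r + q) \<le> u * x powr (r + q) + (1 - u) * z powr (r + q)"
    unfolding tk y1 .
  then have "l * B * y powr (r + q) \<le> l * B * (u * x powr (r + q) + (1 - u) * z powr (r + q))"
    using l B by (intro mult_left_mono) auto
  then show ?thesis unfolding fibre_def y1 by (simp add: algebra_simps)
qed

text \<open>A concave function that is positive at the sphere and zero at \<open>t = 1\<close> is
  positive in between and negative beyond. Concavity is available because \<open>B > 0\<close>
  outside the ball.\<close>

lemma fibre_sign:
  assumes adm: "adm X A B" and X: "X \<ge> R" and eq: "X powr p = A + l * B"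
  shows "R \<le> t * X \<Longrightarrow> t < 1 \<Longrightarrow> fibre X A B t > 0"
    and "t > 1 \<Longrightarrow> fibre X A B t < 0"
proof -
  define a where "a = p - 1 + q"
  have a: "a > 0" using q qp by (simp add: a_def)
  have B: "B > 0" and XR: "X > R" using nehari_outside[OF assms] by auto
  \<comment> \<open>The multiple that lands on the sphere, where the fibre map is positive.\<close>
  define t0 where "t0 = R / X"
  have t0: "t0 > 0" "t0 < 1" "t0 * X = R" using XR R by (auto simp: t0_def)
  have f1: "fibre X A B 1 = 0" using eq by (simp add: fibre_def)
  have "t0 powr (1 - q) * fibre X A B t0 > 0"
    using fibre_eq[of t0 X A B] outside_sphere[of "t0 powr (1 - q) * A" "t0 powr (r + 1) * B"]
      adm_scale[OF adm, of t0] t0 X R by simp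
  then have f0: "fibre X A B t0 > 0" using t0 by (simp add: zero_less_mult_iff)
  have t0a: "t0 powr a < 1" using t0 a by (metis less_eq_real_def powr_less_mono2 powr_one_eq_one)
  { assume t: "R \<le> t * X" "t < 1"
    have tt0: "t \<ge> t0" using t XR R by (simp add: t0_def divide_le_eq)
    \<comment> \<open>Barycentric weight of \<open>t powr a\<close> between \<open>t0 powr a\<close>
      and one, that is, in the variable \<open>\<tau>\<close>.\<close>
    define u where "u = (1 - t powr a) / (1 - t0 powr a)"
    have ta: "t powr a < 1" using t tt0 t0 a by (metis less_eq_real_def less_le_trans powr_less_mono2 powr_one_eq_one)
    have ta': "t0 powr a \<le> t powr a" using tt0 t0 a by (intro powr_mono2) auto
    have u: "u > 0" "u \<le> 1" using ta ta' t0a by (auto simp: u_def)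
    have "u * (1 - t0 powr a) = 1 - t powr a" using t0a by (simp add: u_def)
    then have "t powr a = u * t0 powr a + (1 - u) * 1 powr a" by (simp add: algebra_simps)
    then have "t = (u * t0 powr a + (1 - u) * 1 powr a) powr (1 / a)"
      using a t tt0 t0 by (metis powr_powr nonzero_mult_divide_mult_cancel_left less_imp_neq
        mult.right_neutral times_divide_eq_right powr_one div_self less_le_trans less_eq_real_def)
    then have "fibre X A B t \<ge> u * fibre X A B t0 + (1 - u) * fibre X A B 1"
      using B t0 u by (intro fibre_concave) (auto simp: a_def)
    moreover have "u * fibre X A B t0 > 0" using u f0 by simp
    ultimately show "fibre X A B t > 0" using f1 by simp }
  { assume t: "t > 1"
    have ta: "t powr a > 1" using t a by simp
    \<comment> \<open>Now \<open>1\<close> is the intermediate point, between \<open>t0\<close> and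
      \<open>t\<close>: with value zero there and a positive value at \<open>t0\<close>, the value
      at \<open>t\<close> has to be negative.\<close>
    define u where "u = (t powr a - 1) / (t powr a - t0 powr a)"
    have u: "u > 0" "u < 1" using ta t0a by (auto simp: u_def)
    have "u * (t powr a - t0 powr a) = t powr a - 1" using ta t0a by (simp add: u_def)
    then have "1 = u * t0 powr a + (1 - u) * t powr a" by (simp add: algebra_simps)
    then have "1 = (u * t0 powr a + (1 - u) * t powr a) powr (1 / a)" by (metis powr_one_eq_one)
    then have "fibre X A B 1 \<ge> u * fibre X A B t0 + (1 - u) * fibre X A B t"
      using B t0 u t by (intro fibre_concave) (auto simp: a_def)
    moreover have "u * fibre X A B t0 > 0" using u f0 by simp
    ultimately have "(1 - u) * fibre X A B t < 0" using f1 by linarith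
    then show "fibre X A B t < 0" using u by (simp add: mult_less_0_iff) }
qed

lemma J_scale_deriv:
  assumes "t > 0" "X \<ge> 0"
  shows "((\<lambda>t. J (t * X) (t powr (1 - q) * A) (t powr (r + 1) * B)) has_real_derivative
    t powr (- q) * fibre X A B t) (at t)"
proof -
  have "((\<lambda>t. t powr p * X powr p / p - t powr (1 - q) * A / (1 - q) - l * (t powr (r + 1) * B) / (r + 1))
      has_real_derivative
      p * t powr (p - 1) * X powr p / p - (1 - q) * t powr (1 - q - 1) * A / (1 - q)
        - l * ((r + 1) * t powr (r + 1 - 1) * B) / (r + 1)) (at t)"
    using assms q qp pr by (auto intro!: derivative_eq_intros)
  moreover have "p * t powr (p - 1) * X powr p / p - (1 - q) * t powr (1 - q - 1) * A / (1 - q)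
        - l * ((r + 1) * t powr (r + 1 - 1) * B) / (r + 1) =
      t powr (p - 1) * X powr p - t powr (- q) * A - l * t powr r * B"
  proof -
    have "p \<noteq> 0" "1 - q \<noteq> 0" "r + 1 \<noteq> 0" using q qp pr by auto
    moreover have "l * ((r + 1) * x) / (r + 1) = l * x" if "r + 1 \<noteq> 0" for x using that by simp
    ultimately show ?thesis by simp
  qed
  moreover have "t powr (p - 1) * X powr p - t powr (- q) * A - l * t powr r * B = t powr (- q) * fibre X A B t"
  proof -
    have "t powr (- q) * t powr (p - 1 + q) = t powr (p - 1)" "t powr (- q) * t powr (r + q) = t powr r"
      by (simp_all flip: powr_add)
    then show ?thesis by (simp add: fibre_def algebra_simps)
  qed
  ultimately have "((\<lambda>t. t powr p * X powr p / p - t powr (1 - q) * A / (1 - q) - l * (t powr (r + 1) * B) / (r + 1))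
      has_real_derivative t powr (- q) * fibre X A B t) (at t)" by simp
  then show ?thesis
    by (rule has_field_derivative_transform_within_open[where S="{0<..}"])
      (use assms in \<open>auto simp: J_def powr_mult\<close>)
qed

text \<open>The derivative along the ray has the sign of \<open>fibre\<close>, nonnegative from the
  sphere up to \<open>t = 1\<close> and nonpositive afterwards.\<close>

lemma J_scale_le:
  assumes adm: "adm X A B" and X: "X \<ge> R" and eq: "X powr p = A + l * B"
    and t: "t > 0" "R \<le> t * X"
  shows "J (t * X) (t powr (1 - q) * A) (t powr (r + 1) * B) \<le> J X A B"
proof -
  define g where "g t = J (t * X) (t powr (1 - q) * A) (t powr (r + 1) * B)" for t
  have X0: "X \<ge> 0" "X > 0" using X R by auto
  have d: "(g has_real_derivative u powr (- q) * fibre X A B u) (at u)" if "u > 0" for u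
    unfolding g_def using J_scale_deriv[OF that X0(1)] .
  have "g t \<le> g 1"
  proof (cases "t \<le> 1")
    case True
    show ?thesis
    proof (rule DERIV_nonneg_imp_nondecreasing[where f=g, OF True])
      fix u assume u: "t \<le> u" "u \<le> 1"
      have "R \<le> u * X" using t(2) u X0 by (meson mult_right_mono order_trans less_imp_le)
      then have "fibre X A B u \<ge> 0"
        using fibre_sign(1)[OF adm X eq, of u] u eq by (cases "u = 1") (auto simp: fibre_def)
      then show "\<exists>y. (g has_real_derivative y) (at u) \<and> 0 \<le> y"
        using d[of u] u t by (intro exI[of _ "u powr (- q) * fibre X A B u"]) auto
    qed
  next
    case False
    show ?thesis
    proof (rule DERIV_nonpos_imp_nonincreasing[where f=g])
      show "1 \<le> t" using False by simp
      fix u assume u: "1 \<le> u" "u \<le> t"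
      have "fibre X A B u \<le> 0"
        using fibre_sign(2)[OF adm X eq, of u] u eq by (cases "u = 1") (auto simp: fibre_def)
      then show "\<exists>y. (g has_real_derivative y) (at u) \<and> y \<le> 0"
        using d[of u] u t by (intro exI[of _ "u powr (- q) * fibre X A B u"]) (auto intro: mult_nonneg_nonpos)
    qed
  qed
  then show ?thesis by (simp add: g_def)
qed

text \<open>A strict change of sign survives small perturbations of the triple, so this intermediate
  value argument can bring perturbed points back to the Nehari set.\<close>

lemma fibre_root:
  assumes "0 < x" "x < y" "fibre X A B x > 0" "fibre X A B y < 0" "X \<ge> 0"
  obtains t where "x < t" "t < y" "(t * X) powr p = t powr (1 - q) * A + l * (t powr (r + 1) * B)"
proof -
  have "continuous_on {x..y} (fibre X A B)"
    unfolding fibre_def using assms by (intro continuous_intros) auto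
  then obtain t where t: "x \<le> t" "t \<le> y" "fibre X A B t = 0"
    using IVT2'[of "fibre X A B" y 0 x] assms by auto
  show ?thesis
  proof (rule that[of t])
    show "x < t" "t < y" using t assms by (auto simp: less_le)
    show "(t * X) powr p = t powr (1 - q) * A + l * (t powr (r + 1) * B)"
      using fibre_eq[of t X A B] t assms by simp
  qed
qed

text \<open>The fibre map is positive where the ray meets the sphere, and \<open>B > 0\<close> makes
  the term of highest order win for large \<open>t\<close>.\<close>

lemma exists_nehari_outside:
  assumes adm: "adm X A B" and X: "X > 0" and B: "B > 0"
  obtains t where "t > 0" "t * X \<ge> R" "(t * X) powr p = t powr (1 - q) * A + l * (t powr (r + 1) * B)"
proof -
  define t0 where "t0 = R / X"
  have t0: "t0 > 0" "t0 * X = R" using X R by (auto simp: t0_def)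
  have "t0 powr (1 - q) * fibre X A B t0 > 0"
    using fibre_eq[of t0 X A B] outside_sphere[of "t0 powr (1 - q) * A" "t0 powr (r + 1) * B"]
      adm_scale[OF adm, of t0] t0 X R by simp
  then have f0: "fibre X A B t0 > 0" using t0 by (simp add: zero_less_mult_iff)
  \<comment> \<open>Past the point where \<open>l * B * t powr (r - p + 1)\<close> equals
    \<open>X powr p\<close>; since \<open>A \<ge> 0\<close>, the fibre map is negative
    there.\<close>
  define t1 where "t1 = max (t0 + 1) ((X powr p / (l * B)) powr (1 / (r - p + 1)) + 1)"
  have t1: "t1 > t0" "t1 > 0" using t0 by (auto simp: t1_def)
  have "X powr p / (l * B) = ((X powr p / (l * B)) powr (1 / (r - p + 1))) powr (r - p + 1)"
    using pr X B l by (simp add: powr_powr)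
  also have "\<dots> < t1 powr (r - p + 1)"
    using pr by (intro powr_less_mono2) (auto simp: t1_def)
  finally have "X powr p < l * B * t1 powr (r - p + 1)"
    using l B by (simp add: divide_less_eq mult.commute)
  then have "t1 powr (p - 1 + q) * X powr p < t1 powr (p - 1 + q) * (l * B * t1 powr (r - p + 1))"
    using t1 by simp
  also have "\<dots> = l * B * (t1 powr (p - 1 + q) * t1 powr (r - p + 1))" by simp
  also have "t1 powr (p - 1 + q) * t1 powr (r - p + 1) = t1 powr (r + q)"
    by (simp add: algebra_simps flip: powr_add)
  finally have f1: "fibre X A B t1 < 0"
    using adm by (simp add: fibre_def adm_def mult.commute mult.left_commute)
  obtain t where t: "t0 < t" "t < t1" "(t * X) powr p = t powr (1 - q) * A + l * (t powr (r + 1) * B)"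
    using fibre_root[OF t0(1) t1(1) f0 f1] X by auto
  have "t0 * X \<le> t * X" using t X by (intro mult_right_mono) auto
  then show ?thesis using t t0 by (intro that[of t]) auto
qed

text \<open>Eliminating \<open>l * B\<close> by the Nehari equation leaves
  \<open>c1 * X powr p\<close> with \<open>c1 > 0\<close>, because \<open>p < r + 1\<close>, minus a
  term of order at most \<open>X powr (1 - q)\<close>.\<close>

lemma nehari_J_coercive:
  obtains K where "\<And>X A B. adm X A B \<Longrightarrow> X powr p = A + l * B \<Longrightarrow> J X A B \<le> C \<Longrightarrow> X \<le> K"
proof -
  define c1 where "c1 = 1 / p - 1 / (r + 1)"
  define c2 where "c2 = (1 / (1 - q) - 1 / (r + 1)) * ca"
  have c1: "c1 > 0" using q qp pr by (simp add: c1_def frac_less2)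
  have c20: "1 / (1 - q) - 1 / (r + 1) \<ge> 0" using q qp pr by (simp add: frac_le)
  \<comment> \<open>Beyond this radius \<open>c1 * X powr (p - 1 + q)\<close> exceeds
    \<open>\<bar>c2\<bar> + \<bar>C\<bar> + 1\<close>; the first entry of the maximum gives
    \<open>X powr (1 - q) \<ge> 1\<close>.\<close>
  define K where "K = max 1 (((\<bar>c2\<bar> + \<bar>C\<bar> + 1) / c1) powr (1 / (p - 1 + q)))"
  show ?thesis
  proof (rule that[of K], rule ccontr)
    fix X A B assume adm: "adm X A B" and eq: "X powr p = A + l * B" and C: "J X A B \<le> C" and "\<not> X \<le> K"
    then have X: "X > 1" "X > ((\<bar>c2\<bar> + \<bar>C\<bar> + 1) / c1) powr (1 / (p - 1 + q))" by (auto simp: K_def)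
    have "(\<bar>c2\<bar> + \<bar>C\<bar> + 1) / c1 = (((\<bar>c2\<bar> + \<bar>C\<bar> + 1) / c1) powr (1 / (p - 1 + q))) powr (p - 1 + q)"
      using q qp c1 by (simp add: powr_powr)
    also have "\<dots> < X powr (p - 1 + q)" using X q qp by (intro powr_less_mono2) auto
    finally have *: "c1 * X powr (p - 1 + q) > \<bar>c2\<bar> + \<bar>C\<bar> + 1"
      using c1 by (simp add: divide_less_eq mult.commute)
    have lB: "l * B = X powr p - A" using eq by simp
    have "J X A B = c1 * X powr p - (1 / (1 - q) - 1 / (r + 1)) * A"
      unfolding J_def c1_def lB by (simp add: algebra_simps diff_divide_distrib)
    moreover have "(1 / (1 - q) - 1 / (r + 1)) * A \<le> (1 / (1 - q) - 1 / (r + 1)) * (ca * X powr (1 - q))"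
      using adm c20 by (intro mult_left_mono) (auto simp: adm_def)
    moreover have "X powr p = X powr (p - 1 + q) * X powr (1 - q)" by (simp flip: powr_add)
    ultimately have "J X A B \<ge> (c1 * X powr (p - 1 + q) - c2) * X powr (1 - q)"
      by (simp add: c2_def algebra_simps)
    moreover have "(c1 * X powr (p - 1 + q) - c2) * X powr (1 - q) \<ge> (\<bar>C\<bar> + 1) * 1"
      using * X q by (intro mult_mono) (auto intro: ge_one_powr_ge_zero)
    ultimately show False using C by simp
  qed
qed

lemma J_bounded_below:
  obtains C where "\<And>X A B. adm X A B \<Longrightarrow> X \<le> K \<Longrightarrow> J X A B \<ge> C"
proof (rule that)
  fix X A B assume adm: "adm X A B" and K: "X \<le> K"
  have "0 \<le> ca * X powr (1 - q)" using adm by (auto simp: adm_def)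
  have "A \<le> ca * X powr (1 - q)" using adm by (simp add: adm_def)
  also have "\<dots> \<le> \<bar>ca\<bar> * K powr (1 - q)"
    using K adm q by (intro mult_mono powr_mono2) (auto simp: adm_def)
  finally have "A / (1 - q) \<le> \<bar>ca\<bar> * K powr (1 - q) / (1 - q)" using q by (intro divide_right_mono) auto
  moreover have "l * B / (r + 1) \<le> l * (cb * K powr (r + 1)) / (r + 1)"
  proof -
    have "B \<le> cb * X powr (r + 1)" using adm unfolding adm_def by linarith
    also have "\<dots> \<le> cb * K powr (r + 1)"
      using K adm q qp pr cb by (intro mult_left_mono powr_mono2) (auto simp: adm_def)
    finally show ?thesis using l q qp pr by (intro divide_right_mono mult_left_mono) auto
  qed
  moreover have "X powr p / p \<ge> 0" using q qp by simp
  ultimately show "J X A B \<ge> - (\<bar>ca\<bar> * K powr (1 - q) / (1 - q)) - l * (cb * K powr (r + 1)) / (r + 1)"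
    by (simp add: J_def)
qed

end

section \<open>The Gagliardo measure\<close>

text \<open>With the kernel put into the measure, the energy is an \<open>L^p\<close> integral of
  differences and the integration lemmas for general measures apply to it. On the diagonal the
  density is zero, since \<open>0 powr x = 0\<close>. The whole product space replaces
  \<open>Q\<close>, which changes nothing for functions vanishing outside the domain.\<close>

definition gagliardo :: "real \<Rightarrow> real \<Rightarrow> ((real^'n) \<times> (real^'n)) measure" where
  "gagliardo p s = density lborel
    (\<lambda>z. ennreal (norm (fst z - snd z) powr - (real CARD('n) + p * s)))"

definition energy :: "real \<Rightarrow> real \<Rightarrow> (real^'n \<Rightarrow> real) \<Rightarrow> real" where
  "energy p s w = (LINT z|gagliardo p s. \<bar>w (fst z) - w (snd z)\<bar> powr p)"

lemma sets_gagliardo[measurable_cong, simp]: "sets (gagliardo p s) = sets borel"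
  by (simp add: gagliardo_def)

lemma space_gagliardo[simp]: "space (gagliardo p s) = UNIV"
  by (simp add: gagliardo_def)

lemma measurable_fst_borel[measurable]: "fst \<in> borel_measurable (borel :: ('a::euclidean_space \<times> 'b::euclidean_space) measure)"
  by (intro borel_measurable_continuous_onI continuous_intros)

lemma measurable_snd_borel[measurable]: "snd \<in> borel_measurable (borel :: ('a::euclidean_space \<times> 'b::euclidean_space) measure)"
  by (intro borel_measurable_continuous_onI continuous_intros)

lemma nn_integral_gagliardo:
  fixes f :: "(real^'n) \<times> (real^'n) \<Rightarrow> ennreal"
  assumes [measurable]: "f \<in> borel_measurable borel"
  shows "(\<integral>\<^sup>+z. f z \<partial>gagliardo p s) =
    (\<integral>\<^sup>+x. \<integral>\<^sup>+y. ennreal (norm (x - y) powr - (real CARD('n) + p * s)) * f (x, y) \<partial>lborel \<partial>lborel)"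
proof -
  have "(\<integral>\<^sup>+z. f z \<partial>gagliardo p s) =
      (\<integral>\<^sup>+z. ennreal (norm (fst z - snd z) powr - (real CARD('n) + p * s)) * f z \<partial>lborel)"
    unfolding gagliardo_def by (rule nn_integral_density) measurable
  also have "\<dots> = (\<integral>\<^sup>+z. ennreal (norm (fst z - snd z) powr - (real CARD('n) + p * s)) * f z
      \<partial>(lborel \<Otimes>\<^sub>M lborel))"
    by (simp add: lborel_prod)
  also have "\<dots> = (\<integral>\<^sup>+x. \<integral>\<^sup>+y. ennreal (norm (x - y) powr - (real CARD('n) + p * s)) * f (x, y) \<partial>lborel \<partial>lborel)"
    by (subst lborel.nn_integral_fst[symmetric]) (auto simp: lborel_prod)
  finally show ?thesis .
qed

lemma AE_lborel_prod_fst: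
  assumes "AE x in lborel. P (x :: 'a::euclidean_space)"
  shows "AE z in (lborel :: ('a \<times> 'b::euclidean_space) measure). P (fst z)"
proof -
  obtain N where N: "N \<in> null_sets lborel" "{x. \<not> P x} \<subseteq> N"
    using assms by (auto simp: eventually_ae_filter)
  have "emeasure (lborel \<Otimes>\<^sub>M lborel) (N \<times> (UNIV :: 'b set)) = 0"
    using N by (subst lborel.emeasure_pair_measure_Times) auto
  then have "N \<times> (UNIV :: 'b set) \<in> null_sets lborel"
    using N by (auto simp: null_sets_def lborel_prod borel_prod[symmetric])
  then show ?thesis by (rule AE_I') (use N in auto)
qed

lemma AE_lborel_prod_snd:
  assumes "AE x in lborel. P (x :: 'b::euclidean_space)"
  shows "AE z in (lborel :: ('a::euclidean_space \<times> 'b) measure). P (snd z)"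
proof -
  obtain N where N: "N \<in> null_sets lborel" "{x. \<not> P x} \<subseteq> N"
    using assms by (auto simp: eventually_ae_filter)
  have "emeasure (lborel \<Otimes>\<^sub>M lborel) ((UNIV :: 'a set) \<times> N) = 0"
    using N by (subst lborel.emeasure_pair_measure_Times) auto
  then have "(UNIV :: 'a set) \<times> N \<in> null_sets lborel"
    using N by (auto simp: null_sets_def lborel_prod borel_prod[symmetric])
  then show ?thesis by (rule AE_I') (use N in auto)
qed

lemma AE_gagliardoI: "AE z in lborel. P z \<Longrightarrow> AE z in gagliardo p s. P z"
  unfolding gagliardo_def by (subst AE_density) auto

text \<open>The pairs are sorted by the dyadic size of \<open>norm (x - y)\<close>. Each shell costs
  at most the supremum of the integrand there times the volume of a ball, and these costs form
  geometric series in both directions.\<close>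

lemma Lipschitz_finite_energy:
  fixes f :: "real^'n \<Rightarrow> real"
  assumes ps: "p > 0" "0 < s" "s < 1"
    and Lip: "\<And>x y. \<bar>f x - f y\<bar> \<le> L * norm (x - y)" and bd: "\<And>x. \<bar>f x\<bar> \<le> m"
    and supp: "\<And>x. norm x > \<rho> \<Longrightarrow> f x = 0"
  shows "integrable (gagliardo p s) (\<lambda>z. \<bar>f (fst z) - f (snd z)\<bar> powr p)"
proof -
  define \<gamma> where "\<gamma> = real CARD('n) + p * s"
  have \<gamma>: "\<gamma> \<ge> 0" using ps by (simp add: \<gamma>_def)
  define L' where "L' = \<bar>L\<bar> + 1"
  define m' where "m' = 2 * \<bar>m\<bar> + 1"
  have Lip': "\<bar>f x - f y\<bar> \<le> L' * norm (x - y)" for x y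
    by (rule order_trans[OF Lip mult_right_mono]) (auto simp: L'_def)
  have "continuous_on UNIV f"
    by (intro lipschitz_on_continuous_on[of L'] lipschitz_onI)
      (use Lip' in \<open>auto simp: L'_def dist_norm\<close>)
  then have [measurable]: "f \<in> borel_measurable borel" by (rule borel_measurable_continuous_onI)
  \<comment> \<open>Bound of the integrand when \<open>norm (x - y)\<close> lies between
    \<open>2 powr j\<close> and \<open>2 powr (j + 1)\<close>: the Lipschitz bound serves small
    shells, the sup bound large ones.\<close>
  define c where "c j = min (L' * 2 powr (j + 1)) m' powr p * (2 powr j) powr - \<gamma>" for j :: real
  define V where "V = unit_ball_vol (real CARD('n))"
  define T where "T j = c j * (V * (2 powr (j + 1)) powr real CARD('n))" for j
  have c0: "c j \<ge> 0" for j by (simp add: c_def)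
  have V: "V > 0" by (simp add: V_def)
  have em: "emeasure lborel (ball x (2 powr j)) = ennreal (V * (2 powr j) powr real CARD('n))" for x :: "real^'n" and j
    using emeasure_ball[of "2 powr j" x] by (simp add: V_def powr_realpow flip: powr_powr)
  \<comment> \<open>Balls replace shells, which keeps the volumes explicit. The index zero occurs in
    both sums, which only enlarges the upper bound.\<close>
  define G where "G x y = (\<Sum>k::nat. ennreal (c (real k)) * indicator (ball x (2 powr (real k + 1))) y)
      + (\<Sum>k::nat. ennreal (c (- real k)) * indicator (ball x (2 powr (- real k + 1))) y)" for x y :: "real^'n"
  define C where "C = (\<Sum>k::nat. ennreal (T (real k))) + (\<Sum>k::nat. ennreal (T (- real k)))"
  have G_eq: "G x y = (\<Sum>k::nat. ennreal (c (real k)) * of_bool (dist x y < 2 powr (real k + 1)))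
      + (\<Sum>k::nat. ennreal (c (- real k)) * of_bool (dist x y < 2 powr (- real k + 1)))" for x y
    by (simp add: G_def indicator_def)
  have [measurable]: "(\<lambda>z. G (fst z) (snd z)) \<in> borel_measurable borel"
    unfolding G_eq by measurable
  have [measurable]: "G x \<in> borel_measurable borel" for x
    unfolding G_eq[abs_def] by measurable
  have G_sym: "G x y = G y x" for x y by (simp add: G_eq dist_commute)
  have int1: "(\<integral>\<^sup>+y. ennreal (c j) * indicator (ball x (2 powr (j + 1))) y \<partial>lborel) = ennreal (T j)"
    for x :: "real^'n" and j
    using V c0[of j] by (simp add: nn_integral_cmult_indicator em T_def ennreal_mult)
  have intG: "(\<integral>\<^sup>+y. G x y \<partial>lborel) = C" for x
  proof -
    have [measurable]: "(\<lambda>y. ennreal (c j) * indicator (ball x (2 powr (j + 1))) y) \<in> borel_measurable lborel" for j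
      by (intro borel_measurable_times_ennreal borel_measurable_indicator) auto
    have i: "(\<integral>\<^sup>+y. (\<Sum>k::nat. ennreal (c (g k)) * indicator (ball x (2 powr (g k + 1))) y) \<partial>lborel) =
        (\<Sum>k. ennreal (T (g k)))" for g :: "nat \<Rightarrow> real"
      by (subst nn_integral_suminf) (simp_all only: int1, measurable)
    have m: "(\<lambda>y. \<Sum>k::nat. ennreal (c (g k)) * indicator (ball x (2 powr (g k + 1))) y) \<in> borel_measurable lborel"
      for g :: "nat \<Rightarrow> real"
      by (intro borel_measurable_suminf_order) measurable
    show ?thesis unfolding G_def C_def
      by (subst nn_integral_add[OF m[of real] m[of "\<lambda>k. - real k"]]) (simp only: i)
  qed
  have "C < \<infinity>"
  proof -
    define C1 where "C1 = m' powr p * (V * 2 powr real CARD('n))"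
    define C2 where "C2 = (L' * 2) powr p * (V * 2 powr real CARD('n))"
    \<comment> \<open>At large distance the volume growth loses against the kernel by
      \<open>2 powr (- (p * s))\<close> per scale, where \<open>s > 0\<close> is used. At small
      distance the Lipschitz bound gains \<open>2 powr (- (p * (1 - s)))\<close> per scale, where
      \<open>s < 1\<close> is used.\<close>
    have T1: "T (real k) \<le> C1 * (2 powr (- (p * s))) ^ k" for k
    proof -
      have "T (real k) \<le> (m' powr p * (2 powr real k) powr - \<gamma>) * (V * (2 powr (real k + 1)) powr real CARD('n))"
        unfolding T_def c_def using ps V by (intro mult_right_mono powr_mono2) (auto simp: L'_def m'_def)
      also have "\<dots> = m' powr p * V * ((2 powr real k) powr - \<gamma> * (2 powr (real k + 1)) powr real CARD('n))"
        by simp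
      also have "(2 powr real k) powr - \<gamma> * (2 powr (real k + 1)) powr real CARD('n)
          = 2 powr real CARD('n) * (2 powr (- (p * s))) powr real k"
        by (simp only: powr_powr powr_add[symmetric])
          (rule arg_cong[where f="\<lambda>x. 2 powr x"], simp add: \<gamma>_def algebra_simps)
      also have "m' powr p * V * \<dots> = C1 * (2 powr (- (p * s))) powr real k"
        by (simp add: C1_def)
      finally show ?thesis by (simp add: powr_realpow)
    qed
    have T2: "T (- real k) \<le> C2 * (2 powr (- (p * (1 - s)))) ^ k" for k
    proof -
      have "T (- real k) \<le> ((L' * 2 powr (- real k + 1)) powr p * (2 powr - real k) powr - \<gamma>) * (V * (2 powr (- real k + 1)) powr real CARD('n))"
        unfolding T_def c_def using ps V by (intro mult_right_mono powr_mono2) (auto simp: L'_def m'_def)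
      also have "(L' * 2 powr (- real k + 1)) powr p = (L' * 2) powr p * (2 powr (- real k)) powr p"
      proof -
        have "L' * 2 powr (- real k + 1) = (L' * 2) * 2 powr (- real k)"
          by (simp only: powr_add) simp
        then show ?thesis by (simp only: powr_mult)
      qed
      also have "(L' * 2) powr p * (2 powr (- real k)) powr p * (2 powr - real k) powr - \<gamma>
            * (V * (2 powr (- real k + 1)) powr real CARD('n))
          = (L' * 2) powr p * V * ((2 powr (- real k)) powr p * (2 powr - real k) powr - \<gamma>
            * (2 powr (- real k + 1)) powr real CARD('n))"
        by simp
      also have "(2 powr (- real k)) powr p * (2 powr - real k) powr - \<gamma> * (2 powr (- real k + 1)) powr real CARD('n)
          = 2 powr real CARD('n) * (2 powr (- (p * (1 - s)))) powr real k"
        by (simp only: powr_powr powr_add[symmetric])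
          (rule arg_cong[where f="\<lambda>x. 2 powr x"], simp add: \<gamma>_def algebra_simps)
      also have "(L' * 2) powr p * V * \<dots> = C2 * (2 powr (- (p * (1 - s)))) powr real k"
        by (simp add: C2_def)
      finally show ?thesis by (simp add: powr_realpow)
    qed
    have fin: "(\<Sum>k::nat. ennreal (D k)) < \<infinity>" if "\<And>k. D k \<le> K * x ^ k" "0 < x" "x < 1" "0 \<le> K" for D K and x :: real
    proof -
      have "(\<Sum>k::nat. ennreal (D k)) \<le> (\<Sum>k::nat. ennreal (K * x ^ k))"
        by (intro suminf_le ennreal_leI that) auto
      also have "\<dots> = ennreal (\<Sum>k. K * x ^ k)"
        using that by (intro suminf_ennreal2) (auto intro!: summable_mult summable_geometric)
      also have "\<dots> < \<infinity>" by simp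
      finally show ?thesis .
    qed
    have "(\<Sum>k::nat. ennreal (T (real k))) < \<infinity>"
      using ps V by (intro fin[OF T1]) (auto simp: C1_def powr_less_one)
    moreover have "(\<Sum>k::nat. ennreal (T (- real k))) < \<infinity>"
      using ps V by (intro fin[OF T2]) (auto simp: C2_def powr_less_one)
    ultimately show ?thesis by (simp add: C_def)
  qed
  have point: "\<bar>f x - f y\<bar> powr p * norm (x - y) powr - \<gamma> \<le> c j" "dist x y < 2 powr (j + 1)"
    if "j = of_int \<lfloor>log 2 (norm (x - y))\<rfloor>" "x \<noteq> y" for x y j
  proof -
    have j: "2 powr j \<le> norm (x - y)" "norm (x - y) < 2 powr (j + 1)"
      using floor_log_eq_powr_iff[of "norm (x - y)" 2 "\<lfloor>log 2 (norm (x - y))\<rfloor>"] that by auto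
    have "\<bar>f x - f y\<bar> \<le> L' * norm (x - y)"
      by (rule Lip')
    also have "\<dots> \<le> L' * 2 powr (j + 1)" using j by (intro mult_left_mono) (auto simp: L'_def)
    finally have 1: "\<bar>f x - f y\<bar> \<le> L' * 2 powr (j + 1)" .
    have 2: "\<bar>f x - f y\<bar> \<le> m'" using bd[of x] bd[of y] by (auto simp: m'_def)
    have "norm (x - y) powr - \<gamma> \<le> (2 powr j) powr - \<gamma>"
      using j \<gamma> by (intro powr_mono2') auto
    then show "\<bar>f x - f y\<bar> powr p * norm (x - y) powr - \<gamma> \<le> c j"
      unfolding c_def using 1 2 ps by (intro mult_mono) (auto intro!: powr_mono2)
    show "dist x y < 2 powr (j + 1)" using j by (simp add: dist_norm)
  qed
  have sum_ge: "g k \<le> (\<Sum>k. g k)" for g :: "nat \<Rightarrow> ennreal" and k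
    using sum_le_suminf[of g "{k}"] by auto
  have leG: "ennreal (\<bar>f x - f y\<bar> powr p * norm (x - y) powr - \<gamma>) \<le> G x y" for x y
  proof (cases "x = y")
    case False
    define i where "i = \<lfloor>log 2 (norm (x - y))\<rfloor>"
    show ?thesis
    proof (cases "i \<ge> 0")
      case True
      then have i: "real_of_int i = real (nat i)" by simp
      have "ennreal (\<bar>f x - f y\<bar> powr p * norm (x - y) powr - \<gamma>) \<le>
          ennreal (c (real (nat i))) * of_bool (dist x y < 2 powr (real (nat i) + 1))"
        using point[of i x y] False i by (simp add: i_def ennreal_leI)
      also have "\<dots> \<le> G x y" unfolding G_eq by (rule order_trans[OF sum_ge add_increasing2]) auto
      finally show ?thesis .
    next
      case False
      then have i: "real_of_int i = - real (nat (- i))" by simp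
      have "ennreal (\<bar>f x - f y\<bar> powr p * norm (x - y) powr - \<gamma>) \<le>
          ennreal (c (- real (nat (- i)))) * of_bool (dist x y < 2 powr (- real (nat (- i)) + 1))"
        using point[of i x y] \<open>x \<noteq> y\<close> i by (simp add: i_def ennreal_leI)
      also have "\<dots> \<le> G x y" unfolding G_eq by (rule order_trans[OF sum_ge add_increasing]) auto
      finally show ?thesis .
    qed
  qed auto
  define B where "B = cball (0::real^'n) \<rho>"
  have B[measurable]: "B \<in> sets borel" by (simp add: B_def)
  have "(\<integral>\<^sup>+z. ennreal (\<bar>f (fst z) - f (snd z)\<bar> powr p) \<partial>gagliardo p s) =
      (\<integral>\<^sup>+x. \<integral>\<^sup>+y. ennreal (norm (x - y) powr - \<gamma>) * ennreal (\<bar>f x - f y\<bar> powr p) \<partial>lborel \<partial>lborel)"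
    by (subst nn_integral_gagliardo) (auto simp: \<gamma>_def)
  \<comment> \<open>The difference vanishes unless one of the two points lies in \<open>B\<close>, a
    set of finite measure; symmetry of \<open>G\<close> then makes both parts equal.\<close>
  also have "\<dots> \<le> (\<integral>\<^sup>+x. \<integral>\<^sup>+y. indicator B x * G x y + indicator B y * G x y \<partial>lborel \<partial>lborel)"
  proof (intro nn_integral_mono)
    fix x y
    show "ennreal (norm (x - y) powr - \<gamma>) * ennreal (\<bar>f x - f y\<bar> powr p) \<le> indicator B x * G x y + indicator B y * G x y"
    proof (cases "x \<in> B \<or> y \<in> B")
      case True
      have "G x y \<le> indicator B x * G x y + indicator B y * G x y"
        using True by (auto simp: indicator_def intro: add_increasing)
      then show ?thesis using leG[of x y] by (simp add: ennreal_mult' mult.commute)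
    next
      case False
      then show ?thesis using supp by (simp add: B_def)
    qed
  qed
  also have "\<dots> = (\<integral>\<^sup>+x. \<integral>\<^sup>+y. indicator B x * G x y \<partial>lborel \<partial>lborel) + (\<integral>\<^sup>+x. \<integral>\<^sup>+y. indicator B y * G x y \<partial>lborel \<partial>lborel)"
  proof -
    have [measurable]: "(\<lambda>(x, y). indicator B x * G x y) \<in> borel_measurable (lborel \<Otimes>\<^sub>M lborel)"
      "(\<lambda>(x, y). indicator B y * G x y) \<in> borel_measurable (lborel \<Otimes>\<^sub>M lborel)"
      by (simp_all add: lborel_prod case_prod_beta')
    show ?thesis by (subst nn_integral_add; (subst nn_integral_add)?; simp)
  qed
  also have "(\<integral>\<^sup>+x. \<integral>\<^sup>+y. indicator B y * G x y \<partial>lborel \<partial>lborel) = (\<integral>\<^sup>+y. \<integral>\<^sup>+x. indicator B y * G x y \<partial>lborel \<partial>lborel)"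
    by (rule lborel_pair.Fubini'[symmetric]) (simp add: lborel_prod case_prod_beta')
  also have "\<dots> = (\<integral>\<^sup>+x. \<integral>\<^sup>+y. indicator B x * G x y \<partial>lborel \<partial>lborel)"
    by (simp add: G_sym)
  also have "(\<integral>\<^sup>+x. \<integral>\<^sup>+y. indicator B x * G x y \<partial>lborel \<partial>lborel) = C * emeasure lborel B"
    by (simp add: nn_integral_cmult intG nn_integral_multc mult.commute)
  also have "C * emeasure lborel B + C * emeasure lborel B < \<infinity>"
    using \<open>C < \<infinity>\<close> emeasure_lborel_cball_finite[of "0::real^'n" \<rho>]
    by (simp add: B_def ennreal_mult_less_top)
  finally show ?thesis
    by (intro integrableI_nonneg) auto
qed

section \<open>Compactness\<close>

text \<open>Taking floors gives half-open cubes of side \<open>1 / 2 ^ k\<close>, so cells with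
  different indices are exactly disjoint and every point has exactly one cell.\<close>

definition dyadic_index :: "nat \<Rightarrow> real^'n \<Rightarrow> 'n \<Rightarrow> int" where
  "dyadic_index k x = (\<lambda>i. \<lfloor>2 ^ k * x $ i\<rfloor>)"

definition dyadic_cell :: "nat \<Rightarrow> ('n \<Rightarrow> int) \<Rightarrow> (real^'n) set" where
  "dyadic_cell k z = {x. dyadic_index k x = z}"

lemma mem_dyadic_cell:
  "x \<in> dyadic_cell k z \<longleftrightarrow> (\<forall>i. z i / 2 ^ k \<le> x $ i \<and> x $ i < (z i + 1) / 2 ^ k)"
  by (auto simp: dyadic_cell_def dyadic_index_def fun_eq_iff floor_eq_iff field_simps)

lemma dyadic_cell_borel[measurable]: "dyadic_cell k z \<in> sets borel"
proof -
  have "dyadic_cell k z = {x. \<forall>i. z i / 2 ^ k \<le> x $ i \<and> x $ i < (z i + 1) / 2 ^ k}"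
    by (auto simp: mem_dyadic_cell)
  also have "\<dots> \<in> sets borel" by measurable
  finally show ?thesis .
qed

text \<open>The half-open cube lies between an open and a closed box of equal volume.\<close>

lemma emeasure_dyadic_cell:
  "emeasure lborel (dyadic_cell k z :: (real^'n) set) = ennreal ((1 / 2 ^ k) ^ CARD('n))"
proof -
  define a b :: "real^'n" where "a = (\<chi> i. z i / 2 ^ k)" and "b = (\<chi> i. (z i + 1) / 2 ^ k)"
  have le: "a $ i \<le> b $ i" for i by (simp add: a_def b_def divide_right_mono)
  then have ne: "cbox a b \<noteq> {}" by (simp add: cbox_interval interval_ne_empty_cart) (simp add: less_eq_vec_def)
  have "measure lborel (cbox a b) = (\<Prod>i\<in>UNIV. b $ i - a $ i)"
    by (rule content_cbox_cart[OF ne])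
  also have "\<dots> = (1 / 2 ^ k) ^ CARD('n)"
    by (simp add: a_def b_def diff_divide_distrib[symmetric])
  finally have c: "emeasure lborel (cbox a b) = ennreal ((1 / 2 ^ k) ^ CARD('n))"
    using emeasure_lborel_cbox_finite[of a b] by (simp add: emeasure_eq_ennreal_measure)
  have "box a b \<subseteq> dyadic_cell k z" "dyadic_cell k z \<subseteq> cbox a b"
    by (auto simp: mem_dyadic_cell mem_box_cart a_def b_def less_imp_le)
  then have "emeasure lborel (box a b) \<le> emeasure lborel (dyadic_cell k z)"
    "emeasure lborel (dyadic_cell k z) \<le> emeasure lborel (cbox a b)"
    by (auto intro!: emeasure_mono)
  moreover have "emeasure lborel (box a b) = emeasure lborel (cbox a b)"
    by (simp add: emeasure_lborel_box_eq emeasure_lborel_cbox_eq)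
  ultimately show ?thesis using c by simp
qed

lemma dyadic_cell_diameter:
  fixes x y :: "real^'n"
  assumes "x \<in> dyadic_cell k z" "y \<in> dyadic_cell k z"
  shows "norm (x - y) \<le> real CARD('n) / 2 ^ k"
proof -
  have "\<bar>(x - y) $ i\<bar> \<le> 1 / 2 ^ k" for i
  proof -
    have "z i / 2 ^ k \<le> x $ i" "x $ i < z i / 2 ^ k + 1 / 2 ^ k"
      "z i / 2 ^ k \<le> y $ i" "y $ i < z i / 2 ^ k + 1 / 2 ^ k"
      using assms by (auto simp: mem_dyadic_cell add_divide_distrib)
    then show ?thesis by (simp add: abs_le_iff)
  qed
  then have "(\<Sum>i\<in>UNIV. \<bar>(x - y) $ i\<bar>) \<le> (\<Sum>i\<in>(UNIV::'n set). 1 / 2 ^ k)"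
    by (intro sum_mono)
  then show ?thesis using norm_le_l1_cart[of "x - y"] by simp
qed

lemma finite_dyadic_index:
  fixes \<Omega> :: "(real^'n) set"
  assumes "bounded \<Omega>"
  shows "finite (dyadic_index k ` \<Omega>)"
proof -
  obtain M where M: "\<And>x. x \<in> \<Omega> \<Longrightarrow> norm x \<le> M" using assms by (auto simp: bounded_iff)
  have "dyadic_index k ` \<Omega> \<subseteq> PiE UNIV (\<lambda>_. {\<lfloor>- (2 ^ k * M)\<rfloor>..\<lfloor>2 ^ k * M\<rfloor>})"
  proof (rule image_subsetI, rule PiE_I)
    fix x i assume "x \<in> \<Omega>"
    then have "\<bar>x $ i\<bar> \<le> M" using M component_le_norm_cart[of x i] by (meson order_trans)
    then have "2 ^ k * \<bar>x $ i\<bar> \<le> 2 ^ k * M" by (intro mult_left_mono) auto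
    then have "\<bar>2 ^ k * x $ i\<bar> \<le> 2 ^ k * M" by (simp add: abs_mult)
    then have "\<lfloor>- (2 ^ k * M)\<rfloor> \<le> \<lfloor>2 ^ k * x $ i\<rfloor>" "\<lfloor>2 ^ k * x $ i\<rfloor> \<le> \<lfloor>2 ^ k * M\<rfloor>"
      by (intro floor_mono, linarith)+
    then show "dyadic_index k x i \<in> {\<lfloor>- (2 ^ k * M)\<rfloor>..\<lfloor>2 ^ k * M\<rfloor>}"
      by (simp add: dyadic_index_def)
  qed simp
  then show ?thesis by (rule finite_subset) (auto intro: finite_PiE)
qed

text \<open>\<open>t \<le> \<delta> + \<delta>\<^sup>1\<^sup>-\<^sup>p t\<^sup>p\<close> turns the Gagliardo energy over a small cell into an
  \<open>L\<^sup>1\<close>-bound for the oscillation.\<close>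

lemma cell_L1_estimate:
  fixes u :: "real^'n \<Rightarrow> real"
  assumes ps: "p > 1" "0 < s" and \<delta>: "\<delta> > 0" and V: "V > 0"
    and u: "integrable lborel u"
    and D[measurable]: "D \<in> sets borel" and DV: "emeasure lborel D = ennreal V"
    and diam: "\<And>x y. x \<in> D \<Longrightarrow> y \<in> D \<Longrightarrow> norm (x - y) \<le> d"
  shows "ennreal V * (\<integral>\<^sup>+x\<in>D. ennreal \<bar>u x\<bar> \<partial>lborel) \<le>
    ennreal (V * \<bar>LINT x:D|lborel. u x\<bar> + \<delta> * V * V) +
    ennreal (\<delta> powr (1 - p) * d powr (real CARD('n) + p * s)) *
      (\<integral>\<^sup>+z\<in>D \<times> D. ennreal (\<bar>u (fst z) - u (snd z)\<bar> powr p) \<partial>gagliardo p s)"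
proof -
  have [measurable]: "u \<in> borel_measurable borel" using borel_measurable_integrable[OF u] by simp
  define \<gamma> where "\<gamma> = real CARD('n) + p * s"
  have \<gamma>: "\<gamma> > 0" using ps by (simp add: \<gamma>_def add_pos_pos)
  define c where "c = \<delta> powr (1 - p) * d powr \<gamma>"
  define I where "I = (LINT x:D|lborel. u x)"
  define E where "E x = (\<integral>\<^sup>+y. ennreal (norm (x - y) powr - \<gamma>) *
      (ennreal (\<bar>u x - u y\<bar> powr p) * indicator (D \<times> D) (x, y)) \<partial>lborel)" for x
  have uD: "integrable lborel (\<lambda>x. indicator D x * u x)"
    using integrable_mult_indicator[OF _ u, of D] by simp
  have D1: "integrable lborel (\<lambda>x. indicator D x :: real)" using DV by (simp add: integrable_indicator_iff)
  have mD: "measure lborel D = V" using DV V by (simp add: measure_def)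
  have point: "\<bar>u x - u y\<bar> \<le> \<delta> + c * (norm (x - y) powr - \<gamma> * \<bar>u x - u y\<bar> powr p)"
    if "x \<in> D" "y \<in> D" for x y
  proof (cases "\<bar>u x - u y\<bar> \<le> \<delta>")
    case True
    have "c * (norm (x - y) powr - \<gamma> * \<bar>u x - u y\<bar> powr p) \<ge> 0" by (simp add: c_def)
    then show ?thesis using True by linarith
  next
    case False
    define t where "t = \<bar>u x - u y\<bar>"
    have t: "t > \<delta>" "t > 0" using False \<delta> by (auto simp: t_def)
    have xy: "norm (x - y) > 0" using t by (auto simp: t_def)
    have "t = t powr (1 - p) * t powr p" using t by (simp flip: powr_add)
    also have "\<dots> \<le> \<delta> powr (1 - p) * t powr p"
      using t \<delta> ps by (intro mult_right_mono powr_mono2') auto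
    also have "\<dots> \<le> \<delta> powr (1 - p) * t powr p * (d powr \<gamma> * norm (x - y) powr - \<gamma>)"
    proof -
      \<comment> \<open>Inside the cell the kernel can be inserted at the price of the factor
        \<open>d powr \<gamma>\<close>.\<close>
      have "norm (x - y) powr \<gamma> \<le> d powr \<gamma>" using diam[OF that] \<gamma> by (intro powr_mono2) auto
      then have "1 \<le> d powr \<gamma> * norm (x - y) powr - \<gamma>"
        using xy by (simp add: powr_minus field_simps)
      then have "\<delta> powr (1 - p) * t powr p * 1 \<le> \<delta> powr (1 - p) * t powr p * (d powr \<gamma> * norm (x - y) powr - \<gamma>)"
        by (intro mult_left_mono) auto
      then show ?thesis by simp
    qed
    finally show ?thesis using \<delta> by (simp add: t_def c_def mult_ac)
  qed
  have inner: "ennreal (V * \<bar>u x\<bar>) \<le> ennreal (\<bar>I\<bar> + \<delta> * V) + ennreal c * E x" if x: "x \<in> D" for x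
  proof -
    have i1: "integrable lborel (\<lambda>y. indicator D y * (u x - u y))"
    proof -
      have "integrable lborel (\<lambda>y. indicator D y * u x - indicator D y * u y)"
        using uD D1 by auto
      then show ?thesis by (simp add: algebra_simps)
    qed
    have "(LINT y|lborel. indicator D y * (u x - u y)) = (LINT y|lborel. indicator D y * u x - indicator D y * u y)"
      by (simp add: algebra_simps)
    also have "\<dots> = V * u x - I"
      using uD D1 mD by (simp add: I_def set_lebesgue_integral_def)
    \<comment> \<open>The value \<open>u x\<close> is compared with the mean \<open>I / V\<close>
      over the cell; the error is an average of the oscillations \<open>u x - u y\<close>.\<close>
    finally have "V * u x = I + (LINT y|lborel. indicator D y * (u x - u y))" by simp
    then have "\<bar>V * u x\<bar> \<le> \<bar>I\<bar> + \<bar>LINT y|lborel. indicator D y * (u x - u y)\<bar>"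
      by (simp only: abs_triangle_ineq)
    then have "V * \<bar>u x\<bar> \<le> \<bar>I\<bar> + \<bar>LINT y|lborel. indicator D y * (u x - u y)\<bar>"
      using V by (simp add: abs_mult)
    also have "\<dots> \<le> \<bar>I\<bar> + (LINT y|lborel. \<bar>indicator D y * (u x - u y)\<bar>)"
      by (intro add_left_mono integral_abs_bound)
    finally have "ennreal (V * \<bar>u x\<bar>) \<le> ennreal \<bar>I\<bar> + ennreal (LINT y|lborel. \<bar>indicator D y * (u x - u y)\<bar>)"
      by (simp add: ennreal_leI flip: ennreal_plus)
    also have "ennreal (LINT y|lborel. \<bar>indicator D y * (u x - u y)\<bar>) = (\<integral>\<^sup>+y. ennreal \<bar>indicator D y * (u x - u y)\<bar> \<partial>lborel)"
      using i1 by (intro nn_integral_eq_integral[symmetric]) auto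
    also have "\<dots> \<le> (\<integral>\<^sup>+y. ennreal \<delta> * indicator D y + ennreal c * (ennreal (norm (x - y) powr - \<gamma>) *
      (ennreal (\<bar>u x - u y\<bar> powr p) * indicator (D \<times> D) (x, y))) \<partial>lborel)"
    proof (intro nn_integral_mono)
      fix y
      show "ennreal \<bar>indicator D y * (u x - u y)\<bar> \<le> ennreal \<delta> * indicator D y + ennreal c * (ennreal (norm (x - y) powr - \<gamma>) *
        (ennreal (\<bar>u x - u y\<bar> powr p) * indicator (D \<times> D) (x, y)))"
      proof (cases "y \<in> D")
        case True
        have "ennreal \<bar>u x - u y\<bar> \<le> ennreal (\<delta> + c * (norm (x - y) powr - \<gamma> * \<bar>u x - u y\<bar> powr p))"
          by (intro ennreal_leI point x True)
        also have "\<dots> = ennreal \<delta> + ennreal c * (ennreal (norm (x - y) powr - \<gamma>) * ennreal (\<bar>u x - u y\<bar> powr p))"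
          using \<delta> by (simp add: c_def ennreal_mult)
        finally show ?thesis using x True by simp
      qed simp
    qed
    also have "\<dots> = ennreal (\<delta> * V) + ennreal c * E x"
      using \<delta> V DV by (subst nn_integral_add) (auto simp: nn_integral_cmult nn_integral_cmult_indicator E_def ennreal_mult)
    finally show ?thesis using \<delta> V by (simp add: add.assoc)
  qed
  have [measurable]: "E \<in> borel_measurable borel"
    unfolding E_def by (rule lborel.borel_measurable_nn_integral) (simp add: lborel_prod case_prod_beta')
  have "ennreal V * (\<integral>\<^sup>+x\<in>D. ennreal \<bar>u x\<bar> \<partial>lborel) = (\<integral>\<^sup>+x. ennreal (V * \<bar>u x\<bar>) * indicator D x \<partial>lborel)"
    using V by (simp add: ennreal_mult mult.assoc nn_integral_cmult)
  also have "\<dots> \<le> (\<integral>\<^sup>+x. ennreal (\<bar>I\<bar> + \<delta> * V) * indicator D x + ennreal c * E x \<partial>lborel)"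
  proof (intro nn_integral_mono)
    fix x show "ennreal (V * \<bar>u x\<bar>) * indicator D x \<le> ennreal (\<bar>I\<bar> + \<delta> * V) * indicator D x + ennreal c * E x"
      using inner[of x] by (cases "x \<in> D") auto
  qed
  also have "\<dots> = ennreal (\<bar>I\<bar> + \<delta> * V) * ennreal V + ennreal c * (\<integral>\<^sup>+x. E x \<partial>lborel)"
    using DV by (subst nn_integral_add) (auto simp: nn_integral_cmult nn_integral_cmult_indicator)
  also have "(\<integral>\<^sup>+x. E x \<partial>lborel) = (\<integral>\<^sup>+z\<in>D \<times> D. ennreal (\<bar>u (fst z) - u (snd z)\<bar> powr p) \<partial>gagliardo p s)"
  proof -
    have [measurable]: "D \<times> D \<in> sets borel" using D by (simp add: borel_prod[symmetric])
    show ?thesis unfolding E_def \<gamma>_def by (subst nn_integral_gagliardo) auto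
  qed
  also have "ennreal (\<bar>I\<bar> + \<delta> * V) * ennreal V = ennreal (V * \<bar>I\<bar> + \<delta> * V * V)"
    using \<delta> V by (simp add: algebra_simps flip: ennreal_mult)
  finally show ?thesis by (simp add: I_def c_def \<gamma>_def)
qed

text \<open>Summing the cell estimates and dividing by the cell volume leaves three terms: finitely
  many cell integrals, an error proportional to \<open>\<delta>\<close>, and the energy with a
  factor that decays geometrically in \<open>k\<close>. With \<open>\<delta>\<close> fixed first and
  \<open>k\<close> afterwards, only the cell integrals remain to be controlled.\<close>

lemma dyadic_L1_estimate:
  fixes u :: "real^'n \<Rightarrow> real"
  assumes ps: "p > 1" "0 < s" and \<delta>: "\<delta> > 0"
    and \<Omega>: "\<And>x. x \<in> \<Omega> \<Longrightarrow> norm x \<le> \<rho>" and u0: "\<And>x. x \<notin> \<Omega> \<Longrightarrow> u x = 0"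
    and u: "integrable lborel u" and E: "integrable (gagliardo p s) (\<lambda>z. \<bar>u (fst z) - u (snd z)\<bar> powr p)"
  shows "(LINT x|lborel. \<bar>u x\<bar>) \<le>
    (\<Sum>z\<in>dyadic_index k ` \<Omega>. \<bar>LINT x:dyadic_cell k z|lborel. u x\<bar>) +
    \<delta> * measure lborel (cball (0::real^'n) (\<rho> + real CARD('n))) +
    \<delta> powr (1 - p) * real CARD('n) powr (real CARD('n) + p * s) * (2 powr - (p * s)) ^ k * energy p s u"
proof -
  have [measurable]: "u \<in> borel_measurable borel" using borel_measurable_integrable[OF u] by simp
  define Z where "Z = dyadic_index k ` \<Omega>"
  have finZ: "finite Z" unfolding Z_def by (rule finite_dyadic_index) (use \<Omega> in \<open>auto simp: bounded_iff\<close>)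
  define n where "n = real CARD('n)"
  define V where "V = (1 / 2 ^ k :: real) ^ CARD('n)"
  have V: "V > 0" by (simp add: V_def)
  define c where "c = \<delta> powr (1 - p) * (n / 2 ^ k) powr (n + p * s)"
  have c: "c \<ge> 0" by (simp add: c_def)
  define S where "S = (\<Sum>z\<in>Z. \<bar>LINT x:dyadic_cell k z|lborel. u x\<bar>)"
  define M where "M = measure lborel (cball (0::real^'n) (\<rho> + n))"
  have en: "energy p s u \<ge> 0" by (simp add: energy_def)
  have disj: "disjoint_family_on (dyadic_cell k) Z" by (auto simp: disjoint_family_on_def dyadic_cell_def)
  have cover: "\<Omega> \<subseteq> (\<Union>z\<in>Z. dyadic_cell k z)" by (auto simp: Z_def dyadic_cell_def)
  \<comment> \<open>All cells that meet the domain lie in one fixed ball, whatever the scale, so the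
    errors \<open>\<delta> * V\<close> of the cells add up to a multiple of \<open>\<delta>\<close>
    independent of \<open>k\<close>.\<close>
  have cardZ: "real (card Z) * V \<le> M"
  proof -
    have "(\<Union>z\<in>Z. dyadic_cell k z) \<subseteq> cball (0::real^'n) (\<rho> + n)"
    proof safe
      fix z x assume z: "z \<in> Z" and x: "x \<in> (dyadic_cell k z :: (real^'n) set)"
      obtain y where y: "y \<in> \<Omega>" "z = dyadic_index k y" using z by (auto simp: Z_def)
      have "norm (x - y) \<le> n / 2 ^ k"
        using dyadic_cell_diameter[OF x, of y] y by (simp add: dyadic_cell_def n_def)
      also have "\<dots> \<le> n / 1" by (intro divide_left_mono) (auto simp: n_def)
      finally have "norm (x - y) \<le> n" by simp
      then show "x \<in> cball 0 (\<rho> + n)"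
        using \<Omega>[OF y(1)] norm_triangle_ineq[of "x - y" y] by simp
    qed
    then have "emeasure lborel (\<Union>z\<in>Z. dyadic_cell k z) \<le> emeasure lborel (cball (0::real^'n) (\<rho> + n))"
      by (intro emeasure_mono) auto
    also have "emeasure lborel (\<Union>z\<in>Z. dyadic_cell k z) = (\<Sum>z\<in>Z. emeasure lborel (dyadic_cell k z :: (real^'n) set))"
      using disj finZ by (intro sum_emeasure[symmetric]) auto
    also have "\<dots> = ennreal (real (card Z) * V)"
      using V by (simp add: emeasure_dyadic_cell V_def ennreal_of_nat_eq_real_of_nat ennreal_mult)
    also have "emeasure lborel (cball (0::real^'n) (\<rho> + n)) = ennreal M"
      unfolding M_def using emeasure_lborel_cball_finite by (intro emeasure_eq_ennreal_measure) (auto simp: top_unique less_top[symmetric])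
    finally show ?thesis by (simp add: M_def)
  qed
  have "(\<Sum>z\<in>Z. \<integral>\<^sup>+x\<in>dyadic_cell k z \<times> dyadic_cell k z. ennreal (\<bar>u (fst x) - u (snd x)\<bar> powr p) \<partial>gagliardo p s)
      = (\<integral>\<^sup>+x. (\<Sum>z\<in>Z. ennreal (\<bar>u (fst x) - u (snd x)\<bar> powr p) * indicator (dyadic_cell k z \<times> dyadic_cell k z) x) \<partial>gagliardo p s)"
  proof (rule nn_integral_sum[symmetric])
    fix z
    have [measurable]: "(dyadic_cell k z :: (real^'n) set) \<times> dyadic_cell k z \<in> sets borel"
      using dyadic_cell_borel[of k z] by (simp add: borel_prod[symmetric])
    show "(\<lambda>x. ennreal (\<bar>u (fst x) - u (snd x)\<bar> powr p) * indicator (dyadic_cell k z \<times> dyadic_cell k z) x) \<in> borel_measurable (gagliardo p s)"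
      by measurable
  qed
  also have "\<dots> \<le> (\<integral>\<^sup>+x. ennreal (\<bar>u (fst x) - u (snd x)\<bar> powr p) \<partial>gagliardo p s)"
  proof (intro nn_integral_mono)
    fix x :: "(real^'n) \<times> (real^'n)"
    \<comment> \<open>The diagonal blocks are disjoint: a pair can only lie in the block given by
      its first component.\<close>
    have "(\<Sum>z\<in>Z. indicator (dyadic_cell k z \<times> dyadic_cell k z) x :: ennreal) \<le> (\<Sum>z\<in>Z. indicator {dyadic_index k (fst x)} z)"
      by (intro sum_mono) (auto simp: indicator_def dyadic_cell_def)
    also have "\<dots> = (\<Sum>z\<in>Z \<inter> {dyadic_index k (fst x)}. 1)"
      using finZ by (simp add: indicator_def sum.inter_restrict)
    also have "\<dots> \<le> 1"
      by (cases "dyadic_index k (fst x) \<in> Z") auto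
    finally have "ennreal (\<bar>u (fst x) - u (snd x)\<bar> powr p) * (\<Sum>z\<in>Z. indicator (dyadic_cell k z \<times> dyadic_cell k z) x) \<le>
        ennreal (\<bar>u (fst x) - u (snd x)\<bar> powr p) * 1"
      by (intro mult_left_mono) auto
    then show "(\<Sum>z\<in>Z. ennreal (\<bar>u (fst x) - u (snd x)\<bar> powr p) * indicator (dyadic_cell k z \<times> dyadic_cell k z) x)
        \<le> ennreal (\<bar>u (fst x) - u (snd x)\<bar> powr p)"
      by (simp add: sum_distrib_left)
  qed
  also have "\<dots> = ennreal (energy p s u)"
    unfolding energy_def by (rule nn_integral_eq_integral[OF E]) auto
  finally have energy_le: "(\<Sum>z\<in>Z. \<integral>\<^sup>+x\<in>dyadic_cell k z \<times> dyadic_cell k z.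
      ennreal (\<bar>u (fst x) - u (snd x)\<bar> powr p) \<partial>gagliardo p s) \<le> ennreal (energy p s u)" .
  have "ennreal (V * (LINT x|lborel. \<bar>u x\<bar>)) = ennreal V * (\<integral>\<^sup>+x. ennreal \<bar>u x\<bar> \<partial>lborel)"
    using u V by (simp add: nn_integral_eq_integral ennreal_mult)
  also have "\<dots> \<le> ennreal V * (\<integral>\<^sup>+x. (\<Sum>z\<in>Z. ennreal \<bar>u x\<bar> * indicator (dyadic_cell k z) x) \<partial>lborel)"
  proof (intro mult_left_mono nn_integral_mono)
    fix x
    show "ennreal \<bar>u x\<bar> \<le> (\<Sum>z\<in>Z. ennreal \<bar>u x\<bar> * indicator (dyadic_cell k z) x)"
    proof (cases "x \<in> \<Omega>")
      case True
      then have "dyadic_index k x \<in> Z" by (simp add: Z_def)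
      then have "ennreal \<bar>u x\<bar> * indicator (dyadic_cell k (dyadic_index k x)) x \<le>
          (\<Sum>z\<in>Z. ennreal \<bar>u x\<bar> * indicator (dyadic_cell k z) x)"
        using finZ by (intro member_le_sum) auto
      then show ?thesis by (simp add: dyadic_cell_def)
    qed (simp add: u0)
  qed simp
  also have "(\<integral>\<^sup>+x. (\<Sum>z\<in>Z. ennreal \<bar>u x\<bar> * indicator (dyadic_cell k z) x) \<partial>lborel)
      = (\<Sum>z\<in>Z. \<integral>\<^sup>+x\<in>dyadic_cell k z. ennreal \<bar>u x\<bar> \<partial>lborel)"
    by (rule nn_integral_sum) measurable
  also have "ennreal V * \<dots> = (\<Sum>z\<in>Z. ennreal V * (\<integral>\<^sup>+x\<in>dyadic_cell k z. ennreal \<bar>u x\<bar> \<partial>lborel))"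
    by (simp add: sum_distrib_left)
  also have "\<dots> \<le> (\<Sum>z\<in>Z. ennreal (V * \<bar>LINT x:dyadic_cell k z|lborel. u x\<bar> + \<delta> * V * V) +
      ennreal c * (\<integral>\<^sup>+x\<in>dyadic_cell k z \<times> dyadic_cell k z. ennreal (\<bar>u (fst x) - u (snd x)\<bar> powr p) \<partial>gagliardo p s))"
    unfolding c_def n_def
    by (intro sum_mono cell_L1_estimate ps \<delta> V u dyadic_cell_borel dyadic_cell_diameter)
      (auto simp: emeasure_dyadic_cell V_def)
  also have "\<dots> = ennreal (\<Sum>z\<in>Z. V * \<bar>LINT x:dyadic_cell k z|lborel. u x\<bar> + \<delta> * V * V) +
      ennreal c * (\<Sum>z\<in>Z. \<integral>\<^sup>+x\<in>dyadic_cell k z \<times> dyadic_cell k z. ennreal (\<bar>u (fst x) - u (snd x)\<bar> powr p) \<partial>gagliardo p s)"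
    using V \<delta> by (subst sum.distrib, subst sum_ennreal) (auto simp: sum_distrib_left)
  also have "(\<Sum>z\<in>Z. V * \<bar>LINT x:dyadic_cell k z|lborel. u x\<bar> + \<delta> * V * V) = V * S + \<delta> * V * (real (card Z) * V)"
    by (simp add: sum.distrib S_def sum_distrib_left)
  also have "ennreal (V * S + \<delta> * V * (real (card Z) * V)) + ennreal c *
      (\<Sum>z\<in>Z. \<integral>\<^sup>+x\<in>dyadic_cell k z \<times> dyadic_cell k z. ennreal (\<bar>u (fst x) - u (snd x)\<bar> powr p) \<partial>gagliardo p s)
      \<le> ennreal (V * S + \<delta> * V * (real (card Z) * V)) + ennreal c * ennreal (energy p s u)"
    by (intro add_left_mono mult_left_mono energy_le) simp
  also have "ennreal (V * S + \<delta> * V * (real (card Z) * V)) + ennreal c * ennreal (energy p s u)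
      = ennreal (V * S + \<delta> * V * (real (card Z) * V) + c * energy p s u)"
    using V \<delta> c en by (simp add: S_def sum_nonneg ennreal_mult)
  finally have "V * (LINT x|lborel. \<bar>u x\<bar>) \<le> V * S + \<delta> * V * (real (card Z) * V) + c * energy p s u"
    using V \<delta> c en by (subst (asm) ennreal_le_iff) (auto simp: S_def sum_nonneg)
  also have "\<dots> \<le> V * S + \<delta> * V * M + c * energy p s u"
    using V \<delta> cardZ by simp
  \<comment> \<open>Of the power \<open>n + p * s\<close> of the cell size, the part
    \<open>n\<close> is the cell volume and cancels on division by \<open>V\<close>; the part
    \<open>p * s\<close> is the gain that makes the energy term small.\<close>
  also have "c = V * (\<delta> powr (1 - p) * n powr (n + p * s) * (2 powr - (p * s)) ^ k)"
  proof -
    have half: "(1 / 2 ^ k :: real) = 2 powr - real k" by (simp add: powr_minus powr_realpow divide_inverse)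
    have "V = (2 powr - real k) ^ CARD('n)" unfolding V_def half ..
    also have "\<dots> = (2 powr - real k) powr n" by (simp add: n_def powr_realpow)
    finally have V': "V = 2 powr (- real k * n)" by (simp only: powr_powr)
    have 2: "n / 2 ^ k = n * 2 powr - real k" by (simp add: powr_minus powr_realpow divide_inverse)
    have "(2 powr - (p * s)) ^ k = 2 powr (- (p * s) * real k)"
      by (simp add: powr_powr flip: powr_realpow)
    then show ?thesis
      unfolding c_def 2 V' powr_mult powr_powr
      by (simp add: algebra_simps powr_add[symmetric])
  qed
  also have "V * S + \<delta> * V * M + V * (\<delta> powr (1 - p) * n powr (n + p * s) * (2 powr - (p * s)) ^ k) * energy p s u
     = V * (S + \<delta> * M + \<delta> powr (1 - p) * n powr (n + p * s) * (2 powr - (p * s)) ^ k * energy p s u)"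
    by (simp add: algebra_simps)
  finally show ?thesis using V by (simp add: S_def M_def Z_def n_def)
qed

section \<open>Sequences of bounded energy\<close>

lemma energy_add:
  fixes u v :: "real^'n \<Rightarrow> real"
  assumes p: "p > 0" and [measurable]: "u \<in> borel_measurable borel" "v \<in> borel_measurable borel"
    and u: "integrable (gagliardo p s) (\<lambda>z. \<bar>u (fst z) - u (snd z)\<bar> powr p)"
    and v: "integrable (gagliardo p s) (\<lambda>z. \<bar>v (fst z) - v (snd z)\<bar> powr p)"
  shows "integrable (gagliardo p s) (\<lambda>z. \<bar>(u (fst z) + v (fst z)) - (u (snd z) + v (snd z))\<bar> powr p)"
    and "energy p s (\<lambda>x. u x + v x) \<le> 2 powr p * (energy p s u + energy p s v)"
proof -
  have eq: "(u (fst z) + v (fst z)) - (u (snd z) + v (snd z)) =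
      (u (fst z) - u (snd z)) + (v (fst z) - v (snd z))" for z by simp
  show i: "integrable (gagliardo p s) (\<lambda>z. \<bar>(u (fst z) + v (fst z)) - (u (snd z) + v (snd z))\<bar> powr p)"
    unfolding eq by (rule integrable_powr_add[OF p _ _ u v]) measurable
  have "energy p s (\<lambda>x. u x + v x) \<le> (LINT z|gagliardo p s. 2 powr p *
      (\<bar>u (fst z) - u (snd z)\<bar> powr p + \<bar>v (fst z) - v (snd z)\<bar> powr p))"
    unfolding energy_def using u v i powr_add_le[OF p] unfolding eq
    by (intro integral_mono) auto
  then show "energy p s (\<lambda>x. u x + v x) \<le> 2 powr p * (energy p s u + energy p s v)"
    using u v by (simp add: energy_def)
qed

text \<open>A diagonal subsequence makes the integrals over all dyadic cells converge. The dyadic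
  estimate applied to differences of its terms shows that it is Cauchy in mean, and a further
  subsequence converges almost everywhere.\<close>

theorem energy_compact:
  fixes u :: "nat \<Rightarrow> real^'n \<Rightarrow> real"
  assumes ps: "p > 1" "0 < s" and bdd: "bounded \<Omega>"
    and u0: "\<And>j x. x \<notin> \<Omega> \<Longrightarrow> u j x = 0"
    and u: "\<And>j. integrable lborel (u j)" "\<And>j. (LINT x|lborel. \<bar>u j x\<bar>) \<le> C1"
    and E: "\<And>j. integrable (gagliardo p s) (\<lambda>z. \<bar>u j (fst z) - u j (snd z)\<bar> powr p)"
      "\<And>j. energy p s (u j) \<le> C"
  obtains \<sigma> v where "strict_mono (\<sigma> :: nat \<Rightarrow> nat)" "v \<in> borel_measurable borel"
    "\<And>x. x \<notin> \<Omega> \<Longrightarrow> v x = 0" "AE x in lborel. (\<lambda>n. u (\<sigma> n) x) \<longlonglongrightarrow> v x"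
proof -
  obtain \<rho> where \<rho>: "\<And>x. x \<in> \<Omega> \<Longrightarrow> norm x \<le> \<rho>" using bdd by (auto simp: bounded_iff)
  have um[measurable]: "u j \<in> borel_measurable borel" for j using borel_measurable_integrable[OF u(1)] by simp
  define I where "I j a = (LINT x:dyadic_cell (fst a) (snd a)|lborel. u j x)" for j and a :: "nat \<times> ('n \<Rightarrow> int)"
  \<comment> \<open>Cells of all scales at once: still countably many, so one diagonal extraction
    serves every later choice of \<open>k\<close>.\<close>
  define T where "T = (\<Union>k. {k} \<times> dyadic_index k ` \<Omega>)"
  have "countable T"
    unfolding T_def using finite_dyadic_index[OF bdd] by (auto intro!: countable_finite)
  moreover have "norm (I j a) \<le> C1" for j a
  proof -
    have "norm (I j a) \<le> (LINT x|lborel. \<bar>indicator (dyadic_cell (fst a) (snd a)) x * u j x\<bar>)"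
      unfolding I_def set_lebesgue_integral_def by simp
    also have "\<dots> \<le> (LINT x|lborel. \<bar>u j x\<bar>)"
      using u(1)[of j] integrable_mult_indicator[OF _ u(1), of "dyadic_cell (fst a) (snd a)" j]
      by (intro integral_mono) (auto simp: indicator_def)
    also have "\<dots> \<le> C1" by (rule u)
    finally show ?thesis .
  qed
  ultimately obtain \<tau> :: "nat \<Rightarrow> nat" where \<tau>: "strict_mono \<tau>"
    and conv: "\<And>a. a \<in> T \<Longrightarrow> \<exists>l. (\<lambda>n. I (\<tau> n) a) \<longlonglongrightarrow> l"
    using function_convergent_subsequence[of T I C1] by metis
  have Cauchy: "\<exists>N. \<forall>i\<ge>N. \<forall>j\<ge>N. (LINT x|lborel. \<bar>u (\<tau> i) x - u (\<tau> j) x\<bar>) < e" if e: "e > 0" for e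
  proof -
    define M where "M = measure lborel (cball (0::real^'n) (\<rho> + real CARD('n)))"
    have M: "M \<ge> 0" by (simp add: M_def)
    \<comment> \<open>Leaves \<open>\<delta> * M\<close> strictly below a third of \<open>e\<close>,
      even if \<open>M = 0\<close>. The scale \<open>k\<close> comes after \<open>\<delta>\<close>,
      because \<open>K\<close> contains the negative power
      \<open>\<delta> powr (1 - p)\<close>.\<close>
    define \<delta> where "\<delta> = e / (3 * (M + 1))"
    have \<delta>: "\<delta> > 0" using e M by (simp add: \<delta>_def)
    have \<delta>M: "\<delta> * M < e / 3" using e M by (simp add: \<delta>_def field_simps)
    define C2 where "C2 = 2 powr p * (C + C)"
    define K where "K = \<delta> powr (1 - p) * real CARD('n) powr (real CARD('n) + p * s)"
    have "(\<lambda>k. K * (2 powr - (p * s)) ^ k * C2) \<longlonglongrightarrow> K * 0 * C2"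
      using ps by (intro tendsto_intros LIMSEQ_power_zero) (auto simp: powr_less_one)
    then have "\<forall>\<^sub>F k in sequentially. K * (2 powr - (p * s)) ^ k * C2 < e / 3"
      using e by (intro order_tendstoD) auto
    then obtain k where k: "K * (2 powr - (p * s)) ^ k * C2 < e / 3"
      by (auto simp: eventually_sequentially)
    define Z where "Z = dyadic_index k ` \<Omega>"
    have finZ: "finite Z" unfolding Z_def by (rule finite_dyadic_index[OF bdd])
    have "\<exists>N. \<forall>i\<ge>N. \<forall>j\<ge>N. \<bar>I (\<tau> i) (k, z) - I (\<tau> j) (k, z)\<bar> < e / (3 * (real (card Z) + 1))" if "z \<in> Z" for z
    proof -
      have "(k, z) \<in> T" using that by (auto simp: T_def Z_def)
      then have "Cauchy (\<lambda>n. I (\<tau> n) (k, z))" using conv LIMSEQ_imp_Cauchy by blast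
      then show ?thesis using e by (simp add: Cauchy_def dist_real_def)
    qed
    then obtain N where N: "\<And>z i j. z \<in> Z \<Longrightarrow> i \<ge> N z \<Longrightarrow> j \<ge> N z \<Longrightarrow>
        \<bar>I (\<tau> i) (k, z) - I (\<tau> j) (k, z)\<bar> < e / (3 * (real (card Z) + 1))"
      by metis
    show ?thesis
    proof (intro exI allI impI)
      \<comment> \<open>The sum of the thresholds \<open>N z\<close> serves as their common upper
        bound.\<close>
      fix i j assume ij: "(\<Sum>z\<in>Z. N z) \<le> i" "(\<Sum>z\<in>Z. N z) \<le> j"
      define w where "w x = u (\<tau> i) x + - u (\<tau> j) x" for x
      have [measurable]: "(\<lambda>x. - u (\<tau> j) x) \<in> borel_measurable borel" by measurable
      have neg: "\<bar>- u (\<tau> j) (fst z) - - u (\<tau> j) (snd z)\<bar> = \<bar>u (\<tau> j) (fst z) - u (\<tau> j) (snd z)\<bar>" for z by simp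
      have neg': "energy p s (\<lambda>x. - u (\<tau> j) x) = energy p s (u (\<tau> j))"
        unfolding energy_def neg ..
      have we: "integrable (gagliardo p s) (\<lambda>z. \<bar>w (fst z) - w (snd z)\<bar> powr p)" "energy p s w \<le> C2"
      proof -
        have en: "integrable (gagliardo p s) (\<lambda>z. \<bar>- u (\<tau> j) (fst z) - - u (\<tau> j) (snd z)\<bar> powr p)"
          unfolding neg by (rule E)
        show "integrable (gagliardo p s) (\<lambda>z. \<bar>w (fst z) - w (snd z)\<bar> powr p)"
          unfolding w_def using ps by (intro energy_add(1)[OF _ _ _ E(1) en]) auto
        have "energy p s w \<le> 2 powr p * (energy p s (u (\<tau> i)) + energy p s (\<lambda>x. - u (\<tau> j) x))"
          unfolding w_def using ps by (intro energy_add(2)[OF _ _ _ E(1) en]) auto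
        also have "\<dots> \<le> C2" unfolding C2_def neg' by (intro mult_left_mono add_mono E) auto
        finally show "energy p s w \<le> C2" .
      qed
      have wi: "integrable lborel w" unfolding w_def using u(1) by auto
      have Iw: "\<bar>LINT x:dyadic_cell k z|lborel. w x\<bar> \<le> e / (3 * (real (card Z) + 1))" if z: "z \<in> Z" for z
      proof -
        have "(LINT x:dyadic_cell k z|lborel. w x) = I (\<tau> i) (k, z) - I (\<tau> j) (k, z)"
          using integrable_mult_indicator[OF _ u(1), of "dyadic_cell k z" "\<tau> i"]
            integrable_mult_indicator[OF _ u(1), of "dyadic_cell k z" "\<tau> j"]
          by (simp add: I_def w_def set_lebesgue_integral_def right_diff_distrib)
        moreover have "N z \<le> (\<Sum>z\<in>Z. N z)" using z finZ by (intro member_le_sum) auto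
        ultimately show ?thesis using N[OF z, of i j] ij by simp
      qed
      have "(LINT x|lborel. \<bar>w x\<bar>) \<le> (\<Sum>z\<in>Z. \<bar>LINT x:dyadic_cell k z|lborel. w x\<bar>) +
          \<delta> * M + K * (2 powr - (p * s)) ^ k * energy p s w"
        unfolding Z_def M_def K_def
        by (rule dyadic_L1_estimate[OF ps \<delta> \<rho> _ wi we(1)]) (auto simp: w_def u0)
      also have "\<dots> \<le> (\<Sum>z\<in>Z. e / (3 * (real (card Z) + 1))) + \<delta> * M + K * (2 powr - (p * s)) ^ k * C2"
        using \<delta> by (intro add_mono sum_mono Iw mult_left_mono we) (auto simp: K_def)
      also have "(\<Sum>z\<in>Z. e / (3 * (real (card Z) + 1))) \<le> e / 3"
        using e by (simp add: field_simps)
      finally show "(LINT x|lborel. \<bar>u (\<tau> i) x - u (\<tau> j) x\<bar>) < e"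
        using \<delta>M k by (simp add: w_def)
    qed
  qed
  obtain \<theta> :: "nat \<Rightarrow> nat" where \<theta>: "strict_mono \<theta>" and ae: "AE x in lborel. convergent (\<lambda>n. u (\<tau> (\<theta> n)) x)"
    using L1_Cauchy_AE_subseq[of lborel "\<lambda>n. u (\<tau> n)", OF u(1) Cauchy] by metis
  show ?thesis
  proof (rule that[of "\<tau> \<circ> \<theta>" "\<lambda>x. lim (\<lambda>n. u (\<tau> (\<theta> n)) x)"])
    show "strict_mono (\<tau> \<circ> \<theta>)" using \<tau> \<theta> by (rule strict_mono_o)
    show "(\<lambda>x. lim (\<lambda>n. u (\<tau> (\<theta> n)) x)) \<in> borel_measurable borel" by measurable
    show "lim (\<lambda>n. u (\<tau> (\<theta> n)) x) = 0" if "x \<notin> \<Omega>" for x using u0[OF that] by (simp add: limI)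
    show "AE x in lborel. (\<lambda>n. u ((\<tau> \<circ> \<theta>) n) x) \<longlonglongrightarrow> lim (\<lambda>n. u (\<tau> (\<theta> n)) x)"
      using ae by eventually_elim (simp add: convergent_LIMSEQ_iff)
  qed
qed

section \<open>The variational setting\<close>

text \<open>Solving the bound on \<open>l\<close> for the base of \<open>R\<close> and raising it to
  the power \<open>(p - 1 + q) / (r - p + 1)\<close> gives the claim. This is the only place where
  the closed formula of the threshold is unravelled.\<close>

lemma nehari_gap:
  fixes p q r l \<sigma> na nb :: real
  assumes "0 < q" "q < 1" "q < p - 1" "p - 1 < r" "0 < l" "\<sigma> > 0" "na > 0" "nb > 0"
    and l: "l < (p - 1 + q) / (r + q) * ((r - p + 1) / (r + q)) powr ((r - p + 1) / (p - 1 + q))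
         * (1 / nb) * (\<sigma> powr (r + q) / na powr (r - p + 1)) powr (1 / (p - 1 + q))"
    and cb: "cb = nb * \<sigma> powr (- ((r + 1) / p))"
  shows "na * \<sigma> powr (- ((1 - q) / p)) <
    (r - p + 1) / (r + q) * (((p - 1 + q) / (l * (r + q) * cb)) powr (1 / (r - p + 1))) powr (p - 1 + q)"
proof -
  define \<alpha> where "\<alpha> = p - 1 + q"
  define \<beta> where "\<beta> = r + q"
  define d where "d = r - p + 1"
  have pos: "\<alpha> > 0" "\<beta> > 0" "d > 0" "p > 0" using assms by (auto simp: \<alpha>_def \<beta>_def d_def)
  define k where "k = d / \<beta>"
  have k: "k > 0" using pos by (simp add: k_def)
  \<comment> \<open>Chosen so that the hypothesis on \<open>l\<close> reads
    \<open>l < \<alpha> / \<beta> * x / nb\<close>.\<close>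
  define x where "x = k powr (d / \<alpha>) * (\<sigma> powr \<beta> / na powr d) powr (1 / \<alpha>)"
  have x: "x > 0" using k assms by (simp add: x_def)
  have cb0: "cb > 0" using assms by simp
  have "l * (\<beta> * nb) < \<alpha> * x"
    using l pos assms unfolding \<alpha>_def[symmetric] \<beta>_def[symmetric] d_def[symmetric] k_def[symmetric]
    by (simp add: x_def field_simps)
  then have "nb / x < \<alpha> / (l * \<beta>)" using x pos assms by (simp add: field_simps)
  then have "nb / x / cb < \<alpha> / (l * \<beta>) / cb" using cb0 by (rule divide_strict_right_mono)
  then have 1: "nb / x / cb < \<alpha> / (l * \<beta> * cb)" by simp
  have 2: "nb / x / cb = \<sigma> powr ((r + 1) / p) / x"
    using assms by (simp add: cb powr_minus field_simps)
  have "(\<sigma> powr ((r + 1) / p) / x) powr (\<alpha> / d) < (\<alpha> / (l * \<beta> * cb)) powr (\<alpha> / d)"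
    using 1 x pos assms unfolding 2 by (intro powr_less_mono2) auto
  moreover have "(\<sigma> powr ((r + 1) / p) / x) powr (\<alpha> / d) = \<sigma> powr (- ((1 - q) / p)) * na / k"
  proof -
    have "x powr (\<alpha> / d) = k * (\<sigma> powr (\<beta> / d) / na)"
      using pos k assms by (simp add: x_def powr_mult powr_divide powr_powr)
    moreover have "(\<sigma> powr ((r + 1) / p)) powr (\<alpha> / d) = \<sigma> powr (\<beta> / d) * \<sigma> powr (- ((1 - q) / p))"
    proof -
      have "(r + 1) / p * (\<alpha> / d) = \<beta> / d + - ((1 - q) / p)"
      proof -
        \<comment> \<open>Because of this identity the powers of \<open>\<sigma>\<close> contained
          in \<open>ca\<close> and \<open>cb\<close> combine to the single power of the Sobolev
          constant in the threshold.\<close>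
        have "(r + 1) * \<alpha> = \<beta> * p - (1 - q) * d" by (simp add: \<alpha>_def \<beta>_def d_def algebra_simps)
        then show ?thesis using pos by (simp add: divide_simps)
      qed
      then show ?thesis by (simp only: powr_powr powr_add)
    qed
    ultimately show ?thesis using pos k assms by (simp add: powr_divide)
  qed
  ultimately have "\<sigma> powr (- ((1 - q) / p)) * na / k < (\<alpha> / (l * \<beta> * cb)) powr (\<alpha> / d)" by simp
  then have "na * \<sigma> powr (- ((1 - q) / p)) < k * (\<alpha> / (l * \<beta> * cb)) powr (\<alpha> / d)"
    using k by (simp add: field_simps)
  then show ?thesis
    by (simp add: powr_powr k_def \<alpha>_def \<beta>_def d_def)
qed

section \<open>The space of Borel representatives\<close>

text \<open>Borel functions vanishing at every point outside the domain. Differences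
  \<open>w (fst z) - w (snd z)\<close> are then Borel on the product, and energies over
  \<open>Q\<close> and over the whole space agree without exceptional sets. Every element of
  \<open>X0\<close> has such a representative.\<close>

definition X0_borel :: "real \<Rightarrow> real \<Rightarrow> (real^'n) set \<Rightarrow> (real^'n \<Rightarrow> real) set" where
  "X0_borel p s \<Omega> = {w \<in> borel_measurable borel. (\<forall>x. x \<notin> \<Omega> \<longrightarrow> w x = 0) \<and>
     integrable lborel (\<lambda>x. \<bar>w x\<bar> powr p) \<and>
     integrable (gagliardo p s) (\<lambda>z. \<bar>w (fst z) - w (snd z)\<bar> powr p)}"

lemma X0_borel_zero: "w \<in> X0_borel p s \<Omega> \<Longrightarrow> x \<notin> \<Omega> \<Longrightarrow> w x = 0"
  by (simp add: X0_borel_def)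

lemma X0_borel_energy: "w \<in> X0_borel p s \<Omega> \<Longrightarrow> integrable (gagliardo p s) (\<lambda>z. \<bar>w (fst z) - w (snd z)\<bar> powr p)"
  by (simp add: X0_borel_def)

lemma energy_nonneg[simp]: "energy p s w \<ge> 0"
  by (simp add: energy_def)

lemma X0_borel_scale:
  assumes w: "w \<in> X0_borel p s \<Omega>"
  shows "(\<lambda>x. c * w x) \<in> X0_borel p s \<Omega>" "energy p s (\<lambda>x. c * w x) = \<bar>c\<bar> powr p * energy p s w"
proof -
  have eq: "\<bar>c * w x - c * w y\<bar> powr p = \<bar>c\<bar> powr p * \<bar>w x - w y\<bar> powr p" for x y
    by (simp add: powr_mult abs_mult flip: right_diff_distrib)
  show "(\<lambda>x. c * w x) \<in> X0_borel p s \<Omega>" "energy p s (\<lambda>x. c * w x) = \<bar>c\<bar> powr p * energy p s w"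
    using w by (auto simp: X0_borel_def energy_def eq abs_mult powr_mult)
qed

lemma X0_borel_add:
  assumes "p > 0" "w \<in> X0_borel p s \<Omega>" "v \<in> X0_borel p s \<Omega>"
  shows "(\<lambda>x. w x + v x) \<in> X0_borel p s \<Omega>"
proof -
  have [measurable]: "w \<in> borel_measurable borel" "v \<in> borel_measurable borel"
    using assms by (auto simp: X0_borel_def)
  have "integrable (gagliardo p s) (\<lambda>z. \<bar>(w (fst z) + v (fst z)) - (w (snd z) + v (snd z))\<bar> powr p)"
    by (rule energy_add(1)[OF assms(1) _ _ X0_borel_energy[OF assms(2)] X0_borel_energy[OF assms(3)]]) measurable
  moreover have "integrable lborel (\<lambda>x. \<bar>w x + v x\<bar> powr p)"
    by (rule integrable_powr_add[OF assms(1)]) (use assms(2,3) in \<open>auto simp: X0_borel_def\<close>)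
  ultimately show ?thesis using assms(2,3) by (simp add: X0_borel_def)
qed

text \<open>A map that does not increase distances does not increase the integrand of the energy;
  positive parts and absolute values are the instances.\<close>

lemma X0_borel_contraction:
  assumes p: "p > 0" and w: "w \<in> X0_borel p s \<Omega>"
    and g[measurable]: "g \<in> borel_measurable borel" and g0: "g 0 = 0" and Lip: "\<And>x y. \<bar>g x - g y\<bar> \<le> \<bar>x - y\<bar>"
  shows "(\<lambda>x. g (w x)) \<in> X0_borel p s \<Omega>" "energy p s (\<lambda>x. g (w x)) \<le> energy p s w"
proof -
  have [measurable]: "w \<in> borel_measurable borel" using w by (auto simp: X0_borel_def)
  have le: "\<bar>g (w x) - g (w y)\<bar> powr p \<le> \<bar>w x - w y\<bar> powr p" for x y
    using p Lip by (intro powr_mono2) auto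
  have i1: "integrable (gagliardo p s) (\<lambda>z. \<bar>g (w (fst z)) - g (w (snd z))\<bar> powr p)"
    by (rule Bochner_Integration.integrable_bound[OF X0_borel_energy[OF w]]) (auto simp: le)
  have "\<bar>g (w x)\<bar> powr p \<le> \<bar>w x\<bar> powr p" for x
    using p Lip[of "w x" 0] by (intro powr_mono2) (auto simp: g0)
  moreover have "integrable lborel (\<lambda>x. \<bar>w x\<bar> powr p)" using w by (simp add: X0_borel_def)
  ultimately have "integrable lborel (\<lambda>x. \<bar>g (w x)\<bar> powr p)"
    by (intro Bochner_Integration.integrable_bound[of lborel "\<lambda>x. \<bar>w x\<bar> powr p" "\<lambda>x. \<bar>g (w x)\<bar> powr p"]) simp_all
  then show "(\<lambda>x. g (w x)) \<in> X0_borel p s \<Omega>" using w i1 by (auto simp: X0_borel_def g0)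
  show "energy p s (\<lambda>x. g (w x)) \<le> energy p s w"
    unfolding energy_def by (intro integral_mono i1 X0_borel_energy[OF w] le)
qed

lemma X0_borel_pos_part:
  assumes "p > 0" "w \<in> X0_borel p s \<Omega>"
  shows "(\<lambda>x. max (w x) 0) \<in> X0_borel p s \<Omega>" "energy p s (\<lambda>x. max (w x) 0) \<le> energy p s w"
  using X0_borel_contraction[OF assms, of "\<lambda>x. max x 0"] by (auto simp: max_def)

lemma X0_borel_abs:
  assumes "p > 0" "w \<in> X0_borel p s \<Omega>"
  shows "(\<lambda>x. \<bar>w x\<bar>) \<in> X0_borel p s \<Omega>"
  using X0_borel_contraction[OF assms, of "\<lambda>x. \<bar>x\<bar>"] by auto

text \<open>The source of all explicit elements of the space: the positive test function and the
  cut-offs around a compact set.\<close>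

lemma X0_borel_Lipschitz:
  fixes f :: "real^'n \<Rightarrow> real"
  assumes ps: "p > 0" "0 < s" "s < 1" and bdd: "bounded \<Omega>"
    and Lip: "\<And>x y. \<bar>f x - f y\<bar> \<le> L * norm (x - y)" and bd: "\<And>x. \<bar>f x\<bar> \<le> m"
    and supp: "\<And>x. x \<notin> \<Omega> \<Longrightarrow> f x = 0"
  shows "f \<in> X0_borel p s \<Omega>"
proof -
  obtain \<rho> where \<rho>: "\<And>x. x \<in> \<Omega> \<Longrightarrow> norm x \<le> \<rho>" using bdd by (auto simp: bounded_iff)
  have Lip': "\<bar>f x - f y\<bar> \<le> (\<bar>L\<bar> + 1) * norm (x - y)" for x y
    by (rule order_trans[OF Lip mult_right_mono]) auto
  have "continuous_on UNIV f"
    by (intro lipschitz_on_continuous_on[of "\<bar>L\<bar> + 1"] lipschitz_onI)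
      (use Lip' in \<open>auto simp: dist_norm\<close>)
  then have [measurable]: "f \<in> borel_measurable borel" by (rule borel_measurable_continuous_onI)
  have "integrable (gagliardo p s) (\<lambda>z. \<bar>f (fst z) - f (snd z)\<bar> powr p)"
    by (rule Lipschitz_finite_energy[OF ps Lip bd, of \<rho>]) (use \<rho> supp in force)
  moreover have "integrable lborel (\<lambda>x. \<bar>f x\<bar> powr p)"
  proof (rule Bochner_Integration.integrable_bound)
    show "integrable lborel (\<lambda>x. indicator (cball (0::real^'n) \<rho>) x * m powr p :: real)"
      using emeasure_lborel_cball_finite[of "0::real^'n" \<rho>]
      by (intro integrable_mult_left integrable_real_indicator) simp_all
    have "\<bar>f x\<bar> powr p \<le> m powr p" for x using bd ps by (intro powr_mono2) auto
    then show "AE x in lborel. norm (\<bar>f x\<bar> powr p) \<le> norm (indicator (cball 0 \<rho>) x * m powr p)"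
      using supp \<rho> by (auto simp: indicator_def)
  qed measurable
  ultimately show ?thesis using supp by (simp add: X0_borel_def)
qed

text \<open>The Sobolev inequality may be assumed: in the application it follows from positivity of the
  constant \<open>S\<close>, which is forced by \<open>0 < \<lambda> < \<Lambda>\<close>.\<close>

locale singular_problem =
  fixes p s q r l \<sigma> P :: real and \<Omega> :: "(real^'n) set" and a b :: "real^'n \<Rightarrow> real"
  assumes s: "0 < s" "s < 1" and q: "0 < q" "q < 1" and qp: "q < p - 1" and pr: "p - 1 < r"
    and rP: "r + 1 < P" and l0: "0 < l"
    and bdd: "bounded \<Omega>" and opn: "open \<Omega>" and ne: "\<Omega> \<noteq> {}"
    and a_meas[measurable]: "a \<in> borel_measurable borel" and b_meas[measurable]: "b \<in> borel_measurable borel"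
    and a_pos: "\<And>x. x \<in> \<Omega> \<Longrightarrow> a x > 0" and a_zero: "\<And>x. x \<notin> \<Omega> \<Longrightarrow> a x = 0"
    and b_zero: "\<And>x. x \<notin> \<Omega> \<Longrightarrow> b x = 0"
    and b_pos: "\<not> (AE x in lborel. b x \<le> 0)"
    and a_int: "integrable lborel (\<lambda>x. \<bar>a x\<bar> powr (P / (P - (1 - q))))"
    and b_int: "integrable lborel (\<lambda>x. \<bar>b x\<bar> powr (P / (P - (r + 1))))"
    and sobolev_int: "\<And>w. w \<in> X0_borel p s \<Omega> \<Longrightarrow> integrable lborel (\<lambda>x. \<bar>w x\<bar> powr P)"
    and sobolev: "\<And>w. w \<in> X0_borel p s \<Omega> \<Longrightarrow> \<sigma> * (LINT x|lborel. \<bar>w x\<bar> powr P) powr (p / P) \<le> energy p s w"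
    and \<sigma>: "\<sigma> > 0"
    and l_less: "\<And>na nb. na = (LINT x|lborel. \<bar>a x\<bar> powr (P / (P - (1 - q)))) powr ((P - (1 - q)) / P) \<Longrightarrow>
      nb = (LINT x|lborel. \<bar>b x\<bar> powr (P / (P - (r + 1)))) powr ((P - (r + 1)) / P) \<Longrightarrow>
      l < (p - 1 + q) / (r + q) * ((r - p + 1) / (r + q)) powr ((r - p + 1) / (p - 1 + q))
         * (1 / nb) * (\<sigma> powr (r + q) / na powr (r - p + 1)) powr (1 / (p - 1 + q))"
begin

abbreviation "X \<equiv> X0_borel p s \<Omega>"

text \<open>\<open>P / (P - (1 - q))\<close> is conjugate to \<open>P / (1 - q)\<close>, the
  integrability exponent of \<open>\<bar>w\<bar> powr (1 - q)\<close>; likewise for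
  \<open>nb\<close> with \<open>r + 1\<close>. The outer exponents are the reciprocals.\<close>

definition na where "na = (LINT x|lborel. \<bar>a x\<bar> powr (P / (P - (1 - q)))) powr ((P - (1 - q)) / P)"
definition nb where "nb = (LINT x|lborel. \<bar>b x\<bar> powr (P / (P - (r + 1)))) powr ((P - (r + 1)) / P)"
definition ca where "ca = na * \<sigma> powr (- ((1 - q) / p))"
definition cb where "cb = nb * \<sigma> powr (- ((r + 1) / p))"
definition R where "R = ((p - 1 + q) / (l * (r + q) * cb)) powr (1 / (r - p + 1))"

definition nrm :: "(real^'n \<Rightarrow> real) \<Rightarrow> real" where "nrm w = energy p s w powr (1 / p)"
definition A :: "(real^'n \<Rightarrow> real) \<Rightarrow> real" where "A w = (LINT x|lborel. a x * max (w x) 0 powr (1 - q))"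
definition B :: "(real^'n \<Rightarrow> real) \<Rightarrow> real" where "B w = (LINT x|lborel. b x * max (w x) 0 powr (r + 1))"

lemma p1: "p > 1" using q qp by simp

lemma a_nonneg: "a x \<ge> 0"
  using a_pos[of x] a_zero[of x] by (cases "x \<in> \<Omega>") auto

text \<open>Division by a zero norm would make the bound on \<open>l\<close> zero, leaving no
  positive \<open>l\<close> below it.\<close>

lemma norm_pos: "na > 0" "nb > 0"
proof -
  have "na \<ge> 0" "nb \<ge> 0" by (auto simp: na_def nb_def)
  moreover have "na \<noteq> 0" "nb \<noteq> 0" using l_less[OF na_def nb_def] l0 by (auto intro!: notI)
  ultimately show "na > 0" "nb > 0" by auto
qed

sublocale nehari_scalars p q r l ca cb R
proof
  show cb: "0 < cb" using norm_pos \<sigma> by (simp add: cb_def)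
  have y: "(p - 1 + q) / (l * (r + q) * cb) > 0" using cb q qp pr l0 by simp
  show "0 < R" unfolding R_def powr_gt_zero using y by (metis less_irrefl)
  show "R powr (r - p + 1) = (p - 1 + q) / (l * (r + q) * cb)"
  proof -
    have "1 / (r - p + 1) * (r - p + 1) = 1" using pr by simp
    then show ?thesis by (simp only: R_def powr_powr powr_one[OF less_imp_le[OF y]])
  qed
  show "ca < (r - p + 1) / (r + q) * R powr (p - 1 + q)"
    unfolding ca_def R_def
    by (rule nehari_gap[OF q qp pr l0 \<sigma> norm_pos l_less[OF na_def nb_def] cb_def])
qed (use q qp pr l0 in auto)

lemma nrm_nonneg: "nrm w \<ge> 0" by (simp add: nrm_def)

lemma nrm_powr: "nrm w powr p = energy p s w"
  using p1 by (simp add: nrm_def powr_powr)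

lemma nrm_scale: "w \<in> X \<Longrightarrow> c \<ge> 0 \<Longrightarrow> nrm (\<lambda>x. c * w x) = c * nrm w"
  using p1 by (simp add: nrm_def X0_borel_scale(2) powr_mult powr_powr)

lemma A_scale: "t > 0 \<Longrightarrow> A (\<lambda>x. t * w x) = t powr (1 - q) * A w"
proof -
  assume t: "t > 0"
  have "max (t * w x) 0 = t * max (w x) 0" for x using t by (simp add: max_def zero_le_mult_iff mult_le_0_iff)
  then have "a x * max (t * w x) 0 powr (1 - q) = t powr (1 - q) * (a x * max (w x) 0 powr (1 - q))" for x
    by (simp add: powr_mult)
  then show ?thesis unfolding A_def by (simp only: integral_mult_right_zero)
qed

lemma B_scale: "t > 0 \<Longrightarrow> B (\<lambda>x. t * w x) = t powr (r + 1) * B w"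
proof -
  assume t: "t > 0"
  have "max (t * w x) 0 = t * max (w x) 0" for x using t by (simp add: max_def zero_le_mult_iff mult_le_0_iff)
  then have "b x * max (t * w x) 0 powr (r + 1) = t powr (r + 1) * (b x * max (w x) 0 powr (r + 1))" for x
    by (simp add: powr_mult)
  then show ?thesis unfolding B_def by (simp only: integral_mult_right_zero)
qed

lemma sobolev_P:
  assumes w: "w \<in> X"
  shows "(LINT x|lborel. \<bar>w x\<bar> powr P) \<le> (energy p s w / \<sigma>) powr (P / p)"
proof -
  define I where "I = (LINT x|lborel. \<bar>w x\<bar> powr P)"
  have "I \<ge> 0" by (simp add: I_def)
  have "I powr (p / P) \<le> energy p s w / \<sigma>"
    using sobolev[OF w] \<sigma> by (simp add: I_def field_simps)
  then have "(I powr (p / P)) powr (P / p) \<le> (energy p s w / \<sigma>) powr (P / p)"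
    using p1 pr rP by (intro powr_mono2) auto
  then show ?thesis using \<open>I \<ge> 0\<close> p1 pr rP by (simp add: powr_powr I_def)
qed

text \<open>Hoelder with exponents \<open>P / (P - e)\<close> and \<open>P / e\<close>, followed by
  the Sobolev inequality for the positive part. The choices \<open>e = 1 - q\<close> and
  \<open>e = r + 1\<close> produce \<open>ca\<close> and \<open>cb\<close>.\<close>

lemma X_weighted:
  assumes w: "w \<in> X" and e: "0 < e" "e < P" and [measurable]: "g \<in> borel_measurable borel"
    and g: "integrable lborel (\<lambda>x. \<bar>g x\<bar> powr (P / (P - e)))"
  shows "integrable lborel (\<lambda>x. g x * max (w x) 0 powr e)"
    and "integrable lborel (\<lambda>x. g x * \<bar>w x\<bar> powr e)"
    and "\<bar>LINT x|lborel. g x * max (w x) 0 powr e\<bar> \<le>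
      (LINT x|lborel. \<bar>g x\<bar> powr (P / (P - e))) powr ((P - e) / P) * \<sigma> powr (- (e / p)) * nrm w powr e"
proof -
  have [measurable]: "w \<in> borel_measurable borel" using w by (auto simp: X0_borel_def)
  have c: "P / (P - e) > 1" "P / e > 1" "1 / (P / (P - e)) + 1 / (P / e) = 1"
    using e by (auto simp: field_simps)
  have eq: "\<bar>\<bar>x\<bar> powr e\<bar> powr (P / e) = \<bar>x\<bar> powr P" for x :: real using e by (simp add: powr_powr)
  have int: "integrable lborel (\<lambda>x. \<bar>\<bar>w x\<bar> powr e\<bar> powr (P / e))" 
    unfolding eq by (rule sobolev_int[OF w])
  show "integrable lborel (\<lambda>x. g x * \<bar>w x\<bar> powr e)"
    by (rule Hoelder(1)[OF c _ _ g int]) auto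
  let ?v = "\<lambda>x. max (w x) 0"
  have v: "?v \<in> X" "energy p s ?v \<le> energy p s w" using X0_borel_pos_part[OF _ w] p1 by auto
  have eq': "\<bar>max x 0 powr e\<bar> powr (P / e) = \<bar>max x 0\<bar> powr P" for x :: real using e by (simp add: powr_powr)
  have int': "integrable lborel (\<lambda>x. \<bar>max (w x) 0 powr e\<bar> powr (P / e))" 
    unfolding eq' by (rule sobolev_int[OF v(1)])
  show "integrable lborel (\<lambda>x. g x * max (w x) 0 powr e)"
    by (rule Hoelder(1)[OF c _ _ g int']) auto
  have "\<bar>LINT x|lborel. g x * max (w x) 0 powr e\<bar> \<le>
      (LINT x|lborel. \<bar>g x\<bar> powr (P / (P - e))) powr (1 / (P / (P - e))) *
      (LINT x|lborel. \<bar>max (w x) 0 powr e\<bar> powr (P / e)) powr (1 / (P / e))"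
    by (rule Hoelder(2)[OF c _ _ g int']) auto
  also have "(LINT x|lborel. \<bar>max (w x) 0 powr e\<bar> powr (P / e)) powr (1 / (P / e))
      \<le> ((energy p s w / \<sigma>) powr (P / p)) powr (1 / (P / e))"
  proof (rule powr_mono2)
    have "(LINT x|lborel. \<bar>max (w x) 0 powr e\<bar> powr (P / e)) \<le> (energy p s ?v / \<sigma>) powr (P / p)"
      unfolding eq' by (rule sobolev_P[OF v(1)])
    also have "\<dots> \<le> (energy p s w / \<sigma>) powr (P / p)"
      using v(2) \<sigma> p1 e by (intro powr_mono2 divide_right_mono) auto
    finally show "(LINT x|lborel. \<bar>max (w x) 0 powr e\<bar> powr (P / e)) \<le> (energy p s w / \<sigma>) powr (P / p)" .
  qed (use e in auto)
  also have "((energy p s w / \<sigma>) powr (P / p)) powr (1 / (P / e)) = \<sigma> powr (- (e / p)) * nrm w powr e"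
  proof -
    have "P / p * (1 / (P / e)) = e / p" using e by simp
    then have "((energy p s w / \<sigma>) powr (P / p)) powr (1 / (P / e)) = (energy p s w / \<sigma>) powr (e / p)"
      by (simp only: powr_powr)
    also have "\<dots> = \<sigma> powr (- (e / p)) * energy p s w powr (e / p)"
      using \<sigma> by (simp add: powr_divide powr_minus_divide)
    finally show ?thesis by (simp add: nrm_def powr_powr)
  qed
  finally show "\<bar>LINT x|lborel. g x * max (w x) 0 powr e\<bar> \<le>
      (LINT x|lborel. \<bar>g x\<bar> powr (P / (P - e))) powr ((P - e) / P) * \<sigma> powr (- (e / p)) * nrm w powr e"
    by (simp add: mult.assoc mult_left_mono)
qed

lemmas A_int = X_weighted(1,2)[OF _ _ _ a_meas a_int] and B_int = X_weighted(1,2)[OF _ _ _ b_meas b_int]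

lemma e_bounds: "0 < 1 - q" "1 - q < P" "0 < r + 1" "r + 1 < P"
  using q qp pr rP by auto

lemma adm_X: "w \<in> X \<Longrightarrow> adm (nrm w) (A w) (B w)"
  using X_weighted(3)[OF _ e_bounds(1,2) a_meas a_int, of w] X_weighted(3)[OF _ e_bounds(3,4) b_meas b_int, of w]
  unfolding adm_def unfolding A_def B_def ca_def cb_def na_def nb_def
  by (simp add: nrm_nonneg a_nonneg)

text \<open>On a bounded domain \<open>\<bar>w\<bar> powr e\<close> is at most
  \<open>1 + \<bar>w\<bar> powr P\<close> for \<open>e \<le> P\<close>. The bounds involve the
  energy alone, so a norm bound suffices for compactness.\<close>

lemma X_L1:
  assumes w: "w \<in> X"
  shows "integrable lborel w"
    "(LINT x|lborel. \<bar>w x\<bar>) \<le> measure lborel \<Omega> + (energy p s w / \<sigma>) powr (P / p)"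
    "(LINT x|lborel. \<bar>w x\<bar> powr p) \<le> measure lborel \<Omega> + (energy p s w / \<sigma>) powr (P / p)"
proof -
  have [measurable]: "w \<in> borel_measurable borel" using w by (auto simp: X0_borel_def)
  have \<Omega>[measurable]: "\<Omega> \<in> sets borel" using opn by simp
  have fin: "emeasure lborel \<Omega> < \<infinity>" by (rule emeasure_bounded_finite[OF bdd])
  have le: "\<bar>w x\<bar> powr e \<le> indicator \<Omega> x + \<bar>w x\<bar> powr P" if "0 < e" "e \<le> P" for x e
  proof (cases "x \<in> \<Omega>")
    case True
    show ?thesis
    proof (cases "\<bar>w x\<bar> \<le> 1")
      case True
      then have "\<bar>w x\<bar> powr e \<le> 1" using that by (simp add: powr_le1)
      then show ?thesis using \<open>x \<in> \<Omega>\<close> by (simp add: add_increasing2)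
    next
      case False
      then have "\<bar>w x\<bar> powr e \<le> \<bar>w x\<bar> powr P" using that by (intro powr_mono) auto
      then show ?thesis by (simp add: add_increasing)
    qed
  qed (use X0_borel_zero[OF w] in simp)
  have i: "integrable lborel (\<lambda>x. indicator \<Omega> x + \<bar>w x\<bar> powr P)"
    using fin sobolev_int[OF w] by auto
  have I: "(LINT x|lborel. indicator \<Omega> x + \<bar>w x\<bar> powr P) \<le> measure lborel \<Omega> + (energy p s w / \<sigma>) powr (P / p)"
    using fin sobolev_int[OF w] sobolev_P[OF w] by simp
  have bounds: "1 \<le> P" "p \<le> P" using p1 pr rP by auto
  have le1: "\<bar>w x\<bar> \<le> indicator \<Omega> x + \<bar>w x\<bar> powr P" for x using le[of 1 x] bounds by simp
  show w1: "integrable lborel w"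
    by (rule Bochner_Integration.integrable_bound[OF i]) (use le1 in \<open>auto intro!: AE_I2 order_trans[OF _ abs_ge_self]\<close>)
  have "(LINT x|lborel. \<bar>w x\<bar>) \<le> (LINT x|lborel. indicator \<Omega> x + \<bar>w x\<bar> powr P)"
    using w1 i le1 by (intro integral_mono) auto
  then show "(LINT x|lborel. \<bar>w x\<bar>) \<le> measure lborel \<Omega> + (energy p s w / \<sigma>) powr (P / p)" using I by linarith
  have "(LINT x|lborel. \<bar>w x\<bar> powr p) \<le> (LINT x|lborel. indicator \<Omega> x + \<bar>w x\<bar> powr P)"
    using w i le[of p] bounds p1 by (intro integral_mono) (auto simp: X0_borel_def)
  then show "(LINT x|lborel. \<bar>w x\<bar> powr p) \<le> measure lborel \<Omega> + (energy p s w / \<sigma>) powr (P / p)" using I by linarith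
qed

lemma X_weighted_tendsto:
  assumes w: "\<And>n. w n \<in> X" and C: "\<And>n. energy p s (w n) \<le> C" and e: "0 < e" "e < P"
    and [measurable]: "g \<in> borel_measurable borel" and g: "integrable lborel (\<lambda>x. \<bar>g x\<bar> powr (P / (P - e)))"
    and [measurable]: "v \<in> borel_measurable borel" and lim: "AE x in lborel. (\<lambda>n. w n x) \<longlonglongrightarrow> v x"
  shows "(\<lambda>n. LINT x|lborel. g x * max (w n x) 0 powr e) \<longlonglongrightarrow> (LINT x|lborel. g x * max (v x) 0 powr e)"
proof (rule integral_mult_tendsto_of_bounded)
  have [measurable]: "w n \<in> borel_measurable borel" for n using w by (auto simp: X0_borel_def)
  show "P / e > 1" "P / (P - e) > 1" "1 / (P / e) + 1 / (P / (P - e)) = 1"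
    using e by (auto simp: field_simps)
  show "(\<lambda>x. max (w n x) 0 powr e) \<in> borel_measurable lborel" for n by measurable
  show "(\<lambda>x. max (v x) 0 powr e) \<in> borel_measurable lborel" by measurable
  have eq': "\<bar>max x 0 powr e\<bar> powr (P / e) = \<bar>max x 0\<bar> powr P" for x :: real using e by (simp add: powr_powr)
  have v: "(\<lambda>x. max (w n x) 0) \<in> X" "energy p s (\<lambda>x. max (w n x) 0) \<le> C" for n
    using X0_borel_pos_part[OF _ w, of n] p1 C[of n] by auto
  show "integrable lborel (\<lambda>x. \<bar>max (w n x) 0 powr e\<bar> powr (P / e))" for n
    unfolding eq' by (rule sobolev_int[OF v(1)])
  show "(LINT x|lborel. \<bar>max (w n x) 0 powr e\<bar> powr (P / e)) \<le> (C / \<sigma>) powr (P / p)" for n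
  proof -
    have "(LINT x|lborel. \<bar>max (w n x) 0 powr e\<bar> powr (P / e)) \<le> (energy p s (\<lambda>x. max (w n x) 0) / \<sigma>) powr (P / p)"
      unfolding eq' by (rule sobolev_P[OF v(1)])
    also have "\<dots> \<le> (C / \<sigma>) powr (P / p)"
      using v(2) \<sigma> p1 e by (intro powr_mono2 divide_right_mono) auto
    finally show ?thesis .
  qed
  show "AE x in lborel. (\<lambda>n. max (w n x) 0 powr e) \<longlonglongrightarrow> max (v x) 0 powr e"
    using lim
  proof eventually_elim
    case (elim x)
    show ?case
      using e by (intro tendsto_powr2[OF tendsto_max[OF elim tendsto_const] tendsto_const]) auto
  qed
qed (use g in auto)

text \<open>The limit \<open>N\<close> of the norms is kept apart from \<open>nrm v\<close>, since
  Fatou's lemma only gives \<open>nrm v \<le> N\<close>.\<close>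

lemma X_compact:
  assumes w: "\<And>n. w n \<in> X" and C: "\<And>n. nrm (w n) \<le> C"
  obtains \<tau> v N where "strict_mono (\<tau> :: nat \<Rightarrow> nat)" "v \<in> X" "\<And>x. v x \<ge> 0"
    "(\<lambda>n. nrm (w (\<tau> n))) \<longlonglongrightarrow> N" "nrm v \<le> N"
    "(\<lambda>n. A (w (\<tau> n))) \<longlonglongrightarrow> A v" "(\<lambda>n. B (w (\<tau> n))) \<longlonglongrightarrow> B v"
proof -
  have E: "energy p s (w n) \<le> C powr p" for n
    using C[of n] p1 powr_mono2[of p "nrm (w n)" C] nrm_nonneg by (simp add: nrm_powr)
  have C0: "C \<ge> 0" using C[of 0] nrm_nonneg[of "w 0"] by simp
  define K where "K = measure lborel \<Omega> + (C powr p / \<sigma>) powr (P / p)"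
  have K: "measure lborel \<Omega> + (energy p s (w n) / \<sigma>) powr (P / p) \<le> K" for n
    using E[of n] \<sigma> p1 pr rP by (auto simp: K_def intro!: powr_mono2 divide_right_mono)
  have L1: "(LINT x|lborel. \<bar>w n x\<bar>) \<le> K" for n using X_L1(2)[OF w] K by (rule order_trans)
  have Lp: "(LINT x|lborel. \<bar>w n x\<bar> powr p) \<le> K" for n using X_L1(3)[OF w] K by (rule order_trans)
  obtain \<sigma>1 u where s1: "strict_mono (\<sigma>1 :: nat \<Rightarrow> nat)" and u[measurable]: "u \<in> borel_measurable borel"
    and u0: "\<And>x. x \<notin> \<Omega> \<Longrightarrow> u x = 0" and lim: "AE x in lborel. (\<lambda>n. w (\<sigma>1 n) x) \<longlonglongrightarrow> u x"
    by (rule energy_compact[where u=w, OF p1 s(1) bdd X0_borel_zero[OF w] X_L1(1)[OF w] L1 X0_borel_energy[OF w] E];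
        (assumption | rule that; assumption))
  have "bounded (range (\<lambda>n. nrm (w (\<sigma>1 n))))"
    using C nrm_nonneg by (auto simp: bounded_iff intro!: exI[of _ C])
  then obtain N \<sigma>2 where s2: "strict_mono (\<sigma>2 :: nat \<Rightarrow> nat)" and N: "((\<lambda>n. nrm (w (\<sigma>1 n))) \<circ> \<sigma>2) \<longlonglongrightarrow> N"
    using bounded_imp_convergent_subsequence by blast
  define \<tau> where "\<tau> = \<sigma>1 \<circ> \<sigma>2"
  have \<tau>: "strict_mono \<tau>" unfolding \<tau>_def by (rule strict_mono_o[OF s1 s2])
  have N: "(\<lambda>n. nrm (w (\<tau> n))) \<longlonglongrightarrow> N" using N by (simp add: \<tau>_def o_def)
  have N0: "N \<ge> 0" using N by (rule LIMSEQ_le_const) (auto simp: nrm_nonneg)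
  have lim: "AE x in lborel. (\<lambda>n. w (\<tau> n) x) \<longlonglongrightarrow> u x"
    using lim by eventually_elim (use LIMSEQ_subseq_LIMSEQ[OF _ s2] in \<open>auto simp: \<tau>_def o_def\<close>)
  have [measurable]: "w n \<in> borel_measurable borel" for n using w by (auto simp: X0_borel_def)
  have Elim: "(\<lambda>n. energy p s (w (\<tau> n))) \<longlonglongrightarrow> N powr p"
    using tendsto_powr2[OF N tendsto_const[of p]] p1 nrm_nonneg by (simp add: nrm_powr)
  have "integrable lborel (\<lambda>x. \<bar>u x\<bar> powr p)"
  proof (rule Fatou_integral_bounded(1))
    show "AE x in lborel. (\<lambda>n. \<bar>w (\<tau> n) x\<bar> powr p) \<longlonglongrightarrow> \<bar>u x\<bar> powr p"
      using lim
    proof eventually_elim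
      case (elim x)
      show ?case using p1 by (intro tendsto_powr2[OF tendsto_rabs[OF elim] tendsto_const]) auto
    qed
    show "(LINT x|lborel. \<bar>w (\<tau> n) x\<bar> powr p) \<le> K" for n by (rule Lp)
  qed (use w in \<open>auto simp: X0_borel_def\<close>)
  moreover
  have limg: "AE z in gagliardo p s. (\<lambda>n. \<bar>w (\<tau> n) (fst z) - w (\<tau> n) (snd z)\<bar> powr p) \<longlonglongrightarrow> \<bar>u (fst z) - u (snd z)\<bar> powr p"
  proof (rule AE_gagliardoI)
    show "AE z in lborel. (\<lambda>n. \<bar>w (\<tau> n) (fst z) - w (\<tau> n) (snd z)\<bar> powr p) \<longlonglongrightarrow> \<bar>u (fst z) - u (snd z)\<bar> powr p"
      using AE_lborel_prod_fst[OF lim] AE_lborel_prod_snd[OF lim]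
    proof eventually_elim
      case (elim z)
      show ?case using p1 by (intro tendsto_powr2[OF tendsto_rabs[OF tendsto_diff[OF elim]] tendsto_const]) auto
    qed
  qed
  have F: "integrable (gagliardo p s) (\<lambda>z. \<bar>u (fst z) - u (snd z)\<bar> powr p)" "energy p s u \<le> N powr p"
    using Fatou_integral_le[OF _ _ X0_borel_energy[OF w] _ limg Elim[unfolded energy_def]] by (auto simp: energy_def)
  ultimately have uX: "u \<in> X" using u0 by (simp add: X0_borel_def)
  \<comment> \<open>\<open>A\<close> and \<open>B\<close> see only positive parts and truncation
    does not increase the energy, so the limit may be taken nonnegative.\<close>
  define v where "v x = max (u x) 0" for x
  have v: "v \<in> X" "energy p s v \<le> energy p s u"
    using X0_borel_pos_part[OF _ uX] p1 by (auto simp: v_def[abs_def])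
  have "nrm v \<le> (N powr p) powr (1 / p)"
    unfolding nrm_def using v(2) F(2) p1 by (intro powr_mono2) auto
  then have "nrm v \<le> N" using p1 N0 by (simp add: powr_powr)
  moreover have "A u = A v" "B u = B v" by (auto simp: A_def B_def v_def)
  moreover have "(\<lambda>n. A (w (\<tau> n))) \<longlonglongrightarrow> A u"
    unfolding A_def by (rule X_weighted_tendsto[OF w E e_bounds(1,2) a_meas a_int u lim])
  moreover have "(\<lambda>n. B (w (\<tau> n))) \<longlonglongrightarrow> B u"
    unfolding B_def by (rule X_weighted_tendsto[OF w E e_bounds(3,4) b_meas b_int u lim])
  ultimately show ?thesis using that[OF \<tau> v(1) _ N] by (simp add: v_def)
qed

end

section \<open>Derivatives of the functional\<close>

text \<open>At the origin the difference quotient is at most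
  \<open>\<bar>h\<bar> powr (p - 1)\<close>, which tends to zero; the formula also gives zero there,
  for \<open>p < 2\<close> too, because of the factor \<open>x\<close>.\<close>

lemma abs_powr_has_derivative:
  fixes x p :: real
  assumes p: "p > 1"
  shows "((\<lambda>x. \<bar>x\<bar> powr p) has_real_derivative p * \<bar>x\<bar> powr (p - 2) * x) (at x)"
proof -
  consider "x > 0" | "x < 0" | "x = 0" by linarith
  then show ?thesis
  proof cases
    case 1
    have "((\<lambda>x. x powr p) has_real_derivative p * x powr (p - 1)) (at x)"
      using 1 by (auto intro!: derivative_eq_intros)
    moreover have "x powr (p - 1) = x powr (p - 2) * x"
      using 1 powr_mult_base[of x "p - 2"] by (simp add: mult.commute)
    ultimately have "((\<lambda>x. x powr p) has_real_derivative p * \<bar>x\<bar> powr (p - 2) * x) (at x)"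
      using 1 by (simp add: mult.assoc)
    then show ?thesis
      by (rule has_field_derivative_transform_within_open[OF _ open_greaterThan[of 0]]) (use 1 in auto)
  next
    case 2
    have "((\<lambda>x. (- x) powr p) has_real_derivative - (p * (- x) powr (p - 1))) (at x)"
      using 2 by (auto intro!: derivative_eq_intros)
    moreover have "(- x) powr (p - 1) = - ((- x) powr (p - 2) * x)"
      using 2 powr_mult_base[of "- x" "p - 2"] by (simp add: mult.commute)
    ultimately have "((\<lambda>x. (- x) powr p) has_real_derivative p * \<bar>x\<bar> powr (p - 2) * x) (at x)"
      using 2 by (simp add: mult.assoc)
    then show ?thesis
      by (rule has_field_derivative_transform_within_open[OF _ open_lessThan[of 0]]) (use 2 in auto)
  next
    case 3
    have "((\<lambda>h. \<bar>h\<bar> powr (p - 1)) \<longlongrightarrow> 0 powr (p - 1)) (at (0::real))"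
      using p by (intro tendsto_powr2) (auto intro!: tendsto_eq_intros)
    then have lim: "((\<lambda>h. \<bar>h\<bar> powr (p - 1)) \<longlongrightarrow> 0) (at (0::real))" using p by simp
    have "((\<lambda>h. \<bar>h\<bar> powr p / h) \<longlongrightarrow> 0) (at 0)"
    proof (rule Lim_null_comparison[OF _ lim])
      show "\<forall>\<^sub>F h in at (0::real). norm (\<bar>h\<bar> powr p / h) \<le> \<bar>h\<bar> powr (p - 1)"
        by (auto simp: eventually_at_filter powr_diff)
    qed
    then show ?thesis using 3 p by (simp add: DERIV_def)
  qed
qed

lemma pos_part_powr_has_derivative:
  fixes x e :: real
  assumes e: "e > 1"
  shows "((\<lambda>x. max x 0 powr e) has_real_derivative e * max x 0 powr (e - 1)) (at x)"
proof -
  consider "x > 0" | "x < 0" | "x = 0" by linarith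
  then show ?thesis
  proof cases
    case 1
    have "((\<lambda>x. x powr e) has_real_derivative e * x powr (e - 1)) (at x)"
      using 1 by (auto intro!: derivative_eq_intros)
    then have "((\<lambda>x. x powr e) has_real_derivative e * max x 0 powr (e - 1)) (at x)"
      using 1 by (simp add: max_def)
    then show ?thesis
      by (rule has_field_derivative_transform_within_open[OF _ open_greaterThan[of 0]]) (use 1 in \<open>auto simp: max_def\<close>)
  next
    case 2
    then have "((\<lambda>x. 0) has_real_derivative e * max x 0 powr (e - 1)) (at x)"
      by (simp add: max_def)
    then show ?thesis
      by (rule has_field_derivative_transform_within_open[OF _ open_lessThan[of 0]]) (use 2 in \<open>auto simp: max_def\<close>)
  next
    case 3
    have "((\<lambda>h. \<bar>h\<bar> powr (e - 1)) \<longlongrightarrow> 0 powr (e - 1)) (at (0::real))"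
      using e by (intro tendsto_powr2) (auto intro!: tendsto_eq_intros)
    then have lim: "((\<lambda>h. \<bar>h\<bar> powr (e - 1)) \<longlongrightarrow> 0) (at (0::real))" using e by simp
    have "((\<lambda>h. max h 0 powr e / h) \<longlongrightarrow> 0) (at 0)"
    proof (rule Lim_null_comparison[OF _ lim])
      have "norm (max h 0 powr e / h) \<le> \<bar>h\<bar> powr (e - 1)" if "h \<noteq> 0" for h
      proof (cases "h > 0")
        case True
        then show ?thesis by (simp add: powr_diff)
      next
        case False
        then show ?thesis by (simp add: max_absorb2)
      qed
      then show "\<forall>\<^sub>F h in at (0::real). norm (max h 0 powr e / h) \<le> \<bar>h\<bar> powr (e - 1)"
        by (simp add: eventually_at_filter)
    qed
    then show ?thesis using 3 e by (simp add: DERIV_def)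
  qed
qed

section \<open>Estimates for the singular power, and test functions\<close>

text \<open>The tangent of a concave function lies above it, here in the form of Young's inequality
  for \<open>x powr (1 - q) * u powr q\<close>. The case \<open>x = 0\<close> is included; it is the
  one that yields positivity of minimisers.\<close>

lemma concave_powr_tangent:
  fixes x u q :: real
  assumes q: "0 < q" "q < 1" and x: "0 \<le> x" "0 < u"
  shows "x powr (1 - q) \<le> u powr (1 - q) - (1 - q) * u powr (- q) * (u - x)"
proof -
  have "x powr (1 - q) * u powr q \<le> (1 - q) * x + q * u"
    using Youngs_inequality_0[of "1 - q" q x u] q x by (cases "x = 0") auto
  then have "x powr (1 - q) * u powr q * u powr (- q) \<le> ((1 - q) * x + q * u) * u powr (- q)"
    by (intro mult_right_mono) auto
  also have "x powr (1 - q) * u powr q * u powr (- q) = x powr (1 - q)"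
    using x by (simp add: mult.assoc flip: powr_add)
  also have "u powr (1 - q) = u * u powr (- q)" using powr_mult_base[of u "- q"] x by simp
  then have "((1 - q) * x + q * u) * u powr (- q) = u powr (1 - q) - (1 - q) * u powr (- q) * (u - x)"
    by (simp add: algebra_simps)
  finally show ?thesis .
qed

text \<open>A two-sided bound valid down to and beyond zero, which makes
  \<open>x powr (- q) * \<bar>d\<bar>\<close> a dominating function. Upwards it is concavity;
  downwards it is \<open>y * x powr (- q) \<le> y powr (1 - q)\<close> for
  \<open>y \<le> x\<close>.\<close>

lemma pos_part_powr_diff_le:
  fixes x d q :: real
  assumes q: "0 < q" "q < 1" and x: "0 < x"
  shows "\<bar>max (x + d) 0 powr (1 - q) - x powr (1 - q)\<bar> \<le> x powr (- q) * \<bar>d\<bar>"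
proof (cases "d \<ge> 0")
  case True
  have "(x + d) powr (1 - q) \<le> x powr (1 - q) - (1 - q) * x powr (- q) * (x - (x + d))"
    using True x by (intro concave_powr_tangent q) auto
  then have "(x + d) powr (1 - q) - x powr (1 - q) \<le> (1 - q) * (x powr (- q) * d)" by (simp add: algebra_simps)
  also have "\<dots> \<le> 1 * (x powr (- q) * d)" using q True by (intro mult_right_mono) auto
  finally have "(x + d) powr (1 - q) - x powr (1 - q) \<le> x powr (- q) * d" by simp
  moreover have "x powr (1 - q) \<le> (x + d) powr (1 - q)" using True x q by (intro powr_mono2) auto
  ultimately show ?thesis using True x by (simp add: max_def)
next
  case False
  define y where "y = max (x + d) 0"
  have y: "0 \<le> y" "y \<le> x" "x - y \<le> \<bar>d\<bar>" using False x by (auto simp: y_def)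
  have xx: "x powr (1 - q) = x powr (- q) * x" using powr_mult_base[of x "- q"] x by (simp add: mult.commute)
  have "y * x powr (- q) \<le> y powr (1 - q)"
  proof (cases "y = 0")
    case False
    then have "y * x powr (- q) \<le> y * y powr (- q)" using y q by (intro mult_left_mono powr_mono2') auto
    also have "\<dots> = y powr (1 - q)" using powr_mult_base[of y "- q"] y by simp
    finally show ?thesis .
  qed simp
  then have "x powr (1 - q) - y powr (1 - q) \<le> x powr (- q) * (x - y)" unfolding xx by (simp add: algebra_simps)
  also have "\<dots> \<le> x powr (- q) * \<bar>d\<bar>" using y by (intro mult_left_mono) auto
  finally have "x powr (1 - q) - y powr (1 - q) \<le> x powr (- q) * \<bar>d\<bar>" .
  moreover have "y powr (1 - q) \<le> x powr (1 - q)" using y q by (intro powr_mono2) auto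
  ultimately show ?thesis unfolding y_def[symmetric] by simp
qed

text \<open>The distance to the complement, cut off at one, is Lipschitz and positive exactly on the
  open set.\<close>

lemma exists_positive_X0_borel:
  fixes \<Omega> :: "(real^'n) set"
  assumes ps: "p > 0" "0 < s" "s < 1" and bdd: "bounded \<Omega>" and opn: "open \<Omega>"
  obtains \<phi> where "\<phi> \<in> X0_borel p s \<Omega>" "\<And>x. x \<in> \<Omega> \<Longrightarrow> \<phi> x > 0" "\<And>x. \<phi> x \<ge> 0"
proof -
  have "- \<Omega> \<noteq> {}" using bdd not_bounded_UNIV by (metis Compl_eq_Diff_UNIV Diff_eq_empty_iff subset_UNIV top.extremum_uniqueI)
  moreover have "closed (- \<Omega>)" by (rule closed_Compl[OF opn])
  ultimately have pos: "infdist x (- \<Omega>) > 0" if "x \<in> \<Omega>" for x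
    using in_closed_iff_infdist_zero[of "- \<Omega>" x] that infdist_nonneg[of x "- \<Omega>"] by auto
  show ?thesis
  proof (rule that[of "\<lambda>x. min 1 (infdist x (- \<Omega>))"])
    show "(\<lambda>x. min 1 (infdist x (- \<Omega>))) \<in> X0_borel p s \<Omega>"
    proof (rule X0_borel_Lipschitz[where L=1 and m=1])
      fix x y :: "real^'n"
      show "\<bar>min 1 (infdist x (- \<Omega>)) - min 1 (infdist y (- \<Omega>))\<bar> \<le> 1 * norm (x - y)"
        using infdist_triangle_abs[of x "- \<Omega>" y] by (auto simp: dist_norm)
      show "\<bar>min 1 (infdist x (- \<Omega>))\<bar> \<le> 1" using infdist_nonneg[of x "- \<Omega>"] by auto
    qed (use ps bdd in auto)
  qed (use pos infdist_nonneg in auto)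
qed

context singular_problem
begin

lemma \<Omega>_borel[measurable]: "\<Omega> \<in> sets borel" using opn by simp

lemma X_meas: "w \<in> X \<Longrightarrow> w \<in> borel_measurable borel"
  by (simp add: X0_borel_def)

lemma X_perturb: "w \<in> X \<Longrightarrow> v \<in> X \<Longrightarrow> (\<lambda>x. w x + t * v x) \<in> X"
  using X0_borel_add[of p w s \<Omega> "\<lambda>x. t * v x"] X0_borel_scale(1)[of v p s \<Omega> t] p1 by auto

lemma exists_positive:
  obtains \<phi> where "\<phi> \<in> X" "\<And>x. x \<in> \<Omega> \<Longrightarrow> \<phi> x > 0" "\<And>x. \<phi> x \<ge> 0"
  by (rule exists_positive_X0_borel[OF _ s bdd opn]) (use p1 that in auto)

text \<open>Lipschitz cut-offs shrinking to a compact subset \<open>K\<close> of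
  \<open>{x. b x > 0}\<close> of positive measure make \<open>B\<close> converge to the integral of
  \<open>b\<close> over \<open>K\<close>. Without such a function the outer part of the Nehari set
  could be empty.\<close>

lemma exists_B_positive:
  obtains \<phi> where "\<phi> \<in> X" "B \<phi> > 0"
proof -
  define S where "S = {x. b x > 0}"
  have [measurable]: "S \<in> sets borel" unfolding S_def by measurable
  have S\<Omega>: "S \<subseteq> \<Omega>" using b_zero by (force simp: S_def)
  have bS: "bounded S" using bdd S\<Omega> by (rule bounded_subset)
  have "emeasure lborel S \<noteq> 0"
  proof
    assume "emeasure lborel S = 0"
    then have "S \<in> null_sets lborel" by (auto simp: null_sets_def)
    then have "AE x in lborel. b x \<le> 0" by (rule AE_I') (auto simp: S_def)
    then show False using b_pos by blast
  qed
  then have mS: "measure lborel S > 0"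
    using emeasure_bounded_finite[OF bS] by (simp add: measure_def enn2real_positive_iff zero_less_iff_neq_zero)
  \<comment> \<open>The part of \<open>S\<close> left out has measure below that of
    \<open>S\<close>, so \<open>K\<close> cannot be a null set.\<close>
  obtain K where K': "closed K" "K \<subseteq> S" "S - K \<in> lmeasurable" "emeasure lebesgue (S - K) < ennreal (measure lborel S)"
    using sets_lebesgue_inner_closed[OF _ mS, of S] by auto
  have K: "compact K" "K \<subseteq> S"
    using K' bS bounded_subset compact_eq_bounded_closed by auto
  have [measurable]: "K \<in> sets borel" using K(1) by (simp add: compact_imp_closed)
  have Knull: "emeasure lborel K \<noteq> 0"
  proof
    assume "emeasure lborel K = 0"
    then have "K \<in> null_sets lborel" by (auto simp: null_sets_def)
    then have "emeasure lborel (S - K) = emeasure lborel S"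
      by (intro emeasure_Diff_null_set) auto
    also have "\<dots> = ennreal (measure lborel S)"
      using emeasure_bounded_finite[OF bS] by (intro emeasure_eq_ennreal_measure) auto
    finally show False using K'(4) by simp
  qed
  then have Kne: "K \<noteq> {}" by auto
  obtain d where d: "d > 0" "(\<Union>x\<in>K. ball x d) \<subseteq> \<Omega>"
    using compact_subset_open_imp_ball_epsilon_subset[OF K(1) opn] K(2) S\<Omega> by blast
  \<comment> \<open>The slope is at least \<open>1 / d\<close>, so each cut-off vanishes at distance
    \<open>d\<close> from \<open>K\<close> and hence outside the domain.\<close>
  define m where "m j = 1 / d + real j" for j :: nat
  have m: "m j > 0" for j using d by (simp add: m_def add_pos_nonneg)
  define f where "f j x = max 0 (1 - m j * infdist x K)" for j x
  have f1: "0 \<le> f j x" "f j x \<le> 1" for j x using m[of j] by (auto simp: f_def infdist_nonneg)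
  have fX: "f j \<in> X" for j
  proof (rule X0_borel_Lipschitz[where L="m j" and m=1])
    fix x y :: "real^'n"
    have "\<bar>f j x - f j y\<bar> \<le> \<bar>m j * infdist x K - m j * infdist y K\<bar>" by (auto simp: f_def)
    also have "\<dots> = m j * \<bar>infdist x K - infdist y K\<bar>" using m[of j] by (simp add: abs_mult flip: right_diff_distrib)
    also have "\<dots> \<le> m j * norm (x - y)"
      using m[of j] infdist_triangle_abs[of x K y] by (intro mult_left_mono) (auto simp: dist_norm)
    finally show "\<bar>f j x - f j y\<bar> \<le> m j * norm (x - y)" .
    show "\<bar>f j x\<bar> \<le> 1" using f1 by simp
    assume x: "x \<notin> \<Omega>"
    have "infdist x K \<ge> d"
    proof (rule ccontr)
      assume less: "\<not> ?thesis"
      obtain y where y: "y \<in> K" "infdist x K = dist x y"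
        using infdist_attains_inf[of K x] K(1) Kne compact_imp_closed by blast
      then have "x \<in> ball y d" using less by (simp add: dist_commute)
      then have "x \<in> (\<Union>y\<in>K. ball y d)" using y(1) by blast
      then show False using d x by blast
    qed
    then have "1 / d * d \<le> m j * infdist x K" using d by (intro mult_mono) (auto simp: m_def)
    then show "f j x = 0" using d by (simp add: f_def)
  qed (use p1 s bdd in auto)
  have flim: "(\<lambda>j. f j x) \<longlonglongrightarrow> indicator K x" for x
  proof (cases "x \<in> K")
    case True
    then show ?thesis by (simp add: f_def)
  next
    case False
    then have pos: "infdist x K > 0"
      using in_closed_iff_infdist_zero[of K x] K(1) Kne infdist_nonneg[of x K] compact_imp_closed
      by (metis less_eq_real_def)
    obtain j0 :: nat where j0: "1 / infdist x K < real j0" using reals_Archimedean2 by blast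
    have "f j x = 0" if "j \<ge> j0" for j
    proof -
      have "1 / infdist x K \<le> m j" using j0 that d by (simp add: m_def add_increasing)
      then show ?thesis using pos by (simp add: f_def divide_le_eq)
    qed
    then have "\<forall>\<^sub>F j in sequentially. f j x = indicator K x"
      using False by (auto simp: eventually_sequentially)
    then show ?thesis by (rule tendsto_eventually)
  qed
  have [measurable]: "f j \<in> borel_measurable borel" for j using X_meas[OF fX] .
  have mono: "f j x \<le> f 0 x" for j x
  proof -
    have "m 0 * infdist x K \<le> m j * infdist x K"
      by (intro mult_right_mono infdist_nonneg) (simp add: m_def)
    then show ?thesis by (auto simp: f_def)
  qed
  have lim: "(\<lambda>j. B (f j)) \<longlonglongrightarrow> (LINT x|lborel. b x * indicator K x)"
    unfolding B_def
  proof (rule integral_dominated_convergence)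
    show "integrable lborel (\<lambda>x. \<bar>b x * \<bar>f 0 x\<bar> powr (r + 1)\<bar>)"
      using B_int(2)[OF fX e_bounds(3,4)] by (rule integrable_abs)
    show "AE x in lborel. norm (b x * max (f j x) 0 powr (r + 1)) \<le> \<bar>b x * \<bar>f 0 x\<bar> powr (r + 1)\<bar>" for j
      using f1 mono e_bounds by (auto simp: abs_mult intro!: mult_left_mono powr_mono2)
    show "AE x in lborel. (\<lambda>j. b x * max (f j x) 0 powr (r + 1)) \<longlonglongrightarrow> b x * indicator K x"
    proof (intro AE_I2)
      fix x
      have "(\<lambda>j. b x * max (f j x) 0 powr (r + 1)) \<longlonglongrightarrow> b x * max (indicator K x) 0 powr (r + 1)"
        using e_bounds by (intro tendsto_mult tendsto_const tendsto_powr2[OF tendsto_max[OF flim tendsto_const] tendsto_const]) auto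
      then show "(\<lambda>j. b x * max (f j x) 0 powr (r + 1)) \<longlonglongrightarrow> b x * indicator K x"
        by (cases "x \<in> K") auto
    qed
  qed measurable
  have int: "integrable lborel (\<lambda>x. b x * indicator K x)"
  proof (rule Bochner_Integration.integrable_bound)
    show "integrable lborel (\<lambda>x. b x * \<bar>f 0 x\<bar> powr (r + 1))" by (rule B_int(2)[OF fX e_bounds(3,4)])
    show "AE x in lborel. norm (b x * indicator K x) \<le> norm (b x * \<bar>f 0 x\<bar> powr (r + 1))"
      by (auto simp: indicator_def f_def)
  qed measurable
  have nn: "AE x in lborel. b x * indicator K x \<ge> 0"
    using K(2) by (auto simp: indicator_def S_def less_imp_le subset_iff)
  have "(LINT x|lborel. b x * indicator K x) \<noteq> 0"
  proof
    assume "(LINT x|lborel. b x * indicator K x) = 0"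
    then have "AE x in lborel. b x * indicator K x = 0"
      using integral_nonneg_eq_0_iff_AE[OF int nn] by simp
    then have "AE x in lborel. x \<notin> K"
      by eventually_elim (use K(2) in \<open>auto simp: S_def indicator_def split: if_splits\<close>)
    then have "K \<in> null_sets lborel" by (subst (asm) AE_iff_null_sets[symmetric]) auto
    then show False using Knull by auto
  qed
  moreover have "(LINT x|lborel. b x * indicator K x) \<ge> 0" using nn by (rule integral_nonneg_AE)
  ultimately have "\<forall>\<^sub>F j in sequentially. B (f j) > 0"
    using order_tendstoD(1)[OF lim, of 0] by simp
  then obtain j where "B (f j) > 0" by (auto simp: eventually_sequentially)
  then show ?thesis using fX that by blast
qed

section \<open>Directional derivatives of the energy and of the superlinear term\<close>

definition weak_form :: "(real^'n \<Rightarrow> real) \<Rightarrow> (real^'n \<Rightarrow> real) \<Rightarrow> real" where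
  "weak_form w v = (LINT z|gagliardo p s. \<bar>w (fst z) - w (snd z)\<bar> powr (p - 2) * (w (fst z) - w (snd z)) * (v (fst z) - v (snd z)))"

lemma energy_Gateaux:
  assumes w: "w \<in> X" and v: "v \<in> X" and \<epsilon>: "\<epsilon> \<longlonglongrightarrow> 0" "\<And>j. 0 < \<epsilon> j" "\<And>j. \<epsilon> j \<le> 1"
  shows "integrable (gagliardo p s) (\<lambda>z. \<bar>w (fst z) - w (snd z)\<bar> powr (p - 2) * (w (fst z) - w (snd z)) * (v (fst z) - v (snd z)))"
    and "(\<lambda>j. (energy p s (\<lambda>x. w x + \<epsilon> j * v x) - energy p s w) / \<epsilon> j) \<longlonglongrightarrow> p * weak_form w v"
proof -
  have [measurable]: "w \<in> borel_measurable borel" "v \<in> borel_measurable borel" using X_meas w v by auto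
  let ?F = "\<lambda>z. w (fst z) - w (snd z)" and ?G = "\<lambda>z. v (fst z) - v (snd z)"
  have eq: "w x + t * v x - (w y + t * v y) = w x - w y + t * (v x - v y)" for t x y
    by (simp add: algebra_simps)
  have int: "integrable (gagliardo p s) (\<lambda>z. 1 * \<bar>?F z + t * ?G z\<bar> powr p)" for t
    using X0_borel_energy[OF X_perturb[OF w v, of t]] by (simp add: eq)
  have d: "\<bar>p * \<bar>x\<bar> powr (p - 2) * x\<bar> \<le> p * \<bar>x\<bar> powr (p - 1)" for x :: real
    using p1 powr_mult_base[of "\<bar>x\<bar>" "p - 2"] by (simp add: abs_mult mult.commute mult.left_commute)
  note G = integral_Gateaux_derivative[OF p1 abs_powr_has_derivative[OF p1] d _ _ _ _ _ _ int \<epsilon>]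
  have i: "integrable (gagliardo p s) (\<lambda>z. 1 * (p * \<bar>?F z\<bar> powr (p - 2) * ?F z) * ?G z)"
    by (rule G) (use X0_borel_energy[OF w] X0_borel_energy[OF v] in auto)
  have "integrable (gagliardo p s) (\<lambda>z. (1 / p) * (1 * (p * \<bar>?F z\<bar> powr (p - 2) * ?F z) * ?G z))"
    using i by (rule integrable_mult_right)
  then show "integrable (gagliardo p s) (\<lambda>z. \<bar>?F z\<bar> powr (p - 2) * ?F z * ?G z)" using p1 by (simp add: mult.assoc)
  have "(\<lambda>j. ((LINT z|gagliardo p s. 1 * \<bar>?F z + \<epsilon> j * ?G z\<bar> powr p) - (LINT z|gagliardo p s. 1 * \<bar>?F z\<bar> powr p)) / \<epsilon> j)
      \<longlonglongrightarrow> (LINT z|gagliardo p s. 1 * (p * \<bar>?F z\<bar> powr (p - 2) * ?F z) * ?G z)"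
    by (rule G) (use X0_borel_energy[OF w] X0_borel_energy[OF v] in auto)
  moreover have "(LINT z|gagliardo p s. 1 * (p * \<bar>?F z\<bar> powr (p - 2) * ?F z) * ?G z) = p * weak_form w v"
    unfolding weak_form_def by (simp add: mult.assoc)
  ultimately show "(\<lambda>j. (energy p s (\<lambda>x. w x + \<epsilon> j * v x) - energy p s w) / \<epsilon> j) \<longlonglongrightarrow> p * weak_form w v"
    by (simp add: energy_def eq)
qed

lemma B_Gateaux:
  assumes w: "w \<in> X" and v: "v \<in> X" and \<epsilon>: "\<epsilon> \<longlonglongrightarrow> 0" "\<And>j. 0 < \<epsilon> j" "\<And>j. \<epsilon> j \<le> 1"
  shows "integrable lborel (\<lambda>x. b x * max (w x) 0 powr r * v x)"
    and "(\<lambda>j. (B (\<lambda>x. w x + \<epsilon> j * v x) - B w) / \<epsilon> j) \<longlonglongrightarrow> (r + 1) * (LINT x|lborel. b x * max (w x) 0 powr r * v x)"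
proof -
  have [measurable]: "w \<in> borel_measurable borel" "v \<in> borel_measurable borel" using X_meas w v by auto
  have r1: "r + 1 > 1" using q qp pr by simp
  have d: "\<bar>(r + 1) * max x 0 powr (r + 1 - 1)\<bar> \<le> (r + 1) * \<bar>x\<bar> powr (r + 1 - 1)" for x :: real
    using r1 by (auto simp: abs_mult max_def)
  have int: "integrable lborel (\<lambda>x. b x * max (w x + t * v x) 0 powr (r + 1))" for t
    by (rule B_int(1)[OF X_perturb[OF w v] e_bounds(3,4)])
  note G = integral_Gateaux_derivative[OF r1 pos_part_powr_has_derivative[OF r1] d _ _ _ _
      B_int(2)[OF w e_bounds(3,4)] B_int(2)[OF v e_bounds(3,4)] int \<epsilon>]
  have i: "integrable lborel (\<lambda>x. b x * ((r + 1) * max (w x) 0 powr (r + 1 - 1)) * v x)"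
    by (rule G) auto
  have "integrable lborel (\<lambda>x. (1 / (r + 1)) * (b x * ((r + 1) * max (w x) 0 powr (r + 1 - 1)) * v x))"
    using i by (rule integrable_mult_right)
  moreover have "(1 / (r + 1)) * (b x * ((r + 1) * max (w x) 0 powr (r + 1 - 1)) * v x) = b x * max (w x) 0 powr r * v x" for x
    using r1 by simp
  ultimately show "integrable lborel (\<lambda>x. b x * max (w x) 0 powr r * v x)" by simp
  have "(\<lambda>j. (B (\<lambda>x. w x + \<epsilon> j * v x) - B w) / \<epsilon> j)
      \<longlonglongrightarrow> (LINT x|lborel. b x * ((r + 1) * max (w x) 0 powr (r + 1 - 1)) * v x)"
    unfolding B_def by (rule G) auto
  moreover have "(\<lambda>x. b x * ((r + 1) * max (w x) 0 powr (r + 1 - 1)) * v x)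
      = (\<lambda>x. (r + 1) * (b x * max (w x) 0 powr r * v x))"
    by (simp add: fun_eq_iff)
  ultimately show "(\<lambda>j. (B (\<lambda>x. w x + \<epsilon> j * v x) - B w) / \<epsilon> j) \<longlonglongrightarrow> (r + 1) * (LINT x|lborel. b x * max (w x) 0 powr r * v x)"
    by (simp only: integral_mult_right_zero)
qed

text \<open>The energy converges because its difference quotients do. The resulting bound on the
  energies lets the weighted convergence lemma treat \<open>A\<close> and \<open>B\<close>, without
  differentiability of \<open>A\<close>.\<close>

lemma X_perturb_tendsto:
  assumes w: "w \<in> X" and v: "v \<in> X" and \<epsilon>: "\<epsilon> \<longlonglongrightarrow> 0" "\<And>j. 0 < \<epsilon> j" "\<And>j. \<epsilon> j \<le> 1"
  shows "(\<lambda>j. nrm (\<lambda>x. w x + \<epsilon> j * v x)) \<longlonglongrightarrow> nrm w"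
    "(\<lambda>j. A (\<lambda>x. w x + \<epsilon> j * v x)) \<longlonglongrightarrow> A w" "(\<lambda>j. B (\<lambda>x. w x + \<epsilon> j * v x)) \<longlonglongrightarrow> B w"
proof -
  have "(\<lambda>j. (energy p s (\<lambda>x. w x + \<epsilon> j * v x) - energy p s w) / \<epsilon> j * \<epsilon> j) \<longlonglongrightarrow> p * weak_form w v * 0"
    by (intro tendsto_mult energy_Gateaux(2)[OF w v \<epsilon>] \<epsilon>)
  moreover have "(energy p s (\<lambda>x. w x + \<epsilon> j * v x) - energy p s w) / \<epsilon> j * \<epsilon> j = energy p s (\<lambda>x. w x + \<epsilon> j * v x) - energy p s w" for j
    using \<epsilon>(2)[of j] by simp
  ultimately have E: "(\<lambda>j. energy p s (\<lambda>x. w x + \<epsilon> j * v x)) \<longlonglongrightarrow> energy p s w"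
    by (simp add: LIM_zero_iff)
  show "(\<lambda>j. nrm (\<lambda>x. w x + \<epsilon> j * v x)) \<longlonglongrightarrow> nrm w"
    unfolding nrm_def using p1 by (intro tendsto_powr2[OF E tendsto_const]) auto
  have "Bseq (\<lambda>j. energy p s (\<lambda>x. w x + \<epsilon> j * v x))" using E by (rule convergentI[THEN convergent_imp_Bseq])
  then obtain C where C: "\<And>j. energy p s (\<lambda>x. w x + \<epsilon> j * v x) \<le> C"
    unfolding Bseq_def by (auto simp: abs_le_iff)
  have lim: "AE x in lborel. (\<lambda>j. w x + \<epsilon> j * v x) \<longlonglongrightarrow> w x"
  proof (intro AE_I2)
    fix x
    have "(\<lambda>j. w x + \<epsilon> j * v x) \<longlonglongrightarrow> w x + 0 * v x" by (intro tendsto_intros \<epsilon>)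
    then show "(\<lambda>j. w x + \<epsilon> j * v x) \<longlonglongrightarrow> w x" by simp
  qed
  show "(\<lambda>j. A (\<lambda>x. w x + \<epsilon> j * v x)) \<longlonglongrightarrow> A w"
    unfolding A_def by (rule X_weighted_tendsto[OF X_perturb[OF w v] C e_bounds(1,2) a_meas a_int X_meas[OF w] lim])
  show "(\<lambda>j. B (\<lambda>x. w x + \<epsilon> j * v x)) \<longlonglongrightarrow> B w"
    unfolding B_def by (rule X_weighted_tendsto[OF X_perturb[OF w v] C e_bounds(3,4) b_meas b_int X_meas[OF w] lim])
qed

definition Jf :: "(real^'n \<Rightarrow> real) \<Rightarrow> real" where "Jf w = J (nrm w) (A w) (B w)"

lemma Jf_scale:
  "w \<in> X \<Longrightarrow> t > 0 \<Longrightarrow> Jf (\<lambda>x. t * w x) = J (t * nrm w) (t powr (1 - q) * A w) (t powr (r + 1) * B w)"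
  by (simp add: Jf_def nrm_scale A_scale B_scale)

end

section \<open>Stationary points are weak solutions\<close>

context singular_problem
begin

definition reaction where "reaction w v = (LINT x|lborel. b x * max (w x) 0 powr r * v x)"

text \<open>Energy and \<open>B\<close> are differentiable and go to one side, so minimality becomes
  an upper bound on the difference quotient of \<open>A\<close>, the only term whose derivative may
  be infinite. The scaling factors leave no trace in the limit.\<close>

lemma direction_limit:
  assumes W: "W \<in> X" and \<phi>: "\<phi> \<in> X"
    and \<epsilon>: "\<epsilon> \<longlonglongrightarrow> 0" "\<And>j. 0 < \<epsilon> j" "\<And>j. \<epsilon> j \<le> 1"
    and t: "t \<longlonglongrightarrow> 1" "\<And>j. 0 < t j"
    and min: "\<And>j. Jf (\<lambda>x. t j * W x) \<le> Jf (\<lambda>x. t j * (W x + \<epsilon> j * \<phi> x))"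
  obtains \<rho> where "\<rho> \<longlonglongrightarrow> weak_form W \<phi> - l * reaction W \<phi>"
    "\<And>j. (A (\<lambda>x. W x + \<epsilon> j * \<phi> x) - A W) / \<epsilon> j / (1 - q) \<le> \<rho> j"
proof -
  define U where "U j = (\<lambda>x. W x + \<epsilon> j * \<phi> x)" for j
  have U: "U j \<in> X" for j unfolding U_def by (rule X_perturb[OF W \<phi>])
  define dE where "dE j = (energy p s (U j) - energy p s W) / \<epsilon> j" for j
  define dB where "dB j = (B (U j) - B W) / \<epsilon> j" for j
  define dA where "dA j = (A (U j) - A W) / \<epsilon> j" for j
  define \<rho> where "\<rho> j = t j powr (p - 1 + q) * dE j / p - l * (t j powr (r + q) * dB j) / (r + 1)" for j
  have dE: "dE \<longlonglongrightarrow> p * weak_form W \<phi>" unfolding dE_def U_def by (rule energy_Gateaux[OF W \<phi> \<epsilon>])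
  have dB: "dB \<longlonglongrightarrow> (r + 1) * reaction W \<phi>" unfolding dB_def U_def reaction_def by (rule B_Gateaux[OF W \<phi> \<epsilon>])
  have tp: "(\<lambda>j. t j powr e) \<longlonglongrightarrow> 1" for e
    using tendsto_powr[OF t(1) tendsto_const[of e]] by simp
  have "\<rho> \<longlonglongrightarrow> 1 * (p * weak_form W \<phi>) / p - l * (1 * ((r + 1) * reaction W \<phi>)) / (r + 1)"
    unfolding \<rho>_def using p1 pr by (intro tendsto_intros tp dE dB) auto
  then have lim: "\<rho> \<longlonglongrightarrow> weak_form W \<phi> - l * reaction W \<phi>" using p1 pr by simp
  have "dA j / (1 - q) \<le> \<rho> j" for j
  proof -
    have "J (t j * nrm W) (t j powr (1 - q) * A W) (t j powr (r + 1) * B W)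
        \<le> J (t j * nrm (U j)) (t j powr (1 - q) * A (U j)) (t j powr (r + 1) * B (U j))"
      using min[of j] Jf_scale[OF W t(2)] Jf_scale[OF U t(2)] by (simp add: U_def)
    then have "t j powr (1 - q) * (A (U j) - A W) / (1 - q) \<le>
        t j powr p * (energy p s (U j) - energy p s W) / p - l * (t j powr (r + 1) * (B (U j) - B W)) / (r + 1)"
      by (simp add: J_def powr_mult nrm_powr algebra_simps diff_divide_distrib)
    moreover have "A (U j) - A W = \<epsilon> j * dA j" "energy p s (U j) - energy p s W = \<epsilon> j * dE j"
      "B (U j) - B W = \<epsilon> j * dB j"
      using \<epsilon>(2)[of j] by (simp_all add: dA_def dE_def dB_def)
    ultimately have "\<epsilon> j * (t j powr (1 - q) * (dA j / (1 - q))) \<le>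
        \<epsilon> j * (t j powr p * dE j / p - l * (t j powr (r + 1) * dB j) / (r + 1))"
      by (simp add: right_diff_distrib mult_ac)
    then have "t j powr (1 - q) * (dA j / (1 - q)) \<le>
        t j powr p * dE j / p - l * (t j powr (r + 1) * dB j) / (r + 1)"
      using \<epsilon>(2)[of j] by (simp only: mult_le_cancel_left_pos)
    also have "\<dots> = t j powr (1 - q) * \<rho> j"
    proof -
      \<comment> \<open>Taking out the homogeneity \<open>1 - q\<close> of \<open>A\<close> frees
        its difference quotient from \<open>t j\<close>; the other powers of \<open>t j\<close> tend
        to one.\<close>
      have "t j powr p = t j powr (1 - q) * t j powr (p - 1 + q)" "t j powr (r + 1) = t j powr (1 - q) * t j powr (r + q)"
        by (simp_all add: algebra_simps flip: powr_add)
      then show ?thesis by (simp only: \<rho>_def) (simp add: algebra_simps)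
    qed
    finally have "t j powr (1 - q) * (dA j / (1 - q)) \<le> t j powr (1 - q) * \<rho> j" .
    moreover have "t j powr (1 - q) > 0" using t(2)[of j] by simp
    ultimately show "dA j / (1 - q) \<le> \<rho> j" by (simp only: mult_le_cancel_left_pos)
  qed
  then show ?thesis by (intro that[OF lim]) (simp add: dA_def U_def)
qed

text \<open>The tangent is taken at the perturbed point \<open>W x + e * \<phi> x\<close>, which is
  positive wherever \<open>\<phi>\<close> is, so zeros of \<open>W\<close> do no harm.\<close>

lemma singular_integral_le:
  assumes W: "W \<in> X" and W0: "\<And>x. W x \<ge> 0" and \<phi>: "\<phi> \<in> X" and \<phi>0: "\<And>x. \<phi> x \<ge> 0" and e: "e > 0"
  shows "integrable lborel (\<lambda>x. a x * \<phi> x * (W x + e * \<phi> x) powr (- q))"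
    and "(LINT x|lborel. a x * \<phi> x * (W x + e * \<phi> x) powr (- q)) \<le> (A (\<lambda>x. W x + e * \<phi> x) - A W) / e / (1 - q)"
proof -
  have [measurable]: "W \<in> borel_measurable borel" "\<phi> \<in> borel_measurable borel" using X_meas W \<phi> by auto
  define D where "D x = (a x * max (W x + e * \<phi> x) 0 powr (1 - q) - a x * max (W x) 0 powr (1 - q)) / e / (1 - q)" for x
  have i1: "integrable lborel (\<lambda>x. a x * max (W x + e * \<phi> x) 0 powr (1 - q))"
    by (rule A_int(1)[OF X_perturb[OF W \<phi>] e_bounds(1,2)])
  have i2: "integrable lborel (\<lambda>x. a x * max (W x) 0 powr (1 - q))"
    by (rule A_int(1)[OF W e_bounds(1,2)])
  have Di: "integrable lborel D"
    unfolding D_def by (intro integrable_divide Bochner_Integration.integrable_diff i1 i2)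
  have le: "a x * \<phi> x * (W x + e * \<phi> x) powr (- q) \<le> D x" for x
  proof (cases "W x + e * \<phi> x = 0")
    case True
    then have "e * \<phi> x = 0" "W x = 0" using W0[of x] \<phi>0[of x] e by (auto simp: add_nonneg_eq_0_iff)
    then show ?thesis using e by (simp add: D_def)
  next
    case False
    then have u: "W x + e * \<phi> x > 0" using W0[of x] \<phi>0[of x] e by (simp add: less_le)
    have "W x powr (1 - q) \<le> (W x + e * \<phi> x) powr (1 - q) - (1 - q) * (W x + e * \<phi> x) powr (- q) * (W x + e * \<phi> x - W x)"
      by (intro concave_powr_tangent q W0 u)
    then have "(1 - q) * e * ((W x + e * \<phi> x) powr (- q) * \<phi> x) \<le> (W x + e * \<phi> x) powr (1 - q) - W x powr (1 - q)"
      by (simp add: algebra_simps)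
    then have "a x * ((1 - q) * e * ((W x + e * \<phi> x) powr (- q) * \<phi> x)) \<le> a x * ((W x + e * \<phi> x) powr (1 - q) - W x powr (1 - q))"
      by (intro mult_left_mono a_nonneg)
    then have "a x * \<phi> x * (W x + e * \<phi> x) powr (- q) \<le> a x * ((W x + e * \<phi> x) powr (1 - q) - W x powr (1 - q)) / ((1 - q) * e)"
      using e q by (simp add: pos_le_divide_eq mult_ac)
    then show ?thesis using u W0[of x] by (simp add: D_def max_absorb1 right_diff_distrib mult.commute)
  qed
  show i: "integrable lborel (\<lambda>x. a x * \<phi> x * (W x + e * \<phi> x) powr (- q))"
    by (rule Bochner_Integration.integrable_bound[OF Di])
      (use le a_nonneg \<phi>0 in \<open>auto intro!: AE_I2 order_trans[OF _ abs_ge_self]\<close>)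
  have "(LINT x|lborel. a x * \<phi> x * (W x + e * \<phi> x) powr (- q)) \<le> integral\<^sup>L lborel D"
    by (intro integral_mono i Di le)
  also have "\<dots> = (A (\<lambda>x. W x + e * \<phi> x) - A W) / e / (1 - q)"
    using i1 i2 by (simp add: D_def[abs_def] A_def)
  finally show "(LINT x|lborel. a x * \<phi> x * (W x + e * \<phi> x) powr (- q)) \<le> (A (\<lambda>x. W x + e * \<phi> x) - A W) / e / (1 - q)" .
qed

text \<open>The factors \<open>t j\<close> are \<open>1\<close> for a minimiser in the ball; a perturbed point of the Nehari set is moved
  back into it by \<open>t j\<close>.\<close>

definition stationary :: "(real^'n \<Rightarrow> real) \<Rightarrow> bool" where
  "stationary W \<longleftrightarrow> (\<forall>\<phi>\<in>X. \<exists>\<epsilon> t. \<epsilon> \<longlonglongrightarrow> 0 \<and> (\<forall>j. 0 < \<epsilon> j) \<and> (\<forall>j. \<epsilon> j \<le> 1) \<and> t \<longlonglongrightarrow> 1 \<and> (\<forall>j. 0 < t j) \<and>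
    (\<forall>j::nat. Jf (\<lambda>x. t j * W x) \<le> Jf (\<lambda>x. t j * (W x + \<epsilon> j * \<phi> x))))"

lemma stationaryE:
  assumes "stationary W" "W \<in> X" "\<phi> \<in> X"
  obtains \<epsilon> \<rho> where "\<epsilon> \<longlonglongrightarrow> 0" "\<And>j. 0 < \<epsilon> j" "\<And>j. \<epsilon> j \<le> 1"
    "\<rho> \<longlonglongrightarrow> weak_form W \<phi> - l * reaction W \<phi>" "\<And>j::nat. (A (\<lambda>x. W x + \<epsilon> j * \<phi> x) - A W) / \<epsilon> j / (1 - q) \<le> \<rho> j"
proof -
  obtain \<epsilon> t where *: "\<epsilon> \<longlonglongrightarrow> 0" "\<forall>j. 0 < \<epsilon> j" "\<forall>j. \<epsilon> j \<le> 1" "t \<longlonglongrightarrow> 1" "\<forall>j. 0 < t j"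
      "\<forall>j::nat. Jf (\<lambda>x. t j * W x) \<le> Jf (\<lambda>x. t j * (W x + \<epsilon> j * \<phi> x))"
    using bspec[OF assms(1)[unfolded stationary_def] assms(3)] by (elim exE conjE) (rule that)
  show ?thesis
    by (rule direction_limit[OF assms(2,3) *[rule_format]]) (rule that[OF *(1-3)[rule_format]])
qed

text \<open>On the zero set of \<open>W\<close> the singular integrand equals
  \<open>\<epsilon> j powr (- q)\<close> times \<open>a x * \<phi> x powr (1 - q)\<close>. The
  difference quotients stay bounded, so the integral of the latter over the zero set is at most a
  bounded multiple of \<open>\<epsilon> j powr q\<close>, hence zero.\<close>

lemma stationary_positive:
  assumes st: "stationary W" and W: "W \<in> X" and W0: "\<And>x. W x \<ge> 0"
  shows "AE x in lborel. x \<in> \<Omega> \<longrightarrow> W x > 0"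
proof -
  obtain \<phi> where \<phi>: "\<phi> \<in> X" "\<And>x. x \<in> \<Omega> \<Longrightarrow> \<phi> x > 0" "\<And>x. \<phi> x \<ge> 0" using exists_positive by blast
  obtain \<epsilon> \<rho> where \<epsilon>: "\<epsilon> \<longlonglongrightarrow> 0" "\<And>j. 0 < \<epsilon> j" "\<And>j. \<epsilon> j \<le> 1"
    and \<rho>: "\<rho> \<longlonglongrightarrow> weak_form W \<phi> - l * reaction W \<phi>"
      "\<And>j::nat. (A (\<lambda>x. W x + \<epsilon> j * \<phi> x) - A W) / \<epsilon> j / (1 - q) \<le> \<rho> j"
    by (rule stationaryE[OF st W \<phi>(1)]) (rule that)
  have [measurable]: "W \<in> borel_measurable borel" "\<phi> \<in> borel_measurable borel" using X_meas W \<phi> by auto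
  define Z where "Z = {x \<in> \<Omega>. W x = 0}"
  have [measurable]: "Z \<in> sets borel" unfolding Z_def by measurable
  define h where "h x = indicator Z x * (a x * max (\<phi> x) 0 powr (1 - q))" for x
  have hi: "integrable lborel h"
    unfolding h_def using integrable_mult_indicator[OF _ A_int(1)[OF \<phi>(1) e_bounds(1,2)], of Z] by simp
  have h0: "h x \<ge> 0" for x by (simp add: h_def a_nonneg)
  have le: "integral\<^sup>L lborel h \<le> \<epsilon> j powr q * \<rho> j" for j
  proof -
    note S = singular_integral_le[OF W W0 \<phi>(1,3) \<epsilon>(2)[of j]]
    have "integral\<^sup>L lborel h \<le> (LINT x|lborel. \<epsilon> j powr q * (a x * \<phi> x * (W x + \<epsilon> j * \<phi> x) powr (- q)))"
    proof (intro integral_mono hi integrable_mult_right S)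
      fix x
      show "h x \<le> \<epsilon> j powr q * (a x * \<phi> x * (W x + \<epsilon> j * \<phi> x) powr (- q))"
      proof (cases "x \<in> Z")
        case True
        then have x: "W x = 0" "\<phi> x > 0" using \<phi>(2) by (auto simp: Z_def)
        have "\<epsilon> j powr q * (\<phi> x * (\<epsilon> j * \<phi> x) powr (- q)) = (\<epsilon> j powr q * \<epsilon> j powr (- q)) * (\<phi> x * \<phi> x powr (- q))"
          by (simp add: powr_mult)
        also have "\<dots> = \<phi> x powr (1 - q)"
          using x \<epsilon>(2)[of j] powr_mult_base[of "\<phi> x" "- q"] by (simp flip: powr_add)
        finally have eq: "\<epsilon> j powr q * (\<phi> x * (\<epsilon> j * \<phi> x) powr (- q)) = \<phi> x powr (1 - q)" .
        have "h x = a x * (\<epsilon> j powr q * (\<phi> x * (\<epsilon> j * \<phi> x) powr (- q)))"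
          using True x by (simp only: eq) (simp add: h_def max_absorb1)
        also have "\<dots> = \<epsilon> j powr q * (a x * \<phi> x * (W x + \<epsilon> j * \<phi> x) powr (- q))"
          by (simp add: x(1))
        finally show ?thesis by simp
      next
        case False
        then show ?thesis using a_nonneg \<phi>(3) by (simp add: h_def)
      qed
    qed
    also have "\<dots> = \<epsilon> j powr q * (LINT x|lborel. a x * \<phi> x * (W x + \<epsilon> j * \<phi> x) powr (- q))" by simp
    also have "\<dots> \<le> \<epsilon> j powr q * \<rho> j"
      using S(2) \<rho>(2)[of j] by (intro mult_left_mono) auto
    finally show ?thesis .
  qed
  have "(\<lambda>j. \<epsilon> j powr q * \<rho> j) \<longlonglongrightarrow> 0 powr q * (weak_form W \<phi> - l * reaction W \<phi>)"
    using q \<epsilon> by (intro tendsto_mult \<rho> tendsto_powr2[OF \<epsilon>(1) tendsto_const]) (auto simp: less_imp_le)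
  then have "integral\<^sup>L lborel h \<le> 0 powr q * (weak_form W \<phi> - l * reaction W \<phi>)"
    by (rule LIMSEQ_le_const) (use le in auto)
  moreover have "integral\<^sup>L lborel h \<ge> 0" by (rule Bochner_Integration.integral_nonneg[OF h0])
  ultimately have "integral\<^sup>L lborel h = 0" by simp
  then have "AE x in lborel. h x = 0" using integral_nonneg_eq_0_iff_AE[OF hi] h0 by simp
  then show ?thesis
  proof eventually_elim
    case (elim x)
    show ?case
    proof
      assume x: "x \<in> \<Omega>"
      show "W x > 0"
      proof (rule ccontr)
        assume "\<not> W x > 0"
        then have "x \<in> Z" using x W0[of x] by (simp add: Z_def)
        then show False using elim a_pos[OF x] \<phi>(2)[OF x] by (simp add: h_def max_absorb1)
      qed
    qed
  qed
qed

text \<open>In the direction \<open>\<bar>v\<bar>\<close> the integrals with perturbed denominator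
  stay below the convergent bounds \<open>\<rho> j\<close>, and positivity of \<open>W\<close> makes
  the integrands converge, so Fatou's lemma applies.\<close>

lemma stationary_singular_integrable:
  assumes st: "stationary W" and W: "W \<in> X" and W0: "\<And>x. W x \<ge> 0" and v: "v \<in> X"
  shows "integrable lborel (\<lambda>x. a x * W x powr (- q) * v x)"
proof -
  define \<phi> where "\<phi> x = \<bar>v x\<bar>" for x
  have \<phi>: "\<phi> \<in> X" "\<And>x. \<phi> x \<ge> 0" using X0_borel_abs[OF _ v] p1 by (auto simp: \<phi>_def[abs_def])
  obtain \<epsilon> \<rho> where \<epsilon>: "\<epsilon> \<longlonglongrightarrow> 0" "\<And>j. 0 < \<epsilon> j" "\<And>j. \<epsilon> j \<le> 1"
    and \<rho>: "\<rho> \<longlonglongrightarrow> weak_form W \<phi> - l * reaction W \<phi>"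
      "\<And>j::nat. (A (\<lambda>x. W x + \<epsilon> j * \<phi> x) - A W) / \<epsilon> j / (1 - q) \<le> \<rho> j"
    by (rule stationaryE[OF st W \<phi>(1)]) (rule that)
  have [measurable]: "W \<in> borel_measurable borel" "\<phi> \<in> borel_measurable borel" "v \<in> borel_measurable borel"
    using X_meas W \<phi> v by auto
  obtain C where C: "\<And>j. \<rho> j \<le> C"
    using convergentI[OF \<rho>(1), THEN convergent_imp_Bseq] unfolding Bseq_def by (auto simp: abs_le_iff)
  have "integrable lborel (\<lambda>x. a x * \<phi> x * W x powr (- q))"
  proof (rule Fatou_integral_bounded(1))
    note S = singular_integral_le[OF W W0 \<phi> \<epsilon>(2)]
    show "integrable lborel (\<lambda>x. a x * \<phi> x * (W x + \<epsilon> j * \<phi> x) powr (- q))" for j by (rule S)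
    show "(LINT x|lborel. a x * \<phi> x * (W x + \<epsilon> j * \<phi> x) powr (- q)) \<le> C" for j
      using S(2)[of j] \<rho>(2)[of j] C[of j] by simp
    show "AE x in lborel. (\<lambda>j. a x * \<phi> x * (W x + \<epsilon> j * \<phi> x) powr (- q)) \<longlonglongrightarrow> a x * \<phi> x * W x powr (- q)"
      using stationary_positive[OF st W W0]
    proof eventually_elim
      case (elim x)
      show ?case
      proof (cases "x \<in> \<Omega>")
        case True
        then have "W x > 0" using elim by simp
        moreover have "(\<lambda>j. W x + \<epsilon> j * \<phi> x) \<longlonglongrightarrow> W x + 0 * \<phi> x" by (intro tendsto_intros \<epsilon>)
        ultimately show ?thesis by (intro tendsto_mult tendsto_const tendsto_powr) auto
      qed (simp add: a_zero)
    qed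
  qed (use a_nonneg \<phi> in auto)
  then show ?thesis
    by (rule Bochner_Integration.integrable_bound) (auto simp: \<phi>_def abs_mult a_nonneg)
qed

text \<open>Here \<open>v\<close> may have any sign. Integrability of
  \<open>a x * W x powr (- q) * v x\<close>, just obtained, supplies the dominating function for the
  difference quotients of \<open>A\<close>.\<close>

lemma stationary_le:
  assumes st: "stationary W" and W: "W \<in> X" and W0: "\<And>x. W x \<ge> 0" and v: "v \<in> X"
  shows "(LINT x|lborel. a x * W x powr (- q) * v x) \<le> weak_form W v - l * reaction W v"
proof -
  obtain \<epsilon> \<rho> where \<epsilon>: "\<epsilon> \<longlonglongrightarrow> 0" "\<And>j. 0 < \<epsilon> j" "\<And>j. \<epsilon> j \<le> 1"
    and \<rho>: "\<rho> \<longlonglongrightarrow> weak_form W v - l * reaction W v"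
      "\<And>j::nat. (A (\<lambda>x. W x + \<epsilon> j * v x) - A W) / \<epsilon> j / (1 - q) \<le> \<rho> j"
    by (rule stationaryE[OF st W v]) (rule that)
  have [measurable]: "W \<in> borel_measurable borel" "v \<in> borel_measurable borel"
    using X_meas W v by auto
  define D where "D j x = (a x * max (W x + \<epsilon> j * v x) 0 powr (1 - q) - a x * max (W x) 0 powr (1 - q)) / \<epsilon> j / (1 - q)" for j x
  have i1: "integrable lborel (\<lambda>x. a x * max (W x + \<epsilon> j * v x) 0 powr (1 - q))" for j
    by (rule A_int(1)[OF X_perturb[OF W v] e_bounds(1,2)])
  have i2: "integrable lborel (\<lambda>x. a x * max (W x) 0 powr (1 - q))"
    by (rule A_int(1)[OF W e_bounds(1,2)])
  have Di: "integral\<^sup>L lborel (D j) = (A (\<lambda>x. W x + \<epsilon> j * v x) - A W) / \<epsilon> j / (1 - q)" for j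
    using i1[of j] i2 by (simp add: D_def[abs_def] A_def)
  have "(\<lambda>j. integral\<^sup>L lborel (D j)) \<longlonglongrightarrow> (LINT x|lborel. a x * W x powr (- q) * v x)"
  proof (rule integral_dominated_convergence)
    show "integrable lborel (\<lambda>x. \<bar>a x * W x powr (- q) * v x\<bar> / (1 - q))"
      using stationary_singular_integrable[OF st W W0 v] by (intro integrable_divide integrable_abs)
    show "AE x in lborel. norm (D j x) \<le> \<bar>a x * W x powr (- q) * v x\<bar> / (1 - q)" for j
      using stationary_positive[OF st W W0]
    proof eventually_elim
      case (elim x)
      show ?case
      proof (cases "x \<in> \<Omega>")
        case True
        then have x: "W x > 0" using elim by simp
        have "\<bar>max (W x + \<epsilon> j * v x) 0 powr (1 - q) - W x powr (1 - q)\<bar> \<le> W x powr (- q) * \<bar>\<epsilon> j * v x\<bar>"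
          by (intro pos_part_powr_diff_le q x)
        then have "a x * \<bar>max (W x + \<epsilon> j * v x) 0 powr (1 - q) - W x powr (1 - q)\<bar> \<le> a x * (W x powr (- q) * \<bar>\<epsilon> j * v x\<bar>)"
          by (intro mult_left_mono a_nonneg)
        then have *: "a x * \<bar>max (W x + \<epsilon> j * v x) 0 powr (1 - q) - W x powr (1 - q)\<bar> / \<epsilon> j \<le> a x * W x powr (- q) * \<bar>v x\<bar>"
          using \<epsilon>(2)[of j] by (simp add: pos_divide_le_eq abs_mult mult_ac)
        have "norm (D j x) = a x * \<bar>max (W x + \<epsilon> j * v x) 0 powr (1 - q) - W x powr (1 - q)\<bar> / \<epsilon> j / (1 - q)"
          using x \<epsilon>(2)[of j] q a_nonneg[of x] by (simp add: D_def max_absorb1 abs_mult abs_divide flip: right_diff_distrib)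
        also have "\<dots> \<le> a x * W x powr (- q) * \<bar>v x\<bar> / (1 - q)"
          using * q by (intro divide_right_mono) auto
        finally show ?thesis using a_nonneg[of x] by (simp add: abs_mult)
      qed (use q in \<open>simp add: a_zero D_def\<close>)
    qed
    show "AE x in lborel. (\<lambda>j. D j x) \<longlonglongrightarrow> a x * W x powr (- q) * v x"
      using stationary_positive[OF st W W0]
    proof eventually_elim
      case (elim x)
      show ?case
      proof (cases "x \<in> \<Omega> \<and> v x \<noteq> 0")
        case True
        then have x: "W x > 0" "v x \<noteq> 0" using elim by auto
        have "((\<lambda>y. y powr (1 - q)) has_real_derivative (1 - q) * W x powr (1 - q - 1)) (at (W x))"
          using x by (auto intro!: derivative_eq_intros)
        then have "((\<lambda>y. y powr (1 - q)) has_real_derivative (1 - q) * W x powr (- q)) (at (W x))" by simp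
        then have "((\<lambda>y. max y 0 powr (1 - q)) has_real_derivative (1 - q) * W x powr (- q)) (at (W x))"
          by (rule has_field_derivative_transform_within_open[OF _ open_greaterThan[of 0]])
            (use x in \<open>auto simp: max_def\<close>)
        then have "((\<lambda>h. (max (W x + h) 0 powr (1 - q) - max (W x) 0 powr (1 - q)) / h) \<longlongrightarrow> (1 - q) * W x powr (- q)) (at 0)"
          by (simp add: DERIV_def)
        moreover have "filterlim (\<lambda>j. \<epsilon> j * v x) (at 0) sequentially"
        proof -
          have "(\<lambda>j. \<epsilon> j * v x) \<longlonglongrightarrow> 0 * v x" by (intro tendsto_mult \<epsilon> tendsto_const)
          then show ?thesis using x \<epsilon>(2) by (auto simp: filterlim_at less_le)
        qed
        ultimately have "(\<lambda>j. (max (W x + \<epsilon> j * v x) 0 powr (1 - q) - max (W x) 0 powr (1 - q)) / (\<epsilon> j * v x)) \<longlonglongrightarrow> (1 - q) * W x powr (- q)"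
          by (rule filterlim_compose)
        then have "(\<lambda>j. a x * ((max (W x + \<epsilon> j * v x) 0 powr (1 - q) - max (W x) 0 powr (1 - q)) / (\<epsilon> j * v x)) * v x / (1 - q))
            \<longlonglongrightarrow> a x * ((1 - q) * W x powr (- q)) * v x / (1 - q)"
          using q by (intro tendsto_intros) auto
        moreover have "a x * ((max (W x + \<epsilon> j * v x) 0 powr (1 - q) - max (W x) 0 powr (1 - q)) / (\<epsilon> j * v x)) * v x / (1 - q) = D j x" for j
          using x by (simp add: D_def flip: right_diff_distrib)
        ultimately show ?thesis using q by (simp add: mult.assoc)
      qed (auto simp: a_zero D_def)
    qed
  qed (simp_all add: D_def[abs_def])
  then show ?thesis
    by (rule LIMSEQ_le[OF _ \<rho>(1)]) (use \<rho>(2) Di in auto)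
qed

text \<open>All three terms are linear in \<open>v\<close>, so the one-sided inequality for
  \<open>v\<close> and for \<open>- v\<close> is an equation.\<close>

theorem stationary_weak_solution:
  assumes st: "stationary W" and W: "W \<in> X" and W0: "\<And>x. W x \<ge> 0" and v: "v \<in> X"
  shows "weak_form W v = (LINT x|lborel. a x * W x powr (- q) * v x) + l * reaction W v"
proof -
  have nv: "(\<lambda>x. - v x) \<in> X" using X0_borel_scale(1)[OF v, of "-1"] by simp
  have "weak_form W (\<lambda>x. - v x) = (LINT z|gagliardo p s. - (\<bar>W (fst z) - W (snd z)\<bar> powr (p - 2) * (W (fst z) - W (snd z)) * (v (fst z) - v (snd z))))"
    unfolding weak_form_def by (intro Bochner_Integration.integral_cong) (simp_all add: algebra_simps)
  then have "weak_form W (\<lambda>x. - v x) = - weak_form W v" by (simp add: weak_form_def)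
  moreover have "reaction W (\<lambda>x. - v x) = - reaction W v" by (simp add: reaction_def)
  ultimately have "- (LINT x|lborel. a x * W x powr (- q) * v x) \<le> - weak_form W v + l * reaction W v"
    using stationary_le[OF st W W0 nv] by simp
  then show ?thesis using stationary_le[OF st W W0 v] by simp
qed

end

section \<open>Minimisation\<close>

text \<open>The bound by \<open>I + 1\<close> along the whole sequence is what coercivity is applied
  to.\<close>

lemma minimizing_sequence:
  fixes f :: "'a \<Rightarrow> real"
  assumes ne: "D \<noteq> {}" and bd: "\<And>x. x \<in> D \<Longrightarrow> C \<le> f x"
  obtains w I where "\<And>n::nat. w n \<in> D" "(\<lambda>n. f (w n)) \<longlonglongrightarrow> I" "\<And>x. x \<in> D \<Longrightarrow> I \<le> f x" "\<And>n. f (w n) \<le> I + 1"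
proof -
  define I where "I = Inf (f ` D)"
  have bb: "bdd_below (f ` D)" using bd by (auto intro!: bdd_belowI)
  have I: "I \<le> f x" if "x \<in> D" for x unfolding I_def using that bb by (intro cINF_lower)
  have "\<exists>x\<in>D. f x < I + 1 / real (Suc n)" for n
    using cInf_lessD[of "f ` D" "I + 1 / real (Suc n)"] ne by (auto simp: I_def)
  then obtain w where w: "\<And>n. w n \<in> D" "\<And>n. f (w n) < I + 1 / real (Suc n)" by metis
  have "(\<lambda>n. I + 1 / real (Suc n)) \<longlonglongrightarrow> I + 0"
    using LIMSEQ_Suc[OF lim_1_over_n] by (intro tendsto_add tendsto_const) simp
  then have up: "(\<lambda>n. I + 1 / real (Suc n)) \<longlonglongrightarrow> I" by simp
  have lim: "(\<lambda>n. f (w n)) \<longlonglongrightarrow> I"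
  proof (rule tendsto_sandwich[OF _ _ tendsto_const up])
    show "\<forall>\<^sub>F n in sequentially. I \<le> f (w n)" by (intro always_eventually allI I w(1))
    show "\<forall>\<^sub>F n in sequentially. f (w n) \<le> I + 1 / real (Suc n)"
      by (intro always_eventually allI less_imp_le w(2))
  qed
  have "f (w n) \<le> I + 1" for n
  proof -
    have "1 / real (Suc n) \<le> 1" by simp
    then show ?thesis using w(2)[of n] by linarith
  qed
  then show ?thesis by (intro that[OF w(1) lim I])
qed

context singular_problem
begin

text \<open>Allows the limit norm \<open>N\<close>, possibly larger than \<open>nrm v\<close>, to be
  combined with \<open>A v\<close> and \<open>B v\<close>.\<close>

lemma adm_mono:
  assumes "adm x \<alpha> \<beta>" "x \<le> y"
  shows "adm y \<alpha> \<beta>"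
proof -
  have "ca \<ge> 0" using norm_pos by (simp add: ca_def)
  then have "ca * x powr (1 - q) \<le> ca * y powr (1 - q)" "cb * x powr (r + 1) \<le> cb * y powr (r + 1)"
    using assms e_bounds cb by (auto simp: adm_def intro!: mult_left_mono powr_mono2)
  then show ?thesis using assms by (auto simp: adm_def)
qed

lemma J_mono: "0 \<le> x \<Longrightarrow> x \<le> y \<Longrightarrow> J x \<alpha> \<beta> \<le> J y \<alpha> \<beta>"
  using p1 by (auto simp: J_def intro!: divide_right_mono powr_mono2)

lemma J_tendsto:
  assumes "f \<longlonglongrightarrow> x" "g \<longlonglongrightarrow> \<alpha>" "h \<longlonglongrightarrow> \<beta>" "\<And>n. f n \<ge> 0"
  shows "(\<lambda>n. J (f n) (g n) (h n)) \<longlonglongrightarrow> J x \<alpha> \<beta>"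
proof -
  have "(\<lambda>n. f n powr p) \<longlonglongrightarrow> x powr p"
    using p1 assms(4) by (intro tendsto_powr2[OF assms(1) tendsto_const]) auto
  then show ?thesis unfolding J_def using p1 q e_bounds
    by (intro tendsto_diff tendsto_divide tendsto_mult tendsto_const assms(2,3)) auto
qed

text \<open>Near the origin of a ray the term of degree \<open>1 - q\<close> dominates those of
  degree \<open>p\<close> and \<open>r + 1\<close>. A negative infimum excludes the zero function as
  minimiser.\<close>

lemma exists_negative_Jf:
  obtains u where "u \<in> X" "nrm u \<le> R" "Jf u < 0"
proof -
  obtain \<phi> where \<phi>: "\<phi> \<in> X" "\<And>x. x \<in> \<Omega> \<Longrightarrow> \<phi> x > 0" "\<And>x. \<phi> x \<ge> 0" using exists_positive by blast
  have [measurable]: "\<phi> \<in> borel_measurable borel" using X_meas \<phi> by auto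
  have i: "integrable lborel (\<lambda>x. a x * max (\<phi> x) 0 powr (1 - q))" by (rule A_int(1)[OF \<phi>(1) e_bounds(1,2)])
  have "A \<phi> \<noteq> 0"
  proof
    assume "A \<phi> = 0"
    then have "AE x in lborel. a x * max (\<phi> x) 0 powr (1 - q) = 0"
      using integral_nonneg_eq_0_iff_AE[OF i] a_nonneg by (simp add: A_def)
    then have "AE x in lborel. x \<notin> \<Omega>"
    proof eventually_elim
      case (elim x)
      then show ?case using a_pos[of x] \<phi>(2)[of x] by (auto simp: max_def)
    qed
    then have "\<Omega> \<in> null_sets lborel" by (subst (asm) AE_iff_null_sets[symmetric]) auto
    then have "negligible \<Omega>" by (simp add: negligible_iff_null_sets null_sets_completionI)
    then show False using opn ne open_not_negligible by blast
  qed
  then have A: "A \<phi> > 0" using adm_X[OF \<phi>(1)] by (simp add: adm_def)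
  \<comment> \<open>\<open>J\<close> along the ray divided by \<open>t powr (1 - q)\<close>; its
    limit at zero is \<open>- A \<phi> / (1 - q)\<close>.\<close>
  define g where "g t = t powr (p - 1 + q) * nrm \<phi> powr p / p - A \<phi> / (1 - q) - l * (t powr (r + q) * B \<phi>) / (r + 1)" for t
  have inv: "(\<lambda>n. inverse (real (Suc n))) \<longlonglongrightarrow> 0" by (rule LIMSEQ_inverse_real_of_nat)
  have tp: "(\<lambda>n. inverse (real (Suc n)) powr e) \<longlonglongrightarrow> 0" if "e > 0" for e
    using tendsto_powr2[OF inv tendsto_const[of e]] that by simp
  have "(\<lambda>n. g (inverse (real (Suc n)))) \<longlonglongrightarrow> 0 * nrm \<phi> powr p / p - A \<phi> / (1 - q) - l * (0 * B \<phi>) / (r + 1)"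
    unfolding g_def using p1 q qp pr by (intro tendsto_intros tp) auto
  moreover have "0 * nrm \<phi> powr p / p - A \<phi> / (1 - q) - l * (0 * B \<phi>) / (r + 1) < 0" using A q by simp
  ultimately have 1: "\<forall>\<^sub>F n in sequentially. g (inverse (real (Suc n))) < 0" by (rule order_tendstoD)
  have "(\<lambda>n. inverse (real (Suc n)) * nrm \<phi>) \<longlonglongrightarrow> 0 * nrm \<phi>" by (intro tendsto_mult inv tendsto_const)
  then have 2: "\<forall>\<^sub>F n in sequentially. inverse (real (Suc n)) * nrm \<phi> < R" using R by (intro order_tendstoD) auto
  obtain n where n: "g (inverse (real (Suc n))) < 0" "inverse (real (Suc n)) * nrm \<phi> < R"
    using eventually_happens'[OF _ eventually_conj[OF 1 2]] by auto
  define t where "t = inverse (real (Suc n))"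
  have t: "t > 0" "g t < 0" "t * nrm \<phi> < R" using n by (auto simp: t_def)
  show ?thesis
  proof (rule that[of "\<lambda>x. t * \<phi> x"])
    show "(\<lambda>x. t * \<phi> x) \<in> X" by (rule X0_borel_scale[OF \<phi>(1)])
    show "nrm (\<lambda>x. t * \<phi> x) \<le> R" using t nrm_scale[OF \<phi>(1), of t] by simp
    have "Jf (\<lambda>x. t * \<phi> x) = t powr (1 - q) * g t"
    proof -
      have "t powr p = t powr (1 - q) * t powr (p - 1 + q)" "t powr (r + 1) = t powr (1 - q) * t powr (r + q)"
        by (simp_all add: algebra_simps flip: powr_add)
      then show ?thesis using Jf_scale[OF \<phi>(1) t(1)]
        by (simp only: g_def J_def powr_mult) (simp add: algebra_simps)
    qed
    also have "\<dots> < 0" using t by (simp add: mult_pos_neg)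
    finally show "Jf (\<lambda>x. t * \<phi> x) < 0" .
  qed
qed

text \<open>The minimiser over the ball is not zero, as the minimum is negative, and is not on the
  sphere, as shrinking decreases \<open>J\<close> there. All small perturbations therefore stay in
  the ball and compete with it.\<close>

theorem first_stationary:
  obtains w where "w \<in> X" "\<And>x. w x \<ge> 0" "0 < nrm w" "nrm w < R" "stationary w"
proof -
  define D where "D = {w \<in> X. nrm w \<le> R}"
  obtain u where u: "u \<in> D" "Jf u < 0" using exists_negative_Jf by (auto simp: D_def)
  obtain C where C: "\<And>X A B. adm X A B \<Longrightarrow> X \<le> R \<Longrightarrow> J X A B \<ge> C" using J_bounded_below by blast
  have bd: "C \<le> Jf w" if "w \<in> D" for w
    using that C[OF adm_X] by (simp add: D_def Jf_def)
  have "D \<noteq> {}" using u by auto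
  then obtain w I where w: "\<And>n::nat. w n \<in> D" "(\<lambda>n. Jf (w n)) \<longlonglongrightarrow> I" and I: "\<And>x. x \<in> D \<Longrightarrow> I \<le> Jf x"
    by (rule minimizing_sequence[of D C Jf]) (use bd in auto)
  have wX: "w n \<in> X" "nrm (w n) \<le> R" for n using w(1) by (auto simp: D_def)
  obtain \<tau> v N where \<tau>: "strict_mono (\<tau> :: nat \<Rightarrow> nat)" and v: "v \<in> X" "\<And>x. v x \<ge> 0"
    and N: "(\<lambda>n. nrm (w (\<tau> n))) \<longlonglongrightarrow> N" "nrm v \<le> N"
    and AB: "(\<lambda>n. A (w (\<tau> n))) \<longlonglongrightarrow> A v" "(\<lambda>n. B (w (\<tau> n))) \<longlonglongrightarrow> B v"
    by (rule X_compact[of w R, OF wX]) (rule that)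
  have "(\<lambda>n. Jf (w (\<tau> n))) \<longlonglongrightarrow> J N (A v) (B v)"
    unfolding Jf_def by (rule J_tendsto[OF N(1) AB nrm_nonneg])
  moreover have "(\<lambda>n. Jf (w (\<tau> n))) \<longlonglongrightarrow> I"
    using LIMSEQ_subseq_LIMSEQ[OF w(2) \<tau>] by (simp add: o_def)
  ultimately have JN: "J N (A v) (B v) = I" by (rule LIMSEQ_unique)
  have "N \<le> R" using N(1) by (rule LIMSEQ_le_const2) (use wX in auto)
  then have vD: "v \<in> D" using v N by (simp add: D_def)
  \<comment> \<open>A loss of norm in the limit only lowers \<open>J\<close> and keeps the limit in
    the ball.\<close>
  have Jv: "Jf v \<le> I" using J_mono[OF nrm_nonneg N(2), of "A v" "B v"] JN by (simp add: Jf_def)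
  have neg: "Jf v < 0" using Jv I[OF u(1)] u(2) by simp
  have pos: "nrm v > 0"
  proof (rule ccontr)
    assume "\<not> ?thesis"
    then have "nrm v = 0" using nrm_nonneg[of v] by simp
    then have "A v = 0" "B v = 0" using adm_X[OF v(1)] by (auto simp: adm_def)
    then show False using neg \<open>nrm v = 0\<close> by (simp add: Jf_def J_def)
  qed
  have less: "nrm v < R"
  proof (rule ccontr)
    assume "\<not> ?thesis"
    then have eq: "nrm v = R" using vD by (simp add: D_def)
    have "fibre (nrm v) (A v) (B v) 1 > 0"
      using outside_sphere[of "A v" "B v"] adm_X[OF v(1)] eq by (simp add: fibre_def)
    then obtain d where d: "d > 0" "\<And>h. 0 < h \<Longrightarrow> h < d \<Longrightarrow>
        J ((1 - h) * nrm v) ((1 - h) powr (1 - q) * A v) ((1 - h) powr (r + 1) * B v) <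
        J (1 * nrm v) (1 powr (1 - q) * A v) (1 powr (r + 1) * B v)"
      using DERIV_pos_inc_left[OF J_scale_deriv[of 1 "nrm v" "A v" "B v"]] pos by auto
    define h where "h = min (d / 2) (1 / 2)"
    have h: "0 < h" "h < d" "h < 1" using d(1) by (auto simp: h_def)
    have "Jf (\<lambda>x. (1 - h) * v x) < Jf v"
      using d(2)[OF h(1,2)] h by (simp add: Jf_scale[OF v(1)]) (simp add: Jf_def)
    moreover have "(\<lambda>x. (1 - h) * v x) \<in> D"
    proof -
      have "(1 - h) * nrm v \<le> 1 * nrm v" using h nrm_nonneg by (intro mult_right_mono) auto
      then show ?thesis using h eq nrm_scale[OF v(1), of "1 - h"] X0_borel_scale(1)[OF v(1)] by (simp add: D_def)
    qed
    ultimately show False using I Jv by fastforce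
  qed
  have "stationary v"
    unfolding stationary_def
  proof
    fix \<phi> assume \<phi>: "\<phi> \<in> X"
    define \<epsilon> where "\<epsilon> j = inverse (real (Suc j))" for j
    have \<epsilon>: "\<epsilon> \<longlonglongrightarrow> 0" "\<And>j. 0 < \<epsilon> j" "\<And>j. \<epsilon> j \<le> 1"
      using LIMSEQ_inverse_real_of_nat by (auto simp: \<epsilon>_def[abs_def] inverse_le_1_iff)
    have "\<forall>\<^sub>F j in sequentially. nrm (\<lambda>x. v x + \<epsilon> j * \<phi> x) < R"
      using X_perturb_tendsto(1)[OF v(1) \<phi> \<epsilon>] less by (rule order_tendstoD)
    then obtain K where K: "\<And>j. j \<ge> K \<Longrightarrow> nrm (\<lambda>x. v x + \<epsilon> j * \<phi> x) < R"
      by (auto simp: eventually_sequentially)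
    have "Jf v \<le> Jf (\<lambda>x. v x + \<epsilon> (j + K) * \<phi> x)" for j
      using Jv I[of "\<lambda>x. v x + \<epsilon> (j + K) * \<phi> x"] K[of "j + K"] X_perturb[OF v(1) \<phi>] by (simp add: D_def)
    then show "\<exists>\<epsilon> t. \<epsilon> \<longlonglongrightarrow> 0 \<and> (\<forall>j. 0 < \<epsilon> j) \<and> (\<forall>j. \<epsilon> j \<le> 1) \<and> t \<longlonglongrightarrow> 1 \<and> (\<forall>j. 0 < t j) \<and>
        (\<forall>j::nat. Jf (\<lambda>x. t j * v x) \<le> Jf (\<lambda>x. t j * (v x + \<epsilon> j * \<phi> x)))"
      using \<epsilon> LIMSEQ_ignore_initial_segment[OF \<epsilon>(1), of K]
      by (intro exI[of _ "\<lambda>j. \<epsilon> (j + K)"] exI[of _ "\<lambda>_. 1"]) auto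
  qed
  then show ?thesis using that v pos less by blast
qed

section \<open>Minimisation on the outer part of the Nehari set\<close>

text \<open>The closed condition \<open>R \<le> nrm w\<close> replaces the strict inequality of the
  minus part and passes to limits of norms. By \<open>nehari_outside\<close> it implies that
  inequality and even \<open>R < nrm w\<close>.\<close>

definition M where "M = {w \<in> X. R \<le> nrm w \<and> nrm w powr p = A w + l * B w}"

lemma scale_in_M:
  assumes "w \<in> X" "t > 0" "R \<le> t * nrm w" "(t * nrm w) powr p = t powr (1 - q) * A w + l * (t powr (r + 1) * B w)"
  shows "(\<lambda>x. t * w x) \<in> M"
  using assms by (simp add: M_def X0_borel_scale nrm_scale A_scale B_scale)

text \<open>If norm is lost, the limit \<open>v\<close> is off the Nehari set, but a multiple of it
  lies in \<open>M\<close>. Comparison with the fibre map of the triple formed with \<open>N\<close>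
  shows that this multiple still attains the infimum.\<close>

theorem second_minimizer:
  obtains W where "W \<in> M" "\<And>x. W x \<ge> 0" "\<And>w. w \<in> M \<Longrightarrow> Jf W \<le> Jf w"
proof -
  obtain \<phi> where \<phi>: "\<phi> \<in> X" "B \<phi> > 0" using exists_B_positive by blast
  have "nrm \<phi> > 0"
    using adm_X[OF \<phi>(1)] \<phi>(2) nrm_nonneg[of \<phi>] by (cases "nrm \<phi> = 0") (auto simp: adm_def)
  then obtain t where "t > 0" "t * nrm \<phi> \<ge> R" "(t * nrm \<phi>) powr p = t powr (1 - q) * A \<phi> + l * (t powr (r + 1) * B \<phi>)"
    using exists_nehari_outside[OF adm_X[OF \<phi>(1)] _ \<phi>(2)] by blast
  then have "(\<lambda>x. t * \<phi> x) \<in> M" by (intro scale_in_M \<phi>(1))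
  then have ne: "M \<noteq> {}" by auto
  have admM: "adm (nrm w) (A w) (B w)" if "w \<in> M" for w using that adm_X by (simp add: M_def)
  obtain K0 where K0: "\<And>X A B. adm X A B \<Longrightarrow> X powr p = A + l * B \<Longrightarrow> J X A B \<le> 0 \<Longrightarrow> X \<le> K0"
    using nehari_J_coercive[of 0] by blast
  obtain C0 where C0: "\<And>X A B. adm X A B \<Longrightarrow> X \<le> K0 \<Longrightarrow> J X A B \<ge> C0" using J_bounded_below by blast
  \<comment> \<open>Where \<open>J\<close> is nonpositive, coercivity bounds the norm and hence
    \<open>J\<close> from below; elsewhere zero is a lower bound.\<close>
  have bd: "min C0 0 \<le> Jf w" if "w \<in> M" for w
    using K0[OF admM[OF that]] C0[OF admM[OF that]] that
    by (cases "Jf w \<le> 0") (auto simp: Jf_def M_def)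
  obtain w I where w: "\<And>n::nat. w n \<in> M" "(\<lambda>n. Jf (w n)) \<longlonglongrightarrow> I"
    and I: "\<And>x. x \<in> M \<Longrightarrow> I \<le> Jf x" and w3: "\<And>n. Jf (w n) \<le> I + 1"
    by (rule minimizing_sequence[of M "min C0 0" Jf, OF ne bd], assumption) (rule that)
  obtain K where K: "\<And>X A B. adm X A B \<Longrightarrow> X powr p = A + l * B \<Longrightarrow> J X A B \<le> I + 1 \<Longrightarrow> X \<le> K"
    using nehari_J_coercive[of "I + 1"] by blast
  have wX: "w n \<in> X" "R \<le> nrm (w n)" "nrm (w n) powr p = A (w n) + l * B (w n)" for n
    using w(1)[of n] by (auto simp: M_def)
  have wK: "nrm (w n) \<le> K" for n
    using K[OF admM[OF w(1)] wX(3)] w3[of n] by (simp add: Jf_def)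
  obtain \<tau> v N where \<tau>: "strict_mono (\<tau> :: nat \<Rightarrow> nat)" and v: "v \<in> X" "\<And>x. v x \<ge> 0"
    and N: "(\<lambda>n. nrm (w (\<tau> n))) \<longlonglongrightarrow> N" "nrm v \<le> N"
    and AB: "(\<lambda>n. A (w (\<tau> n))) \<longlonglongrightarrow> A v" "(\<lambda>n. B (w (\<tau> n))) \<longlonglongrightarrow> B v"
    by (rule X_compact[of w K, OF wX(1) wK]) (rule that)
  have "(\<lambda>n. Jf (w (\<tau> n))) \<longlonglongrightarrow> J N (A v) (B v)"
    unfolding Jf_def by (rule J_tendsto[OF N(1) AB nrm_nonneg])
  moreover have "(\<lambda>n. Jf (w (\<tau> n))) \<longlonglongrightarrow> I"
    using LIMSEQ_subseq_LIMSEQ[OF w(2) \<tau>] by (simp add: o_def)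
  ultimately have JN: "J N (A v) (B v) = I" by (rule LIMSEQ_unique)
  have RN: "R \<le> N" using N(1) by (rule LIMSEQ_le_const) (use wX in auto)
  have "(\<lambda>n. nrm (w (\<tau> n)) powr p) \<longlonglongrightarrow> N powr p"
    using p1 nrm_nonneg by (intro tendsto_powr2[OF N(1) tendsto_const]) auto
  moreover have "(\<lambda>n. nrm (w (\<tau> n)) powr p) \<longlonglongrightarrow> A v + l * B v"
    unfolding wX(3) by (intro tendsto_intros AB)
  ultimately have Neq: "N powr p = A v + l * B v" by (rule LIMSEQ_unique)
  \<comment> \<open>From here on \<open>N\<close> plays the role of the norm of \<open>v\<close>; in
    particular \<open>B v > 0\<close>, so \<open>v\<close> is not zero.\<close>
  have admN: "adm N (A v) (B v)" using adm_mono[OF adm_X[OF v(1)] N(2)] .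
  have Bv: "B v > 0" by (rule nehari_outside(3)[OF admN RN Neq])
  have nv: "nrm v > 0"
    using adm_X[OF v(1)] Bv nrm_nonneg[of v] by (cases "nrm v = 0") (auto simp: adm_def)
  obtain t where t: "t > 0" "t * nrm v \<ge> R" "(t * nrm v) powr p = t powr (1 - q) * A v + l * (t powr (r + 1) * B v)"
    using exists_nehari_outside[OF adm_X[OF v(1)] nv Bv] by blast
  have tM: "(\<lambda>x. t * v x) \<in> M" using t by (intro scale_in_M v)
  have tN: "t * nrm v \<le> t * N" using t N by (intro mult_left_mono) auto
  have "Jf (\<lambda>x. t * v x) = J (t * nrm v) (t powr (1 - q) * A v) (t powr (r + 1) * B v)"
    by (rule Jf_scale[OF v(1) t(1)])
  also have "\<dots> \<le> J (t * N) (t powr (1 - q) * A v) (t powr (r + 1) * B v)"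
    using t nrm_nonneg tN by (intro J_mono) auto
  \<comment> \<open>The triple with \<open>N\<close> satisfies the Nehari equation, so
    \<open>t = 1\<close> is the maximum on its ray outside the ball; for \<open>nrm v\<close> this
    need not hold.\<close>
  also have "\<dots> \<le> J N (A v) (B v)"
    using J_scale_le[OF admN RN Neq t(1)] t tN by simp
  finally have "Jf (\<lambda>x. t * v x) \<le> I" using JN by simp
  then show ?thesis using tM v t I by (intro that[of "\<lambda>x. t * v x"]) (auto intro: order_trans)
qed

text \<open>A perturbation leaves \<open>M\<close>, but the strict sign change of the fibre map on
  both sides of \<open>t = 1\<close> persists, so some factor close to one returns it to
  \<open>M\<close>. Only continuity of the norm, \<open>A\<close> and \<open>B\<close> along the
  perturbation is used.\<close>

theorem second_stationary:
  obtains W where "W \<in> M" "\<And>x. W x \<ge> 0" "stationary W"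
proof -
  obtain W where W: "W \<in> M" "\<And>x. W x \<ge> 0" "\<And>w. w \<in> M \<Longrightarrow> Jf W \<le> Jf w" using second_minimizer by blast
  have WX: "W \<in> X" and WR: "R \<le> nrm W" and Weq: "nrm W powr p = A W + l * B W" using W(1) by (auto simp: M_def)
  have adm: "adm (nrm W) (A W) (B W)" by (rule adm_X[OF WX])
  have WR': "R < nrm W" by (rule nehari_outside(2)[OF adm WR Weq])
  \<comment> \<open>Half the relative distance of \<open>W\<close> to the sphere, so factors above
    \<open>1 - d\<close> keep \<open>W\<close> outside the ball.\<close>
  define d where "d = (1 - R / nrm W) / 2"
  have RW: "R / nrm W < 1" "0 < R / nrm W" using WR' R by auto
  have d: "0 < d" "d < 1" using RW by (auto simp: d_def)
  have "stationary W"
    unfolding stationary_def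
  proof
    fix \<phi> assume \<phi>: "\<phi> \<in> X"
    define e where "e i = inverse (real (Suc i))" for i
    have e: "e \<longlonglongrightarrow> 0" "\<And>j. 0 < e j" "\<And>j. e j \<le> 1"
      using LIMSEQ_inverse_real_of_nat by (auto simp: e_def[abs_def] inverse_le_1_iff)
    define U where "U i = (\<lambda>x. W x + e i * \<phi> x)" for i
    have U: "U i \<in> X" for i unfolding U_def by (rule X_perturb[OF WX \<phi>])
    have lim: "(\<lambda>i. nrm (U i)) \<longlonglongrightarrow> nrm W" "(\<lambda>i. A (U i)) \<longlonglongrightarrow> A W" "(\<lambda>i. B (U i)) \<longlonglongrightarrow> B W"
      unfolding U_def by (rule X_perturb_tendsto[OF WX \<phi> e])+
    have flim: "(\<lambda>i. fibre (nrm (U i)) (A (U i)) (B (U i)) t) \<longlonglongrightarrow> fibre (nrm W) (A W) (B W) t" for t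
      unfolding fibre_def using p1 nrm_nonneg
      by (intro tendsto_intros lim tendsto_powr2[OF lim(1) tendsto_const]) auto
    \<comment> \<open>The tolerance \<open>d * e j\<close> is fixed first, and the index
      \<open>i\<close> of a fine enough perturbation depends on it; the final step sizes are
      therefore \<open>e (i j)\<close>.\<close>
    have ex: "\<exists>i t. i \<ge> j \<and> \<bar>t - 1\<bar> \<le> d * e j \<and> 0 < t \<and> Jf (\<lambda>x. t * W x) \<le> Jf (\<lambda>x. t * U i x)" for j
    proof -
      define lo where "lo = 1 - d * e j"
      define hi where "hi = 1 + d * e j"
      have de: "0 < d * e j" "d * e j \<le> d" using d e(2,3)[of j] by (auto simp: mult_left_le)
      have lo: "0 < lo" "lo < 1" "hi > 1" using de d unfolding lo_def hi_def by linarith+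
      have "R / nrm W < 1 - d" using RW by (simp add: d_def field_simps)
      also have "\<dots> \<le> lo" using de by (simp add: lo_def)
      finally have loR: "R < lo * nrm W" using WR' R by (simp add: pos_divide_less_eq)
      have f1: "fibre (nrm W) (A W) (B W) lo > 0"
        using fibre_sign(1)[OF adm WR Weq] loR lo by simp
      have f2: "fibre (nrm W) (A W) (B W) hi < 0"
        using fibre_sign(2)[OF adm WR Weq] lo by simp
      have "(\<lambda>i. lo * nrm (U i)) \<longlonglongrightarrow> lo * nrm W" by (intro tendsto_intros lim)
      then have "\<forall>\<^sub>F i in sequentially. R < lo * nrm (U i)" using loR by (rule order_tendstoD)
      moreover have "\<forall>\<^sub>F i in sequentially. fibre (nrm (U i)) (A (U i)) (B (U i)) lo > 0"
        using flim f1 by (rule order_tendstoD)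
      moreover have "\<forall>\<^sub>F i in sequentially. fibre (nrm (U i)) (A (U i)) (B (U i)) hi < 0"
        using flim f2 by (rule order_tendstoD)
      moreover have "\<forall>\<^sub>F i in sequentially. i \<ge> j" by (rule eventually_ge_at_top)
      ultimately have "\<forall>\<^sub>F i in sequentially. R < lo * nrm (U i) \<and> fibre (nrm (U i)) (A (U i)) (B (U i)) lo > 0 \<and>
          fibre (nrm (U i)) (A (U i)) (B (U i)) hi < 0 \<and> i \<ge> j"
        by eventually_elim auto
      then obtain i where i: "R < lo * nrm (U i)" "fibre (nrm (U i)) (A (U i)) (B (U i)) lo > 0"
          "fibre (nrm (U i)) (A (U i)) (B (U i)) hi < 0" "i \<ge> j"
        by (auto simp: eventually_sequentially)
      have "lo < hi" using lo by simp
      then obtain t where t: "lo < t" "t < hi" "(t * nrm (U i)) powr p = t powr (1 - q) * A (U i) + l * (t powr (r + 1) * B (U i))"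
        using fibre_root[OF lo(1) _ i(2,3) nrm_nonneg] by blast
      have t0: "t > 0" using t lo by simp
      have "lo * nrm (U i) \<le> t * nrm (U i)" using t nrm_nonneg by (intro mult_right_mono) auto
      then have "(\<lambda>x. t * U i x) \<in> M" using i t t0 by (intro scale_in_M U) auto
      then have "Jf W \<le> Jf (\<lambda>x. t * U i x)" by (rule W)
      \<comment> \<open>\<open>W\<close> maximises \<open>J\<close> on its ray outside the ball and
        minimises it on \<open>M\<close>, which contains the rescaled perturbation; chaining the two
        puts the same factor \<open>t\<close> on both sides.\<close>
      moreover have "Jf (\<lambda>x. t * W x) \<le> Jf W"
      proof -
        have "lo * nrm W \<le> t * nrm W" using t nrm_nonneg by (intro mult_right_mono) auto
        then show ?thesis
          using J_scale_le[OF adm WR Weq t0] loR unfolding Jf_scale[OF WX t0] by (simp add: Jf_def)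
      qed
      ultimately show ?thesis using i(4) t t0
        by (intro exI[of _ i] exI[of _ t]) (auto simp: lo_def hi_def)
    qed
    from choice[OF allI[OF ex]] obtain i where
      "\<forall>j. \<exists>t. i j \<ge> j \<and> \<bar>t - 1\<bar> \<le> d * e j \<and> 0 < t \<and> Jf (\<lambda>x. t * W x) \<le> Jf (\<lambda>x. t * U (i j) x)" ..
    from choice[OF this] obtain t where
      it': "\<forall>j. i j \<ge> j \<and> \<bar>t j - 1\<bar> \<le> d * e j \<and> 0 < t j \<and> Jf (\<lambda>x. t j * W x) \<le> Jf (\<lambda>x. t j * U (i j) x)" ..
    have it: "i j \<ge> j" "\<bar>t j - 1\<bar> \<le> d * e j" "0 < t j" "Jf (\<lambda>x. t j * W x) \<le> Jf (\<lambda>x. t j * U (i j) x)" for j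
      using it' by simp_all
    have "(\<lambda>j. e (i j)) \<longlonglongrightarrow> 0"
    proof (rule tendsto_sandwich[OF _ _ tendsto_const e(1)])
      show "\<forall>\<^sub>F j in sequentially. e (i j) \<le> e j"
        using it(1) by (intro always_eventually allI) (simp add: e_def le_imp_inverse_le)
    qed (use e(2) in \<open>auto intro!: always_eventually less_imp_le\<close>)
    moreover have "t \<longlonglongrightarrow> 1"
    proof -
      have "(\<lambda>j. d * e j) \<longlonglongrightarrow> d * 0" by (intro tendsto_intros e)
      then have up: "(\<lambda>j. d * e j) \<longlonglongrightarrow> 0" by simp
      have "(\<lambda>j. \<bar>t j - 1\<bar>) \<longlonglongrightarrow> 0"
      proof (rule tendsto_sandwich[OF _ _ tendsto_const up])
        show "\<forall>\<^sub>F j in sequentially. \<bar>t j - 1\<bar> \<le> d * e j" by (intro always_eventually allI it(2))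
      qed simp
      then show ?thesis by (rule LIM_zero_cancel[OF tendsto_rabs_zero_cancel])
    qed
    ultimately show "\<exists>\<epsilon> t. \<epsilon> \<longlonglongrightarrow> 0 \<and> (\<forall>j. 0 < \<epsilon> j) \<and> (\<forall>j. \<epsilon> j \<le> 1) \<and> t \<longlonglongrightarrow> 1 \<and> (\<forall>j. 0 < t j) \<and>
        (\<forall>j::nat. Jf (\<lambda>x. t j * W x) \<le> Jf (\<lambda>x. t j * (W x + \<epsilon> j * \<phi> x)))"
      using e it(3,4) unfolding U_def by (intro exI[of _ "\<lambda>j. e (i j)"] exI[of _ t]) auto
  qed
  then show ?thesis using that W by blast
qed

end

section \<open>Modification on null sets and the Nehari equation\<close>

lemma energy_cong_AE:
  fixes u v :: "real^'n \<Rightarrow> real"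
  assumes [measurable]: "u \<in> borel_measurable borel" "v \<in> borel_measurable borel" and eq: "AE x in lborel. u x = v x"
  shows "energy p s u = energy p s v"
    and "integrable (gagliardo p s) (\<lambda>z. \<bar>u (fst z) - u (snd z)\<bar> powr p) \<longleftrightarrow> integrable (gagliardo p s) (\<lambda>z. \<bar>v (fst z) - v (snd z)\<bar> powr p)"
proof -
  have ae: "AE z in gagliardo p s. \<bar>u (fst z) - u (snd z)\<bar> powr p = \<bar>v (fst z) - v (snd z)\<bar> powr p"
    by (rule AE_gagliardoI) (use AE_lborel_prod_fst[OF eq] AE_lborel_prod_snd[OF eq] in eventually_elim, simp)
  show "energy p s u = energy p s v" unfolding energy_def by (rule integral_cong_AE) (use ae in auto)
  show "integrable (gagliardo p s) (\<lambda>z. \<bar>u (fst z) - u (snd z)\<bar> powr p) \<longleftrightarrow> integrable (gagliardo p s) (\<lambda>z. \<bar>v (fst z) - v (snd z)\<bar> powr p)"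
    by (rule integrable_cong_AE) (use ae in auto)
qed

context singular_problem
begin

lemma Jf_cong_AE:
  assumes [measurable]: "u \<in> borel_measurable borel" "v \<in> borel_measurable borel" and eq: "AE x in lborel. u x = v x"
  shows "nrm u = nrm v" "Jf u = Jf v"
proof -
  show n: "nrm u = nrm v" using energy_cong_AE(1)[OF assms] by (simp add: nrm_def)
  have "A u = A v" unfolding A_def by (rule integral_cong_AE) (use eq in auto)
  moreover have "B u = B v" unfolding B_def by (rule integral_cong_AE) (use eq in auto)
  ultimately show "Jf u = Jf v" using n by (simp add: Jf_def)
qed

text \<open>Solutions have to be positive at every point of the domain. \<open>stationary\<close>
  depends only on the class modulo null sets, so the exceptional values may be overwritten by the
  arbitrary value one.\<close>

lemma stationary_representative:
  assumes st: "stationary u" and u: "u \<in> X" and u0: "\<And>x. u x \<ge> 0"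
  obtains w where "w \<in> X" "stationary w" "\<And>x. x \<in> \<Omega> \<Longrightarrow> w x > 0" "\<And>x. w x \<ge> 0" "nrm w = nrm u"
proof -
  define w where "w x = (if x \<in> \<Omega> \<and> u x \<le> 0 then 1 else u x)" for x
  have [measurable]: "u \<in> borel_measurable borel" by (rule X_meas[OF u])
  have wm[measurable]: "w \<in> borel_measurable borel" unfolding w_def by measurable
  have eq: "AE x in lborel. u x = w x"
    using stationary_positive[OF st u u0] by eventually_elim (auto simp: w_def)
  have "integrable lborel (\<lambda>x. \<bar>u x\<bar> powr p) \<longleftrightarrow> integrable lborel (\<lambda>x. \<bar>w x\<bar> powr p)"
    by (rule integrable_cong_AE) (use eq in auto)
  then have wX: "w \<in> X"
    using u energy_cong_AE(2)[OF _ _ eq, of p s] by (auto simp: X0_borel_def w_def[abs_def])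
  have "Jf (\<lambda>x. t * u x) = Jf (\<lambda>x. t * w x)" for t
    by (rule Jf_cong_AE) (use eq in auto)
  moreover have "Jf (\<lambda>x. t * (u x + e * \<phi> x)) = Jf (\<lambda>x. t * (w x + e * \<phi> x))" if "\<phi> \<in> X" for t e \<phi>
  proof -
    have [measurable]: "\<phi> \<in> borel_measurable borel" by (rule X_meas[OF that])
    show ?thesis by (rule Jf_cong_AE) (use eq in auto)
  qed
  ultimately have "stationary w" using st by (simp add: stationary_def)
  moreover have "w x > 0" if "x \<in> \<Omega>" for x using that by (simp add: w_def)
  moreover have "w x \<ge> 0" for x using u0[of x] by (simp add: w_def)
  moreover have "nrm w = nrm u" using Jf_cong_AE(1)[OF _ _ eq] by simp
  ultimately show ?thesis using that wX by blast
qed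

lemma weak_form_integrable:
  assumes "w \<in> X" "v \<in> X"
  shows "integrable (gagliardo p s) (\<lambda>z. \<bar>w (fst z) - w (snd z)\<bar> powr (p - 2) * (w (fst z) - w (snd z)) * (v (fst z) - v (snd z)))"
  by (rule energy_Gateaux(1)[OF assms LIMSEQ_inverse_real_of_nat]) (auto simp: inverse_le_1_iff)

lemma reaction_integrable:
  assumes "w \<in> X" "v \<in> X"
  shows "integrable lborel (\<lambda>x. b x * max (w x) 0 powr r * v x)"
  by (rule B_Gateaux(1)[OF assms LIMSEQ_inverse_real_of_nat]) (auto simp: inverse_le_1_iff)

text \<open>The weak equation is tested with \<open>w\<close> itself. For the minimiser over the
  ball this is where membership in the Nehari set comes from.\<close>

lemma stationary_nehari:
  assumes st: "stationary w" and w: "w \<in> X" and w0: "\<And>x. w x \<ge> 0" and pos: "\<And>x. x \<in> \<Omega> \<Longrightarrow> w x > 0"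
  shows "nrm w powr p = A w + l * B w"
proof -
  have "\<bar>y\<bar> powr (p - 2) * y * y = \<bar>y\<bar> powr p" for y :: real
  proof (cases "y = 0")
    case False
    have "\<bar>y\<bar> powr (p - 2) * y * y = \<bar>y\<bar> powr (p - 2) * \<bar>y\<bar> powr 2"
      using False by (simp add: power2_eq_square powr_numeral)
    also have "\<dots> = \<bar>y\<bar> powr p" by (simp only: powr_add[symmetric]) simp
    finally show ?thesis .
  qed simp
  then have "weak_form w w = energy p s w" by (simp add: weak_form_def energy_def)
  moreover have "a x * w x powr (- q) * w x = a x * max (w x) 0 powr (1 - q)" for x
  proof (cases "x \<in> \<Omega>")
    case True
    then show ?thesis using pos[of x] powr_mult_base[of "w x" "- q"] by (simp add: max_absorb1 mult.commute)
  qed (simp add: a_zero)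
  moreover have "b x * max (w x) 0 powr r * w x = b x * max (w x) 0 powr (r + 1)" for x
    using w0[of x] powr_mult_base[of "w x" r] by (simp add: max_absorb1 mult.commute add.commute)
  ultimately show ?thesis
    using stationary_weak_solution[OF st w w0 w] by (simp add: nrm_powr A_def B_def reaction_def)
qed

text \<open>The radius \<open>R\<close> settles everything that remains: the first norm is below it
  and the second at least \<open>R\<close>, which decides the signs and orders the norms.\<close>

theorem two_solutions:
  obtains w W where "w \<in> X" "stationary w" "\<And>x. x \<in> \<Omega> \<Longrightarrow> w x > 0" "\<And>x. w x \<ge> 0"
    "(p - 1 + q) * nrm w powr p > l * (r + q) * B w" "nrm w powr p = A w + l * B w"
    "W \<in> X" "stationary W" "\<And>x. x \<in> \<Omega> \<Longrightarrow> W x > 0" "\<And>x. W x \<ge> 0"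
    "(p - 1 + q) * nrm W powr p < l * (r + q) * B W" "nrm W powr p = A W + l * B W" "nrm w < nrm W"
proof -
  obtain u where u: "u \<in> X" "\<And>x. u x \<ge> 0" "0 < nrm u" "nrm u < R" "stationary u"
    by (rule first_stationary) (rule that)
  obtain w where w: "w \<in> X" "stationary w" "\<And>x. x \<in> \<Omega> \<Longrightarrow> w x > 0" "\<And>x. w x \<ge> 0" "nrm w = nrm u"
    by (rule stationary_representative[OF u(5,1,2)]) (rule that)
  obtain U where U: "U \<in> M" "\<And>x. U x \<ge> 0" "stationary U"
    by (rule second_stationary) (rule that)
  have UX: "U \<in> X" "R \<le> nrm U" using U(1) by (auto simp: M_def)
  obtain W where W: "W \<in> X" "stationary W" "\<And>x. x \<in> \<Omega> \<Longrightarrow> W x > 0" "\<And>x. W x \<ge> 0" "nrm W = nrm U"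
    by (rule stationary_representative[OF U(3) UX(1) U(2)]) (rule that)
  have N: "nrm w powr p = A w + l * B w" "nrm W powr p = A W + l * B W"
    by (rule stationary_nehari; fact)+
  have 1: "l * (r + q) * B w < (p - 1 + q) * nrm w powr p"
    by (rule inside_ball[OF adm_X[OF w(1)]]) (use w u in auto)
  have 2: "(p - 1 + q) * nrm W powr p < l * (r + q) * B W"
    by (rule nehari_outside(1)[OF adm_X[OF W(1)] _ N(2)]) (use W UX in auto)
  have 3: "nrm w < nrm W" using u UX w W by simp
  show ?thesis by (rule that[OF w(1-4) 1 N(1) W(1-4) 2 N(2) 3])
qed

end

section \<open>Lebesgue measurable functions and Borel representatives\<close>

lemma borel_representative:
  fixes f :: "'a::euclidean_space \<Rightarrow> real"
  assumes S: "S \<in> sets borel" and f: "f \<in> borel_measurable (lebesgue_on S)"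
  obtains g where "g \<in> borel_measurable borel" "\<And>x. x \<notin> S \<Longrightarrow> g x = 0" "AE x in lborel. x \<in> S \<longrightarrow> f x = g x"
proof -
  have "(\<lambda>x. if x \<in> S then f x else 0) \<in> borel_measurable lebesgue"
    using f S by (simp add: borel_measurable_if)
  then obtain g where g: "g \<in> borel_measurable lborel" "AE x in lborel. (if x \<in> S then f x else 0) = g x"
    using completion_ex_borel_measurable_real by blast
  have [measurable]: "S \<in> sets borel" "g \<in> borel_measurable borel" using S g by auto
  show ?thesis
  proof (rule that[of "\<lambda>x. if x \<in> S then g x else 0"])
    show "AE x in lborel. x \<in> S \<longrightarrow> f x = (if x \<in> S then g x else 0)"
      using g(2) by eventually_elim auto
  qed auto
qed

text \<open>Completeness of the Lebesgue measure makes a function that agrees almost everywhere with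
  a Borel one measurable, so \<open>F\<close> needs no measurability assumption.\<close>

lemma lebesgue_on_transfer:
  fixes F G :: "'a::euclidean_space \<Rightarrow> real"
  assumes S: "S \<in> sets borel" and G: "G \<in> borel_measurable borel" and G0: "\<And>x. x \<notin> S \<Longrightarrow> G x = 0"
    and eq: "AE x in lborel. x \<in> S \<longrightarrow> F x = G x"
  shows "F \<in> borel_measurable (lebesgue_on S)"
    and "integrable (lebesgue_on S) F \<longleftrightarrow> integrable lborel G"
    and "(LINT x|lebesgue_on S. F x) = (LINT x|lborel. G x)"
proof -
  have S': "S \<in> sets lebesgue" using S by simp
  have Gl: "G \<in> borel_measurable lebesgue" using G by (simp add: measurable_completion)
  have ae: "AE x in lebesgue. G x = (if x \<in> S then F x else 0)"
    using AE_completion[OF eq] by eventually_elim (simp add: G0)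
  have Fm: "(\<lambda>x. if x \<in> S then F x else 0) \<in> borel_measurable lebesgue"
    by (rule borel_measurable_AE[OF Gl ae])
  then show "F \<in> borel_measurable (lebesgue_on S)"
    using S' by (simp add: borel_measurable_if)
  have ind: "indicator S x * F x = (if x \<in> S then F x else 0)" for x by (simp add: indicator_def)
  have "integrable (lebesgue_on S) F \<longleftrightarrow> integrable lebesgue (\<lambda>x. if x \<in> S then F x else 0)"
    using S' by (subst integrable_restrict_space) (simp_all add: ind)
  also have "\<dots> \<longleftrightarrow> integrable lebesgue G"
    using ae by (intro integrable_cong_AE[OF Fm Gl]) auto
  also have "\<dots> \<longleftrightarrow> integrable lborel G" using G by (intro integrable_completion) simp
  finally show "integrable (lebesgue_on S) F \<longleftrightarrow> integrable lborel G" .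
  have "(LINT x|lebesgue_on S. F x) = (LINT x|lebesgue. (if x \<in> S then F x else 0))"
    using S' by (subst integral_restrict_space) (simp_all add: ind)
  also have "\<dots> = (LINT x|lebesgue. G x)"
    using ae by (intro integral_cong_AE[OF Fm Gl]) auto
  also have "\<dots> = (LINT x|lborel. G x)" using G by (intro integral_completion) simp
  finally show "(LINT x|lebesgue_on S. F x) = (LINT x|lborel. G x)" .
qed

lemma Q_borel: "open \<Omega> \<Longrightarrow> Q (\<Omega> :: (real^'n) set) \<in> sets borel"
proof -
  assume o: "open \<Omega>"
  have "closed ((UNIV - \<Omega>) \<times> (UNIV - \<Omega>))" using o by (intro closed_Times closed_Diff) auto
  then show ?thesis unfolding Q_def by (intro borel_open open_Diff) auto
qed

lemma gagliardo_density:
  fixes F :: "(real^'n) \<times> (real^'n) \<Rightarrow> real"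
  assumes [measurable]: "F \<in> borel_measurable borel"
  shows "integrable (gagliardo p s) F \<longleftrightarrow> integrable lborel (\<lambda>z. F z * norm (fst z - snd z) powr - (real CARD('n) + p * s))"
    and "(LINT z|gagliardo p s. F z) = (LINT z|lborel. F z * norm (fst z - snd z) powr - (real CARD('n) + p * s))"
  unfolding gagliardo_def by (subst integrable_density integral_density; simp add: mult.commute)+

text \<open>The kernel moves from the integrand into the measure, and the restriction to
  \<open>Q\<close> disappears because \<open>G\<close> vanishes outside it.\<close>

lemma gagliardo_transfer:
  fixes F G :: "(real^'n) \<times> (real^'n) \<Rightarrow> real"
  assumes o: "open \<Omega>" and [measurable]: "G \<in> borel_measurable borel"
    and G0: "\<And>z. z \<notin> Q \<Omega> \<Longrightarrow> G z = 0"
    and eq: "AE z in lborel. F z = G z / norm (fst z - snd z) powr (real CARD('n) + p * s)"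
  shows "F \<in> borel_measurable (lebesgue_on (Q \<Omega>))"
    and "integrable (lebesgue_on (Q \<Omega>)) F \<longleftrightarrow> integrable (gagliardo p s) G"
    and "(LINT z|lebesgue_on (Q \<Omega>). F z) = (LINT z|gagliardo p s. G z)"
proof -
  have m: "(\<lambda>z. G z * norm (fst z - snd z) powr - (real CARD('n) + p * s)) \<in> borel_measurable borel" by measurable
  have e: "AE z in lborel. z \<in> Q \<Omega> \<longrightarrow> F z = G z * norm (fst z - snd z) powr - (real CARD('n) + p * s)"
    using eq by eventually_elim (simp only: powr_minus divide_inverse simp_thms)
  note T = lebesgue_on_transfer[OF Q_borel[OF o] m _ e]
  show "F \<in> borel_measurable (lebesgue_on (Q \<Omega>))" by (rule T) (simp add: G0)
  show "integrable (lebesgue_on (Q \<Omega>)) F \<longleftrightarrow> integrable (gagliardo p s) G"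
    by (subst T) (simp_all add: G0 gagliardo_density)
  show "(LINT z|lebesgue_on (Q \<Omega>). F z) = (LINT z|gagliardo p s. G z)"
    by (subst T) (simp_all add: G0 gagliardo_density)
qed

lemma X0_transfer:
  fixes v w :: "real^'n \<Rightarrow> real"
  assumes p: "p > 0" and o: "open \<Omega>" and [measurable]: "w \<in> borel_measurable borel" and w0: "\<And>x. x \<notin> \<Omega> \<Longrightarrow> w x = 0"
    and eq: "AE x in lborel. v x = w x"
  shows "v \<in> X0 p s \<Omega> \<longleftrightarrow> w \<in> X0_borel p s \<Omega>"
    and "X0_norm p s \<Omega> v = energy p s w powr (1 / p)"
proof -
  have \<Omega>[measurable]: "\<Omega> \<in> sets borel" using o by simp
  define \<gamma> where "\<gamma> = real CARD('n) + p * s"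
  define G where "G z = \<bar>w (fst z) - w (snd z)\<bar> powr p" for z
  have Gm: "G \<in> borel_measurable borel" unfolding G_def by measurable
  have G0: "G z = 0" if "z \<notin> Q \<Omega>" for z using that w0 by (cases z) (auto simp: Q_def G_def)
  have eq2: "AE z in lborel. v (fst z) = w (fst z) \<and> v (snd z) = w (snd z)"
    using AE_lborel_prod_fst[OF eq] AE_lborel_prod_snd[OF eq] by eventually_elim simp
  define H where "H = (\<lambda>(x, y). (v x - v y) / norm (x - y) powr (\<gamma> / p))"
  have H: "\<bar>H z\<bar> powr p = \<bar>v (fst z) - v (snd z)\<bar> powr p / norm (fst z - snd z) powr \<gamma>" for z
    using p by (simp add: H_def case_prod_beta' powr_divide abs_divide powr_powr)
  have e1: "AE z in lborel. \<bar>H z\<bar> powr p = G z / norm (fst z - snd z) powr (real CARD('n) + p * s)"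
    using eq2 by eventually_elim (simp add: H G_def \<gamma>_def)
  note T = gagliardo_transfer[OF o Gm G0 e1]
  have Hm: "H \<in> borel_measurable (lebesgue_on (Q \<Omega>))"
  proof (rule lebesgue_on_transfer(1)[OF Q_borel[OF o]])
    show "(\<lambda>z. (w (fst z) - w (snd z)) / norm (fst z - snd z) powr (\<gamma> / p)) \<in> borel_measurable borel" by measurable
    show "AE z in lborel. z \<in> Q \<Omega> \<longrightarrow> H z = (w (fst z) - w (snd z)) / norm (fst z - snd z) powr (\<gamma> / p)"
      using eq2 by eventually_elim (simp add: H_def case_prod_beta')
    show "(w (fst z) - w (snd z)) / norm (fst z - snd z) powr (\<gamma> / p) = 0" if "z \<notin> Q \<Omega>" for z
      using that w0 by (cases z) (auto simp: Q_def)
  qed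
  have HL: "H \<in> Lp p (Q \<Omega>) \<longleftrightarrow> integrable (gagliardo p s) G" using Hm T(2) by (simp add: Lp_def)
  have vm: "v \<in> borel_measurable lebesgue"
    by (rule borel_measurable_AE[of w]) (use AE_completion[OF eq] in \<open>auto simp: measurable_completion eq_commute\<close>)
  have vO: "v \<in> borel_measurable (lebesgue_on \<Omega>)"
    by (rule lebesgue_on_transfer(1)[OF \<Omega>, of w]) (use w0 eq in auto)
  have "integrable (lebesgue_on \<Omega>) (\<lambda>x. \<bar>v x\<bar> powr p) \<longleftrightarrow> integrable lborel (\<lambda>x. \<bar>w x\<bar> powr p)"
    by (rule lebesgue_on_transfer(2)[OF \<Omega>]) (use w0 eq in auto)
  then have vL: "v \<in> Lp p \<Omega> \<longleftrightarrow> integrable lborel (\<lambda>x. \<bar>w x\<bar> powr p)" using vO by (simp add: Lp_def)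
  have v0: "AE x in lebesgue. x \<notin> \<Omega> \<longrightarrow> v x = 0"
    using AE_completion[OF eq] by eventually_elim (simp add: w0)
  show "v \<in> X0 p s \<Omega> \<longleftrightarrow> w \<in> X0_borel p s \<Omega>"
    using vm v0 vL HL w0 by (simp add: X0_def X0_borel_def H_def \<gamma>_def G_def[abs_def])
  have "(LINT (x, y)|lebesgue_on (Q \<Omega>). \<bar>v x - v y\<bar> powr p / norm (x - y) powr (real CARD('n) + p * s)) =
      (LINT z|lebesgue_on (Q \<Omega>). \<bar>H z\<bar> powr p)"
    by (simp add: H \<gamma>_def case_prod_beta')
  then show "X0_norm p s \<Omega> v = energy p s w powr (1 / p)"
    by (simp add: X0_norm_def T(3) energy_def G_def)
qed

lemma X0_representative:
  fixes v :: "real^'n \<Rightarrow> real"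
  assumes p: "p > 0" and o: "open \<Omega>" and v: "v \<in> X0 p s \<Omega>"
  obtains w where "w \<in> X0_borel p s \<Omega>" "AE x in lborel. v x = w x"
proof -
  have \<Omega>: "\<Omega> \<in> sets borel" using o by simp
  have vm: "v \<in> borel_measurable (lebesgue_on \<Omega>)" using v by (simp add: X0_def Lp_def)
  obtain w where w: "w \<in> borel_measurable borel" "\<And>x. x \<notin> \<Omega> \<Longrightarrow> w x = 0" "AE x in lborel. x \<in> \<Omega> \<longrightarrow> v x = w x"
    by (rule borel_representative[OF \<Omega> vm]) (rule that)
  have "AE x in lborel. x \<notin> \<Omega> \<longrightarrow> v x = 0" using v by (simp add: X0_def AE_completion_iff)
  with w(3) have eq: "AE x in lborel. v x = w x"
    by eventually_elim (use w(2) in force)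
  show ?thesis by (rule that[OF _ eq]) (use X0_transfer(1)[OF p o w(1,2) eq, of s] v in simp)
qed

lemma X0_borel_subset_X0: "p > 0 \<Longrightarrow> open \<Omega> \<Longrightarrow> w \<in> X0_borel p s \<Omega> \<Longrightarrow> w \<in> X0 p s \<Omega>"
  by (subst X0_transfer(1)[of p \<Omega> w w s]) (auto simp: X0_borel_def)

lemma X0_norm_X0_borel: "p > 0 \<Longrightarrow> open \<Omega> \<Longrightarrow> w \<in> X0_borel p s \<Omega> \<Longrightarrow> X0_norm p s \<Omega> w = energy p s w powr (1 / p)"
  by (rule X0_transfer(2)[of p \<Omega> w w s]) (auto simp: X0_borel_def)

text \<open>Since \<open>x / 0 = 0\<close>, the quotient vanishes when the Bochner integral in its denominator is
  undefined or zero; so positivity of the infimum contains the Sobolev embedding.\<close>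

lemma sobolev_S_positive_imp:
  fixes \<Omega> :: "(real^'n) set"
  assumes p: "p > 0" and o: "open \<Omega>" and S: "sobolev_S p s \<Omega> > 0" and P: "P = p_star (real CARD('n)) p s" "P > 0"
    and w: "w \<in> X0_borel p s \<Omega>"
  shows "integrable lborel (\<lambda>x. \<bar>w x\<bar> powr P)"
    and "sobolev_S p s \<Omega> * (LINT x|lborel. \<bar>w x\<bar> powr P) powr (p / P) \<le> energy p s w"
proof -
  have wm[measurable]: "w \<in> borel_measurable borel" using w by (simp add: X0_borel_def)
  define I where "I = (LINT x|lborel. \<bar>w x\<bar> powr P)"
  have "integrable lborel (\<lambda>x. \<bar>w x\<bar> powr P) \<and> sobolev_S p s \<Omega> * I powr (p / P) \<le> energy p s w"
  proof (cases "AE x in lborel. w x = 0")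
    case True
    have "integrable lborel (\<lambda>x. \<bar>w x\<bar> powr P) \<longleftrightarrow> integrable lborel (\<lambda>x::real^'n. 0 :: real)"
      by (rule integrable_cong_AE) (use True in auto)
    moreover have "I = (LINT x|(lborel :: (real^'n) measure). 0)"
      unfolding I_def by (rule integral_cong_AE) (use True in auto)
    ultimately show ?thesis by simp
  next
    case False
    define f where "f w = (LINT (x, y)|lebesgue. \<bar>w x - w y\<bar> powr p * norm (x - y) powr (- (real CARD('n) + p * s))) /
        (LINT x|lebesgue. \<bar>w x\<bar> powr p_star (real CARD('n)) p s) powr (p / p_star (real CARD('n)) p s)" for w :: "real^'n \<Rightarrow> real"
    have Sf: "sobolev_S p s \<Omega> = (INF w \<in> {w \<in> X0 p s \<Omega>. \<not> (AE x in lebesgue. w x = 0)}. f w)"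
      by (simp add: sobolev_S_def f_def)
    have f0: "f w \<ge> 0" for w unfolding f_def by (intro divide_nonneg_nonneg Bochner_Integration.integral_nonneg) (auto simp: case_prod_beta')
    have "sobolev_S p s \<Omega> \<le> f w"
      unfolding Sf
    proof (rule cINF_lower)
      show "bdd_below (f ` {w \<in> X0 p s \<Omega>. \<not> (AE x in lebesgue. w x = 0)})" using f0 by (auto intro!: bdd_belowI)
      show "w \<in> {w \<in> X0 p s \<Omega>. \<not> (AE x in lebesgue. w x = 0)}"
        using X0_borel_subset_X0[OF p o w] False by (simp add: AE_completion_iff)
    qed
    also have "f w = energy p s w / I powr (p / P)"
    proof -
      have "(LINT (x, y)|lebesgue. \<bar>w x - w y\<bar> powr p * norm (x - y) powr (- (real CARD('n) + p * s))) =
          (LINT z|lborel. \<bar>w (fst z) - w (snd z)\<bar> powr p * norm (fst z - snd z) powr (- (real CARD('n) + p * s)))"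
        unfolding case_prod_beta' by (rule integral_completion) measurable
      also have "\<dots> = energy p s w" unfolding energy_def by (rule gagliardo_density(2)[symmetric]) measurable
      moreover have "(LINT x|lebesgue. \<bar>w x\<bar> powr P) = I" unfolding I_def by (rule integral_completion) measurable
      ultimately show ?thesis by (simp add: f_def P)
    qed
    finally have le: "sobolev_S p s \<Omega> \<le> energy p s w / I powr (p / P)" .
    have "I \<noteq> 0" using le S by (auto intro!: notI)
    then have "integrable lborel (\<lambda>x. \<bar>w x\<bar> powr P)" unfolding I_def using not_integrable_integral_eq by blast
    moreover have "I powr (p / P) > 0" using \<open>I \<noteq> 0\<close> by simp
    ultimately show ?thesis using le by (simp add: pos_le_divide_eq)
  qed
  then show "integrable lborel (\<lambda>x. \<bar>w x\<bar> powr P)"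
    "sobolev_S p s \<Omega> * (LINT x|lborel. \<bar>w x\<bar> powr P) powr (p / P) \<le> energy p s w"
    by (auto simp: I_def)
qed

text \<open>All quotients are nonnegative, but a lower bound of an infimum also requires a nonempty
  index set, that is, an element that is not almost everywhere zero.\<close>

lemma sobolev_S_nonneg:
  fixes \<Omega> :: "(real^'n) set"
  assumes "p > 0" "0 < s" "s < 1" "bounded \<Omega>" "open \<Omega>" "\<Omega> \<noteq> {}"
  shows "sobolev_S p s \<Omega> \<ge> 0"
  unfolding sobolev_S_def
proof (rule cINF_greatest)
  obtain \<phi> where \<phi>: "\<phi> \<in> X0_borel p s \<Omega>" "\<And>x. x \<in> \<Omega> \<Longrightarrow> \<phi> x > 0"
    by (rule exists_positive_X0_borel[OF assms(1-5)]) (rule that)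
  have "\<not> (AE x in lebesgue. \<phi> x = 0)"
  proof
    assume "AE x in lebesgue. \<phi> x = 0"
    then have "AE x in lborel. \<phi> x = 0" by (simp add: AE_completion_iff)
    then have "AE x in lborel. x \<notin> \<Omega>" by eventually_elim (use \<phi>(2) in force)
    then have "\<Omega> \<in> null_sets lborel" using assms(5) by (subst (asm) AE_iff_null_sets[symmetric]) auto
    then have "negligible \<Omega>" by (simp add: negligible_iff_null_sets null_sets_completionI)
    then show False using open_not_negligible assms(5,6) by blast
  qed
  then show "{w \<in> X0 p s \<Omega>. \<not> (AE x in lebesgue. w x = 0)} \<noteq> {}"
    using X0_borel_subset_X0[OF assms(1,5) \<phi>(1)] by auto
qed (auto intro!: divide_nonneg_nonneg Bochner_Integration.integral_nonneg simp: case_prod_beta')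

section \<open>Reduction of the theorem to Borel data\<close>

theorem theorem2p2:
  fixes s p q r l :: real
    and \<Omega> :: "(real^'n) set"
    and a b :: "real^'n \<Rightarrow> real"
  assumes "0 < s" "s < 1"
    and "real CARD('n) > p * s"
    and "open \<Omega>" "connected \<Omega>" "bounded \<Omega>" "smooth_boundary \<Omega>" "0 \<in> \<Omega>"
    and "0 < q" "q < 1" "q < p - 1" "p - 1 < r" "r < p_star (real CARD('n)) p s - 1"
    and "\<forall>x\<in>\<Omega>. a x > 0"
    and "a \<in> Lp (p_star (real CARD('n)) p s / (p_star (real CARD('n)) p s - 1 + q)) \<Omega>"
    and "\<not> (AE x in lebesgue_on \<Omega>. b x \<le> 0)"
    and "\<not> (AE x in lebesgue_on \<Omega>. b x \<ge> 0)"
    and "b \<in> Lp (p_star (real CARD('n)) p s / (p_star (real CARD('n)) p s - 1 - r)) \<Omega>"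
    and "0 < l" "l < Lambda p s q r \<Omega> a b"
  shows "\<exists>w W. weak_solution p s q r \<Omega> a b l w \<and> w \<in> nehari_plus p s q r \<Omega> a b l \<and>
               weak_solution p s q r \<Omega> a b l W \<and> W \<in> nehari_minus p s q r \<Omega> a b l \<and>
               X0_norm p s \<Omega> W > X0_norm p s \<Omega> w"
proof -
  define P where "P = p_star (real CARD('n)) p s"
  have p: "p > 1" "p > 0" and rP: "r + 1 < P" and P0: "P > 0" using assms by (auto simp: P_def)
  have \<Omega>[measurable]: "\<Omega> \<in> sets borel" using assms(4) by simp
  have ne: "\<Omega> \<noteq> {}" using assms(8) by auto
  define ma where "ma = P / (P - (1 - q))"
  define mb where "mb = P / (P - (r + 1))"
  have aL: "a \<in> Lp ma \<Omega>" and bL: "b \<in> Lp mb \<Omega>"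
    using assms(15,18) by (simp_all add: ma_def mb_def P_def[symmetric] algebra_simps)
  obtain a1 where a1: "a1 \<in> borel_measurable borel" "\<And>x. x \<notin> \<Omega> \<Longrightarrow> a1 x = 0" "AE x in lborel. x \<in> \<Omega> \<longrightarrow> a x = a1 x"
    by (rule borel_representative[OF \<Omega>, of a]) (use aL in \<open>simp add: Lp_def\<close>, rule that)
  obtain \<beta> where \<beta>[measurable]: "\<beta> \<in> borel_measurable borel" and \<beta>0: "\<And>x. x \<notin> \<Omega> \<Longrightarrow> \<beta> x = 0"
    and \<beta>eq: "AE x in lborel. x \<in> \<Omega> \<longrightarrow> b x = \<beta> x"
    by (rule borel_representative[OF \<Omega>, of b]) (use bL in \<open>simp add: Lp_def\<close>, rule that)
  \<comment> \<open>The Borel representative of \<open>a\<close> may fail to be positive on a null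
    subset of the domain; there it is reset to one, since the variational setting requires
    positivity at every point.\<close>
  define \<alpha> where "\<alpha> x = (if x \<in> \<Omega> then if a1 x > 0 then a1 x else 1 else 0)" for x
  have \<alpha>[measurable]: "\<alpha> \<in> borel_measurable borel" using a1(1) unfolding \<alpha>_def by measurable
  have \<alpha>eq: "AE x in lborel. x \<in> \<Omega> \<longrightarrow> a x = \<alpha> x"
    using a1(3) by eventually_elim (use assms(14) in \<open>auto simp: \<alpha>_def\<close>)
  have \<alpha>L: "integrable lborel (\<lambda>x. \<bar>\<alpha> x\<bar> powr ma)" "(LINT x|lebesgue_on \<Omega>. \<bar>a x\<bar> powr ma) = (LINT x|lborel. \<bar>\<alpha> x\<bar> powr ma)"
  proof -
    have e: "AE x in lborel. x \<in> \<Omega> \<longrightarrow> \<bar>a x\<bar> powr ma = \<bar>\<alpha> x\<bar> powr ma" using \<alpha>eq by eventually_elim simp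
    have m: "(\<lambda>x. \<bar>\<alpha> x\<bar> powr ma) \<in> borel_measurable borel" by measurable
    have z: "\<bar>\<alpha> x\<bar> powr ma = 0" if "x \<notin> \<Omega>" for x using that by (simp add: \<alpha>_def)
    have "integrable (lebesgue_on \<Omega>) (\<lambda>x. \<bar>a x\<bar> powr ma)" using aL by (simp add: Lp_def)
    moreover have "integrable (lebesgue_on \<Omega>) (\<lambda>x. \<bar>a x\<bar> powr ma) \<longleftrightarrow> integrable lborel (\<lambda>x. \<bar>\<alpha> x\<bar> powr ma)"
      by (rule lebesgue_on_transfer(2)[OF \<Omega> m z e])
    ultimately show "integrable lborel (\<lambda>x. \<bar>\<alpha> x\<bar> powr ma)" by simp
    show "(LINT x|lebesgue_on \<Omega>. \<bar>a x\<bar> powr ma) = (LINT x|lborel. \<bar>\<alpha> x\<bar> powr ma)"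
      by (rule lebesgue_on_transfer(3)[OF \<Omega> m z e])
  qed
  have \<beta>L: "integrable lborel (\<lambda>x. \<bar>\<beta> x\<bar> powr mb)" "(LINT x|lebesgue_on \<Omega>. \<bar>b x\<bar> powr mb) = (LINT x|lborel. \<bar>\<beta> x\<bar> powr mb)"
  proof -
    have e: "AE x in lborel. x \<in> \<Omega> \<longrightarrow> \<bar>b x\<bar> powr mb = \<bar>\<beta> x\<bar> powr mb" using \<beta>eq by eventually_elim simp
    have m: "(\<lambda>x. \<bar>\<beta> x\<bar> powr mb) \<in> borel_measurable borel" by measurable
    have z: "\<bar>\<beta> x\<bar> powr mb = 0" if "x \<notin> \<Omega>" for x using that by (simp add: \<beta>0)
    have "integrable (lebesgue_on \<Omega>) (\<lambda>x. \<bar>b x\<bar> powr mb)" using bL by (simp add: Lp_def)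
    moreover have "integrable (lebesgue_on \<Omega>) (\<lambda>x. \<bar>b x\<bar> powr mb) \<longleftrightarrow> integrable lborel (\<lambda>x. \<bar>\<beta> x\<bar> powr mb)"
      by (rule lebesgue_on_transfer(2)[OF \<Omega> m z e])
    ultimately show "integrable lborel (\<lambda>x. \<bar>\<beta> x\<bar> powr mb)" by simp
    show "(LINT x|lebesgue_on \<Omega>. \<bar>b x\<bar> powr mb) = (LINT x|lborel. \<bar>\<beta> x\<bar> powr mb)"
      by (rule lebesgue_on_transfer(3)[OF \<Omega> m z e])
  qed
  define S where "S = sobolev_S p s \<Omega>"
  have Lam: "Lambda p s q r \<Omega> a b = (p - 1 + q) / (r + q) * ((r - p + 1) / (r + q)) powr ((r - p + 1) / (p - 1 + q))
      * (1 / ((LINT x|lborel. \<bar>\<beta> x\<bar> powr mb) powr ((P - (r + 1)) / P)))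
      * (S powr (r + q) / ((LINT x|lborel. \<bar>\<alpha> x\<bar> powr ma) powr ((P - (1 - q)) / P)) powr (r - p + 1)) powr (1 / (p - 1 + q))"
  proof -
    have "P / (P - 1 + q) = ma" "P / (P - 1 - r) = mb" by (simp_all add: ma_def mb_def algebra_simps)
    moreover have "1 / ma = (P - (1 - q)) / P" "1 / mb = (P - (r + 1)) / P" by (simp_all add: ma_def mb_def)
    ultimately show ?thesis
      unfolding Lambda_def Let_def P_def[symmetric] Lp_norm_def S_def by (simp add: \<alpha>L(2) \<beta>L(2))
  qed
  have S: "S > 0"
  proof -
    have "S \<ge> 0" unfolding S_def by (rule sobolev_S_nonneg) (use assms p ne in auto)
    \<comment> \<open>\<open>S = 0\<close> would make \<open>Lambda\<close> zero through
      \<open>0 powr (r + q)\<close>, against \<open>0 < l\<close>. Hence the Sobolev embedding is a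
      consequence of the hypotheses on \<open>l\<close>.\<close>
    moreover have "S \<noteq> 0" using assms(19,20) assms(9-12) by (auto simp: Lam intro!: notI)
    ultimately show ?thesis by simp
  qed
  have bpos: "\<not> (AE x in lborel. \<beta> x \<le> 0)"
  proof
    assume "AE x in lborel. \<beta> x \<le> 0"
    with \<beta>eq have "AE x in lborel. x \<in> \<Omega> \<longrightarrow> b x \<le> 0" by eventually_elim auto
    then have "AE x in lebesgue_on \<Omega>. b x \<le> 0"
      using \<Omega> by (subst AE_restrict_space_iff) (auto simp: AE_completion_iff)
    then show False using assms(16) by blast
  qed
  interpret sp: singular_problem p s q r l S P \<Omega> \<alpha> \<beta>
  proof
    show "\<alpha> x > 0" if "x \<in> \<Omega>" for x using that by (simp add: \<alpha>_def)
    show "\<alpha> x = 0" if "x \<notin> \<Omega>" for x using that by (simp add: \<alpha>_def)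
    show "\<beta> x = 0" if "x \<notin> \<Omega>" for x using that by (rule \<beta>0)
    show "integrable lborel (\<lambda>x. \<bar>\<alpha> x\<bar> powr (P / (P - (1 - q))))" using \<alpha>L(1) by (simp add: ma_def)
    show "integrable lborel (\<lambda>x. \<bar>\<beta> x\<bar> powr (P / (P - (r + 1))))" using \<beta>L(1) by (simp add: mb_def)
    show "integrable lborel (\<lambda>x. \<bar>w x\<bar> powr P)" if "w \<in> X0_borel p s \<Omega>" for w
      by (rule sobolev_S_positive_imp(1)[OF p(2) assms(4) S[unfolded S_def] P_def P0 that])
    show "S * (LINT x|lborel. \<bar>w x\<bar> powr P) powr (p / P) \<le> energy p s w" if "w \<in> X0_borel p s \<Omega>" for w
      unfolding S_def by (rule sobolev_S_positive_imp(2)[OF p(2) assms(4) S[unfolded S_def] P_def P0 that])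
    show "l < (p - 1 + q) / (r + q) * ((r - p + 1) / (r + q)) powr ((r - p + 1) / (p - 1 + q))
         * (1 / nb) * (S powr (r + q) / na powr (r - p + 1)) powr (1 / (p - 1 + q))"
      if "na = (LINT x|lborel. \<bar>\<alpha> x\<bar> powr (P / (P - (1 - q)))) powr ((P - (1 - q)) / P)"
        "nb = (LINT x|lborel. \<bar>\<beta> x\<bar> powr (P / (P - (r + 1)))) powr ((P - (r + 1)) / P)" for na nb
      using assms(20) unfolding Lam ma_def mb_def that .
  qed (use assms rP S ne bpos in auto)
  have norm: "X0_norm p s \<Omega> w = sp.nrm w" if "w \<in> X0_borel p s \<Omega>" for w
    unfolding sp.nrm_def by (rule X0_norm_X0_borel[OF p(2) assms(4) that])
  have A: "(LINT x|lebesgue_on \<Omega>. a x * max (w x) 0 powr (1 - q)) = sp.A w"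
    and B: "(LINT x|lebesgue_on \<Omega>. b x * max (w x) 0 powr (r + 1)) = sp.B w" if w: "w \<in> X0_borel p s \<Omega>" for w
  proof -
    have [measurable]: "w \<in> borel_measurable borel" using w by (simp add: X0_borel_def)
    show "(LINT x|lebesgue_on \<Omega>. a x * max (w x) 0 powr (1 - q)) = sp.A w"
      unfolding sp.A_def
      by (rule lebesgue_on_transfer(3)[OF \<Omega>]) (use \<alpha>eq in \<open>auto simp: sp.a_zero elim: eventually_mono\<close>)
    show "(LINT x|lebesgue_on \<Omega>. b x * max (w x) 0 powr (r + 1)) = sp.B w"
      unfolding sp.B_def
      by (rule lebesgue_on_transfer(3)[OF \<Omega>]) (use \<beta>eq in \<open>auto simp: \<beta>0 elim: eventually_mono\<close>)
  qed
  have weak: "weak_solution p s q r \<Omega> a b l w"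
    if w: "w \<in> X0_borel p s \<Omega>" and st: "sp.stationary w" and pos: "\<And>x. x \<in> \<Omega> \<Longrightarrow> w x > 0" and w0: "\<And>x. w x \<ge> 0" for w
    unfolding weak_solution_def
  proof (intro conjI ballI)
    show "w \<in> X0 p s \<Omega>" by (rule X0_borel_subset_X0[OF p(2) assms(4) w])
    show "w x > 0" if "x \<in> \<Omega>" for x using pos that .
    \<comment> \<open>Test functions are arbitrary Lebesgue measurable elements; each integral is
      moved to the Borel representative \<open>v'\<close>.\<close>
    fix v assume "v \<in> X0 p s \<Omega>"
    then obtain v' where v': "v' \<in> X0_borel p s \<Omega>" and eq: "AE x in lborel. v x = v' x"
      by (rule X0_representative[OF p(2) assms(4)]) (rule that)
    have [measurable]: "w \<in> borel_measurable borel" "v' \<in> borel_measurable borel"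
      using w v' by (simp_all add: X0_borel_def)
    define G where "G z = \<bar>w (fst z) - w (snd z)\<bar> powr (p - 2) * (w (fst z) - w (snd z)) * (v' (fst z) - v' (snd z))" for z
    have Gm: "G \<in> borel_measurable borel" unfolding G_def by measurable
    have G0: "G z = 0" if "z \<notin> Q \<Omega>" for z
      using that X0_borel_zero[OF w] by (cases z) (auto simp: Q_def G_def)
    have e: "AE z in lborel. weak_integrand p s w v z = G z / norm (fst z - snd z) powr (real CARD('n) + p * s)"
      using AE_lborel_prod_fst[OF eq] AE_lborel_prod_snd[OF eq]
      by eventually_elim (simp add: weak_integrand_def G_def case_prod_beta')
    have TI: "integrable (lebesgue_on (Q \<Omega>)) (weak_integrand p s w v) \<longleftrightarrow> integrable (gagliardo p s) G"
      by (rule gagliardo_transfer(2)[OF assms(4) Gm G0 e])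
    have TE: "(LINT z|lebesgue_on (Q \<Omega>). weak_integrand p s w v z) = (LINT z|gagliardo p s. G z)"
      by (rule gagliardo_transfer(3)[OF assms(4) Gm G0 e])
    show "integrable (lebesgue_on (Q \<Omega>)) (weak_integrand p s w v)"
      unfolding TI G_def by (rule sp.weak_form_integrable[OF w v'])
    have ea: "AE x in lborel. x \<in> \<Omega> \<longrightarrow> a x * w x powr (- q) * v x = \<alpha> x * w x powr (- q) * v' x"
      using \<alpha>eq eq by eventually_elim simp
    have eb: "AE x in lborel. x \<in> \<Omega> \<longrightarrow> b x * w x powr r * v x = \<beta> x * max (w x) 0 powr r * v' x"
      using \<beta>eq eq by eventually_elim (simp add: w0 max_absorb1)
    have Ta: "integrable (lebesgue_on \<Omega>) (\<lambda>x. a x * w x powr (- q) * v x) \<longleftrightarrow> integrable lborel (\<lambda>x. \<alpha> x * w x powr (- q) * v' x)"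
      "(LINT x|lebesgue_on \<Omega>. a x * w x powr (- q) * v x) = (LINT x|lborel. \<alpha> x * w x powr (- q) * v' x)"
      by (rule lebesgue_on_transfer(2,3)[OF \<Omega> _ _ ea]; simp add: sp.a_zero)+
    have Tb: "integrable (lebesgue_on \<Omega>) (\<lambda>x. b x * w x powr r * v x) \<longleftrightarrow> integrable lborel (\<lambda>x. \<beta> x * max (w x) 0 powr r * v' x)"
      "(LINT x|lebesgue_on \<Omega>. b x * w x powr r * v x) = sp.reaction w v'"
      unfolding sp.reaction_def by (rule lebesgue_on_transfer(2,3)[OF \<Omega> _ _ eb]; simp add: \<beta>0)+
    show "integrable (lebesgue_on \<Omega>) (\<lambda>x. a x * w x powr (- q) * v x)"
      unfolding Ta by (rule sp.stationary_singular_integrable[OF st w w0 v'])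
    show "integrable (lebesgue_on \<Omega>) (\<lambda>x. b x * w x powr r * v x)"
      unfolding Tb by (rule sp.reaction_integrable[OF w v'])
    have "(LINT z|lebesgue_on (Q \<Omega>). weak_integrand p s w v z) = sp.weak_form w v'"
      unfolding TE G_def sp.weak_form_def ..
    then show "(LINT z|lebesgue_on (Q \<Omega>). weak_integrand p s w v z) =
        (LINT x|lebesgue_on \<Omega>. a x * w x powr (- q) * v x) + l * (LINT x|lebesgue_on \<Omega>. b x * w x powr r * v x)"
      unfolding Ta Tb using sp.stationary_weak_solution[OF st w w0 v'] by simp
  qed
  obtain w W where w: "w \<in> X0_borel p s \<Omega>" "sp.stationary w" "\<And>x. x \<in> \<Omega> \<Longrightarrow> w x > 0" "\<And>x. w x \<ge> 0"
      "(p - 1 + q) * sp.nrm w powr p > l * (r + q) * sp.B w" "sp.nrm w powr p = sp.A w + l * sp.B w"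
    and W: "W \<in> X0_borel p s \<Omega>" "sp.stationary W" "\<And>x. x \<in> \<Omega> \<Longrightarrow> W x > 0" "\<And>x. W x \<ge> 0"
      "(p - 1 + q) * sp.nrm W powr p < l * (r + q) * sp.B W" "sp.nrm W powr p = sp.A W + l * sp.B W"
    and less: "sp.nrm w < sp.nrm W"
    by (rule sp.two_solutions) (rule that)
  have X: "w \<in> X0 p s \<Omega>" "W \<in> X0 p s \<Omega>" using X0_borel_subset_X0[OF p(2) assms(4)] w(1) W(1) by auto
  show ?thesis
  proof (intro exI conjI)
    show "weak_solution p s q r \<Omega> a b l w" by (rule weak[OF w(1-4)])
    show "weak_solution p s q r \<Omega> a b l W" by (rule weak[OF W(1-4)])
    show "w \<in> nehari_plus p s q r \<Omega> a b l"
      using w(5,6) X(1) by (simp add: nehari_plus_def nehari_def norm[OF w(1)] A[OF w(1)] B[OF w(1)])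
    show "W \<in> nehari_minus p s q r \<Omega> a b l"
      using W(5,6) X(2) by (simp add: nehari_minus_def nehari_def norm[OF W(1)] A[OF W(1)] B[OF W(1)])
    show "X0_norm p s \<Omega> W > X0_norm p s \<Omega> w" using less by (simp add: norm w(1) W(1))
  qed
qed

end
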